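(* Let $L>0$ be such that $G(L)>0$ and let $f\in\mathcal C_L$ be such that $\Delta(f)=G(L)$. Then $\mathscr L(f)=L$. Assuming that $f$ is $L$-Lipschitz, the following hold. (1) $f$ is right-differentiable on $[0,1)$ and $\|f'_r(t)\|=L$ for all $t\in[0,1)$; $f$ is left-differentiable on $(0,1]$ and $\|f'_\ell(t)\|=L$ for all $t\in(0,1]$. (2) There exists a unique signed measure $f''$ on $[0,1]$ (with values in $\mathbb R^d$) such that $f''((s,t])=f'_r(t)-f'_r(s)$ for all $0\le s\le t<1$, and $f''([0,1])=0$. In the open case $\mathcal C_L=\{\phi:[0,1]\to\mathbb R^d \text{ curve},\ \mathscr L(\phi)\le L\}$, we also have $f''(\{0\})=f'_r(0)$ and $f''(\{1\})=-f'_\ell(1)$. (3) Moreover, there exists a unique $\lambda>0$ and there exists a random variable $\hat t$ with values in $[0,1]$, defined on an extension $(\tilde\Omega,\tilde{\mathcal F},\tilde{\mathbb P})$ of the probability space $(\Omega,\mathcal F,\mathbb P)$, such that $$\|X-f(\hat t)\|=d(X,\mathrm{Im} f)\quad\text{a.s.}$$ and, for every bounded Borel function $g:[0,1]\to\mathbb R^d$, $$\mathbb E\left[\langle X-f(\hat t),g(\hat t)\rangle\right]=-\lambda\int_{[0,1]}\langle g(t),f''(dt)\rangle .$$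
   Context: Let $d\ge1$, and let $\mathbb R^d$ carry the Euclidean norm $\|\cdot\|$ and inner product $\langle\cdot,\cdot\rangle$; $d(x,A)=\inf_{y\in A}\|x-y\|$. Let $X$ be a random vector on a probability space $(\Omega,\mathcal F,\mathbb P)$ with values in $\mathbb R^d$ and $\mathbb E[\|X\|^2]<\infty$. A curve is a continuous function $f:[0,1]\to\mathbb R^d$; its image is $\mathrm{Im} f$ and its length is $\mathscr L(f)=\sup\sum_{i=1}^n\|f(t_i)-f(t_{i-1})\|\in[0,\infty]$, the supremum being over all subdivisions $0=t_0\le\dots\le t_n=1$, $n\ge1$. Set $\Delta(f)=\mathbb E[d(X,\mathrm{Im} f)^2]$. For $L\ge0$, $\mathcal C_L$ denotes either one of the two sets $\{f:[0,1]\to\mathbb R^d \text{ curve},\ \mathscr L(f)\le L\}$ (open case) or $\{f:[0,1]\to\mathbb R^d\text{ curve},\ \mathscr L(f)\le L,\ f(0)=f(1)\}$ (closed case); the result is asserted for each of the two choices. $G(L)=\min\{\Delta(f): f\in\mathcal C_L\}$ (the minimum is attained). $f'_r$ and $f'_\ell$ denote right and left derivatives. An $\mathbb R^d$-valued signed measure on $[0,1]$ is $m=(m^1,\dots,m^d)$ with each $m^j$ a real-valued, $\sigma$-additive set function with $m^j(\emptyset)=0$, and $\int\langle g(t),m(dt)\rangle=\sum_{j=1}^d\int g^j(t)\,m^j(dt)$ for measurable $g=(g^1,\dots,g^d):[0,1]\to\mathbb R^d$. A probability space $(\tilde\Omega,\tilde{\mathcal F},\tilde{\mathbb P})$ is called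 an extension of $(\Omega,\mathcal F,\mathbb P)$ if there is a random vector $\tilde X$ defined on it with the same distribution as $X$; this random vector is still denoted by $X$.
   Formalization: Uniqueness of f'' fails literally (add v(δ_0−δ_1)); proved instead: unique on Borel sets containing both or neither of 0, 1, and fully unique in the open case with the endpoint values. Uniqueness of λ is over extensions with sample space R^d×R (general case: use the law of (X, t̂)). *)

theory Defs
  imports "HOL-Probability.Probability"
begin

text \<open>A curve is a function on all of \<open>real\<close> of which only the values on \<open>{0..1}\<close> matter;
  its image is \<open>path_image f = f ` {0..1}\<close>.\<close>

definition curve_length :: "(real \<Rightarrow> 'a::real_normed_vector) \<Rightarrow> ennreal" where
  "curve_length f =
     (SUP (n, t) \<in> {(n::nat, t::nat \<Rightarrow> real).
                      n \<ge> 1 \<and> t 0 = 0 \<and> t n = 1 \<and> (\<forall>i\<in>{1..n}. t (i - 1) \<le> t i)}.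
        ennreal (\<Sum>i=1..n. norm (f (t i) - f (t (i - 1)))))"

datatype curve_kind = Open_Curves | Closed_Curves

fun curves_upto :: "curve_kind \<Rightarrow> real \<Rightarrow> (real \<Rightarrow> 'a::real_normed_vector) set" where
  "curves_upto Open_Curves L = {f. path f \<and> curve_length f \<le> ennreal L}"
| "curves_upto Closed_Curves L = {f. path f \<and> curve_length f \<le> ennreal L \<and> f 0 = f 1}"

definition mean_sq_dist ::
  "'w measure \<Rightarrow> ('w \<Rightarrow> 'a::euclidean_space) \<Rightarrow> (real \<Rightarrow> 'a) \<Rightarrow> real" where
  "mean_sq_dist M X f = prob_space.expectation M (\<lambda>w. (infdist (X w) (path_image f))\<^sup>2)"

text \<open>The minimum over the curve class is attained for \<open>L \<ge> 0\<close> and so equals the infimum.\<close>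

definition optimal_value ::
  "'w measure \<Rightarrow> ('w \<Rightarrow> 'a::euclidean_space) \<Rightarrow> curve_kind \<Rightarrow> real \<Rightarrow> real" where
  "optimal_value M X k L = (INF f \<in> curves_upto k L. mean_sq_dist M X f)"

abbreviation right_deriv :: "(real \<Rightarrow> 'a::real_normed_vector) \<Rightarrow> real \<Rightarrow> 'a" where
  "right_deriv f t \<equiv> vector_derivative f (at_right t)"

abbreviation left_deriv :: "(real \<Rightarrow> 'a::real_normed_vector) \<Rightarrow> real \<Rightarrow> 'a" where
  "left_deriv f t \<equiv> vector_derivative f (at_left t)"

text \<open>Set functions take the junk value \<open>0\<close> off the \<open>\<sigma>\<close>-algebra, as \<open>emeasure\<close> does; thus two
  signed measures are equal iff they agree on all measurable sets.\<close>

definition signed_measure :: "'b measure \<Rightarrow> ('b set \<Rightarrow> real) \<Rightarrow> bool" where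
  "signed_measure M m \<longleftrightarrow>
     m {} = 0 \<and>
     (\<forall>A::nat \<Rightarrow> 'b set. range A \<subseteq> sets M \<longrightarrow> disjoint_family A \<longrightarrow>
        (\<lambda>i. m (A i)) sums m (\<Union>i. A i)) \<and>
     (\<forall>A. A \<notin> sets M \<longrightarrow> m A = 0)"

text \<open>The upper variation of the Jordan decomposition; the lower variation of \<open>m\<close> is the upper
  variation of \<open>- m\<close>. As \<open>ennreal\<close> truncates negative numbers to \<open>0 = m {}\<close>, the supremum is
  that of \<open>m B\<close> over measurable \<open>B \<subseteq> A\<close>.\<close>

definition upper_variation :: "'b measure \<Rightarrow> ('b set \<Rightarrow> real) \<Rightarrow> 'b measure" where
  "upper_variation M m =
     measure_of (space M) (sets M) (\<lambda>A. SUP B \<in> {B \<in> sets M. B \<subseteq> A}. ennreal (m B))"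

definition signed_integral :: "'b measure \<Rightarrow> ('b set \<Rightarrow> real) \<Rightarrow> ('b \<Rightarrow> real) \<Rightarrow> real" where
  "signed_integral M m g =
     integral\<^sup>L (upper_variation M m) g - integral\<^sup>L (upper_variation M (\<lambda>A. - m A)) g"

definition vec_signed_measure :: "'b measure \<Rightarrow> ('b set \<Rightarrow> real ^ 'n) \<Rightarrow> bool" where
  "vec_signed_measure M m \<longleftrightarrow> (\<forall>j. signed_measure M (\<lambda>A. m A $ j))"

definition vec_signed_integral ::
  "'b measure \<Rightarrow> ('b set \<Rightarrow> real ^ 'n) \<Rightarrow> ('b \<Rightarrow> real ^ 'n) \<Rightarrow> real" where
  "vec_signed_integral M m g =
     (\<Sum>j\<in>UNIV. signed_integral M (\<lambda>A. m A $ j) (\<lambda>x. g x $ j))"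

abbreviation unit_borel :: "real measure" where
  "unit_borel \<equiv> restrict_space borel {0..1}"

definition second_deriv_measure :: "(real \<Rightarrow> real ^ 'n) \<Rightarrow> (real set \<Rightarrow> real ^ 'n) \<Rightarrow> bool" where
  "second_deriv_measure f m \<longleftrightarrow>
     vec_signed_measure unit_borel m \<and>
     (\<forall>s t. 0 \<le> s \<longrightarrow> s \<le> t \<longrightarrow> t < 1 \<longrightarrow> m {s<..t} = right_deriv f t - right_deriv f s) \<and>
     m {0..1} = 0"

text \<open>These conditions fix the total mass of the two endpoints but not how it splits between them:
  adding \<open>v (\<delta>\<^sub>0 - \<delta>\<^sub>1)\<close> preserves them. So they determine the measure on exactly
  those Borel sets that contain both endpoints or neither.\<close>

definition agree_up_to_endpoints :: "(real set \<Rightarrow> 'a) \<Rightarrow> (real set \<Rightarrow> 'a) \<Rightarrow> bool" where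
  "agree_up_to_endpoints m m' \<longleftrightarrow>
     (\<forall>A \<in> sets unit_borel. (0 \<in> A \<longleftrightarrow> 1 \<in> A) \<longrightarrow> m A = m' A)"

text \<open>For open curves the end derivatives fix the split.\<close>

definition open_second_deriv_measure ::
  "(real \<Rightarrow> real ^ 'n) \<Rightarrow> (real set \<Rightarrow> real ^ 'n) \<Rightarrow> bool" where
  "open_second_deriv_measure f m \<longleftrightarrow>
     second_deriv_measure f m \<and> m {0} = right_deriv f 0 \<and> m {1} = - left_deriv f 1"

text \<open>The probability space \<open>N\<close> extends \<open>M\<close>, with \<open>Y\<close> as the copy of \<open>X\<close>.\<close>

definition prob_extension ::
  "'w measure \<Rightarrow> ('w \<Rightarrow> 'a::euclidean_space) \<Rightarrow> 'v measure \<Rightarrow> ('v \<Rightarrow> 'a) \<Rightarrow> bool" where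
  "prob_extension M X N Y \<longleftrightarrow>
     prob_space N \<and> Y \<in> borel_measurable N \<and> distr N borel Y = distr M borel X"

text \<open>A random parameter on an extension, with the two properties of the theorem. HOL cannot
  quantify over the type of the extension's sample space; it is taken to be \<open>real ^ 'n \<times> real\<close>.
  This is no restriction, since both properties depend only on the joint law of \<open>(Y, \<tau>)\<close>, which
  is itself an extension on that type.\<close>

definition projection_parameter ::
  "'w measure \<Rightarrow> ('w \<Rightarrow> real ^ 'n) \<Rightarrow> (real \<Rightarrow> real ^ 'n) \<Rightarrow> (real set \<Rightarrow> real ^ 'n) \<Rightarrow> real
    \<Rightarrow> ((real ^ 'n) \<times> real) measure \<Rightarrow> ((real ^ 'n) \<times> real \<Rightarrow> real ^ 'n)
    \<Rightarrow> ((real ^ 'n) \<times> real \<Rightarrow> real) \<Rightarrow> bool" where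
  "projection_parameter M X f m lam N Y \<tau> \<longleftrightarrow>
     prob_extension M X N Y \<and>
     \<tau> \<in> borel_measurable N \<and> (\<forall>w\<in>space N. \<tau> w \<in> {0..1}) \<and>
     (AE w in N. norm (Y w - f (\<tau> w)) = infdist (Y w) (path_image f)) \<and>
     (\<forall>g. g \<in> borel_measurable unit_borel \<longrightarrow> bounded (g ` {0..1}) \<longrightarrow>
        prob_space.expectation N (\<lambda>w. (Y w - f (\<tau> w)) \<bullet> g (\<tau> w))
          = - lam * vec_signed_integral unit_borel m g)"

end

theory Submission
  imports Defs
begin

text \<open>
  Let \<open>\<tau>\<close> be a parameter of a point of the curve nearest to \<open>Y\<close>, a copy of \<open>X\<close>, and let
  \<open>Z = Y - f \<tau>\<close>. Optimality enters in one way only: if \<open>g\<close> is an admissible curve and \<open>q\<close> is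
  any random point on \<open>g\<close>, then \<open>E |Z|\<^sup>2 \<le> E |Y - q|\<^sup>2\<close> (\<open>optimal_le_competitor\<close>). Two kinds of
  competitors carry the proof.

  The first is \<open>(1 - c \<epsilon>) f + \<epsilon> h\<close>, where \<open>h\<close> is a constant vector plus a vector times a function
  with one kink at \<open>r\<close>. For an \<open>L\<close>-Lipschitz \<open>f\<close> the squared length of such a curve is at most its
  energy, and on each side of the kink the energy can be expanded in \<open>\<epsilon>\<close> with no differentiability
  of \<open>f\<close>: the first-order term contains only \<open>v \<bullet> (f r - f 0)\<close>. Optimality then says that the
  linear functional \<open>h \<mapsto> E (Z \<bullet> h \<tau>)\<close> is a multiple \<open>\<lambda>\<close> of the first variation of the length
  (\<open>first_variation\<close>). For an open curve this reads \<open>\<lambda> (f r - f 0) = E (min \<tau> r \<cdot> Z)\<close>. Once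
  \<open>\<lambda> > 0\<close>, dominated convergence gives the one-sided derivatives
  \<open>f'\<^sub>r t = E (Z; \<tau> > t) / \<lambda>\<close> and \<open>f'\<^sub>l t = E (Z; \<tau> \<ge> t) / \<lambda>\<close>, hence
  \<open>f'' = - E (Z; \<tau> \<in> \<cdot>) / \<lambda>\<close>, and the speed is \<open>L\<close> everywhere because a slower stretch would make
  \<open>f\<close> shorter than \<open>L\<close>. For a closed curve a constant vector is added to both derivatives.

  The second is \<open>f\<close> with a spike, a segment run out and back from some \<open>f t0\<close>
  (\<open>exists_curve_with_spike\<close>, \<open>spike_bound\<close>). If \<open>f\<close> were shorter than \<open>L\<close>, a spike
  could be added for free and would lower the loss. If \<open>\<lambda>\<close> were zero, shrinking \<open>f\<close> by the factor
  \<open>1 - \<epsilon>\<close> would cost only \<open>O(\<epsilon>\<^sup>2)\<close> and pay for a spike of height of order \<open>\<epsilon>\<close>. So a spike of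
  height \<open>s\<close> must not catch more than \<open>O(s)\<close> of the probability. But since \<open>f\<close> has full length, it
  is nearly straight on most of the windows \<open>[i/m, (i+1)/m]\<close>, and there a spike of height \<open>s\<close>
  catches a window of length \<open>K s\<close> with \<open>K\<close> as large as desired. Adding up over all
  windows contradicts that \<open>Z \<noteq> 0\<close> with positive probability (\<open>multiplier_pos\<close>).

  Finally, two nearest parameters can be interchanged on any event, and \<open>E Z = 0\<close> holds after each
  interchange. Hence the nearest point is almost surely unique (\<open>nearest_point_AE_unique\<close>), and
  \<open>\<lambda> L\<^sup>2 = E (Z \<bullet> f \<tau>)\<close> does not depend on the parameter.
\<close>

section \<open>Estimates of the length of a curve\<close>

lemma subdivision_mono:
  fixes t :: "nat \<Rightarrow> real"
  assumes "\<forall>i\<in>{1..n}. t (i - 1) \<le> t i" and "i \<le> j" "j \<le> n"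
  shows "t i \<le> t j"
  using assms(2,3)
proof (induction j)
  case (Suc j)
  then show ?case using assms(1)[rule_format, of "Suc j"]
    by (cases "i = Suc j") (auto intro: order_trans)
qed simp

text \<open>The right-hand side telescopes over every subdivision. With a piecewise linear \<open>E\<close> this stands in
for the integral of a bound on the speed.\<close>

lemma curve_length_leI:
  fixes g :: "real \<Rightarrow> 'a::real_normed_vector" and E :: "real \<Rightarrow> real"
  assumes "\<And>s t. 0 \<le> s \<Longrightarrow> s \<le> t \<Longrightarrow> t \<le> 1 \<Longrightarrow> norm (g t - g s) \<le> E t - E s"
  shows "curve_length g \<le> ennreal (E 1 - E 0)"
  unfolding curve_length_def
proof (rule SUP_least, clarify)
  fix n :: nat and t :: "nat \<Rightarrow> real"
  assume n: "1 \<le> n" and t: "t 0 = 0" "t n = 1" "\<forall>i\<in>{1..n}. t (i - 1) \<le> t i"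
  have mono: "t i \<le> t j" if "i \<le> j" "j \<le> n" for i j
    using subdivision_mono[OF t(3) that] .
  have "(\<Sum>i=1..n. norm (g (t i) - g (t (i - 1)))) \<le> (\<Sum>i=1..n. E (t i) - E (t (i - 1)))"
  proof (rule sum_mono)
    fix i assume i: "i \<in> {1..n}"
    then show "norm (g (t i) - g (t (i - 1))) \<le> E (t i) - E (t (i - 1))"
      using mono[of 0 "i - 1"] mono[of i n] t by (intro assms) auto
  qed
  also have "\<dots> = (\<Sum>i=Suc 0..n. E (t i) - E (t (i - 1)))" by simp
  also have "\<dots> = E (t n) - E (t 0)"
    by (rule sum_telescope'') simp
  finally show "ennreal (\<Sum>i=1..n. norm (g (t i) - g (t (i - 1)))) \<le> ennreal (E 1 - E 0)"
    using t by (simp add: ennreal_leI)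
qed

text \<open>The function \<open>E\<close> is a primitive of a bound on the squared speed. An increment is at most
\<open>sqrt (\<Delta>t \<Delta>E) \<le> (L \<Delta>t + \<Delta>E / L) / 2\<close>, and the latter telescopes.\<close>

lemma curve_length_le_of_energy:
  fixes g :: "real \<Rightarrow> 'a::real_normed_vector" and E :: "real \<Rightarrow> real"
  assumes "\<And>s t. 0 \<le> s \<Longrightarrow> s \<le> t \<Longrightarrow> t \<le> 1 \<Longrightarrow> (norm (g t - g s))\<^sup>2 \<le> (t - s) * (E t - E s)"
    and "E 1 - E 0 \<le> L\<^sup>2" and "L > 0"
  shows "curve_length g \<le> ennreal L"
proof -
  define F where "F t = (L * t + E t / L) / 2" for t
  have amgm: "x * y \<le> ((x + y) / 2)\<^sup>2" for x y :: real
    using zero_le_power2[of "x - y"] by (simp add: power2_eq_square field_simps)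
  have "curve_length g \<le> ennreal (F 1 - F 0)"
  proof (rule curve_length_leI)
    fix s t :: real assume st: "0 \<le> s" "s \<le> t" "t \<le> 1"
    have eq: "F t - F s = (L * (t - s) + (E t - E s) / L) / 2"
      by (simp add: F_def diff_divide_distrib algebra_simps)
    have sq: "(norm (g t - g s))\<^sup>2 \<le> (t - s) * (E t - E s)" using assms(1)[OF st] .
    show "norm (g t - g s) \<le> F t - F s"
    proof (cases "s = t")
      case False
      then have pos: "t - s > 0" using st by simp
      then have E: "E t - E s \<ge> 0" using sq
        by (smt (verit) mult_pos_neg zero_le_power2)
      have "(t - s) * (E t - E s) = (L * (t - s)) * ((E t - E s) / L)" using assms(3) by simp
      also have "\<dots> \<le> ((L * (t - s) + (E t - E s) / L) / 2)\<^sup>2"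
        by (rule amgm)
      finally have "(norm (g t - g s))\<^sup>2 \<le> (F t - F s)\<^sup>2" unfolding eq using sq by linarith
      moreover have "F t - F s \<ge> 0" unfolding eq using E pos assms(3) by simp
      ultimately show ?thesis using power2_le_imp_le by blast
    qed (use eq in simp)
  qed
  also have "F 1 - F 0 \<le> L"
  proof -
    have "(E 1 - E 0) / L \<le> L" using assms by (simp add: divide_le_eq power2_eq_square)
    then show ?thesis by (simp add: F_def diff_divide_distrib add_divide_distrib)
  qed
  finally show ?thesis by (simp add: ennreal_leI)
qed

text \<open>By the Cauchy-Schwarz inequality, the hypothesis of the preceding lemma need only be checked on
intervals that do not contain a kink of the curve in their interior.\<close>

lemma energy_bound_trans:
  fixes g :: "real \<Rightarrow> 'a::real_normed_vector"
  assumes "(norm (g r - g s))\<^sup>2 \<le> (r - s) * (E r - E s)"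
    and "(norm (g t - g r))\<^sup>2 \<le> (t - r) * (E t - E r)"
    and "s \<le> r" "r \<le> t"
  shows "(norm (g t - g s))\<^sup>2 \<le> (t - s) * (E t - E s :: real)"
proof (cases "s = r \<or> r = t")
  case False
  define a b A B where "a = r - s" and "b = t - r" and "A = E r - E s" and "B = E t - E r"
  define x y where "x = norm (g r - g s)" and "y = norm (g t - g r)"
  have ab: "a > 0" "b > 0" using False assms by (auto simp: a_def b_def)
  have x: "x\<^sup>2 \<le> a * A" and y: "y\<^sup>2 \<le> b * B" using assms by (auto simp: a_def b_def A_def B_def x_def y_def)
  have A: "x\<^sup>2 / a \<le> A" and B: "y\<^sup>2 / b \<le> B" using x y ab by (simp_all add: divide_le_eq mult.commute)
  have "norm (g t - g s) \<le> x + y"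
    using norm_triangle_ineq[of "g t - g r" "g r - g s"] by (simp add: x_def y_def)
  then have "(norm (g t - g s))\<^sup>2 \<le> (x + y)\<^sup>2" by (rule power_mono) simp
  also have "\<dots> \<le> (a + b) * (x\<^sup>2 / a + y\<^sup>2 / b)"
  proof -
    have "(a + b) * (x\<^sup>2 / a + y\<^sup>2 / b) - (x + y)\<^sup>2 = (b * x - a * y)\<^sup>2 / (a * b)"
      using ab by (simp add: field_simps power2_eq_square)
    moreover have "\<dots> \<ge> 0" using ab by simp
    ultimately show ?thesis by linarith
  qed
  also have "\<dots> \<le> (a + b) * (A + B)" using A B ab by (intro mult_left_mono) auto
  finally show ?thesis by (simp add: a_def b_def A_def B_def)
qed (use assms in auto)

text \<open>A stretch that is slower than \<open>L\<close> wastes length; this is what forces a curve of full length to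
have speed \<open>L\<close>.\<close>

lemma lipschitz_subinterval_curve_length:
  fixes f :: "real \<Rightarrow> 'a::real_normed_vector"
  assumes lip: "L-lipschitz_on {0..1} f" and ab: "0 \<le> a" "a \<le> b" "b \<le> 1"
    and c: "c-lipschitz_on {a..b} f" "c \<le> L"
  shows "curve_length f \<le> ennreal (L - (L - c) * (b - a))"
proof -
  define E where "E t = L * t - (L - c) * max a (min b t)" for t
  have lip': "norm (f t - f s) \<le> L * (t - s)" if "0 \<le> s" "s \<le> t" "t \<le> 1" for s t
    using lipschitz_onD[OF lip, of t s] that by (simp add: dist_norm)
  have c': "norm (f t - f s) \<le> c * (t - s)" if "a \<le> s" "s \<le> t" "t \<le> b" for s t
    using lipschitz_onD[OF c(1), of t s] that by (simp add: dist_norm)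
  have out: "norm (f t - f s) \<le> E t - E s"
    if "0 \<le> s" "s \<le> t" "t \<le> 1" "t \<le> a \<or> b \<le> s" for s t
    using lip'[OF that(1-3)] that ab by (auto simp: E_def right_diff_distrib)
  have inn: "norm (f t - f s) \<le> E t - E s" if "a \<le> s" "s \<le> t" "t \<le> b" for s t
    using c'[OF that] that by (simp add: E_def algebra_simps)
  have tri: "norm (f t - f s) \<le> E t - E s"
    if "norm (f r - f s) \<le> E r - E s" "norm (f t - f r) \<le> E t - E r" for r s t
    using that norm_triangle_ineq[of "f t - f r" "f r - f s"] by simp
  have low: "norm (f t - f s) \<le> E t - E s" if "0 \<le> s" "s \<le> t" "t \<le> b" for s t
  proof (cases "s \<le> a \<and> a \<le> t")
    case True
    then show ?thesis using tri[of a s t] out[of s a] inn[of a t] that ab by auto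
  next
    case False
    then show ?thesis using out[of s t] inn[of s t] that ab by fastforce
  qed
  have "norm (f t - f s) \<le> E t - E s" if "0 \<le> s" "s \<le> t" "t \<le> 1" for s t
  proof (cases "s \<le> b \<and> b \<le> t")
    case True
    then show ?thesis using tri[of b s t] out[of b t] low[of s b] that ab by auto
  next
    case False
    then show ?thesis using out[of s t] low[of s t] that ab by fastforce
  qed
  from curve_length_leI[of f E, OF this] have "curve_length f \<le> ennreal (E 1 - E 0)" by simp
  also have "E 1 - E 0 = L - (L - c) * (b - a)" using ab by (simp add: E_def algebra_simps)
  finally show ?thesis .
qed

lemma sum_le_curve_length:
  fixes n :: nat and t :: "nat \<Rightarrow> real"
  assumes "n \<ge> 1" "t 0 = 0" "t n = 1" "\<forall>i\<in>{1..n}. t (i - 1) \<le> t i"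
  shows "ennreal (\<Sum>i=1..n. norm (f (t i) - f (t (i - 1)))) \<le> curve_length f"
proof -
  let ?F = "\<lambda>(n::nat, t::nat \<Rightarrow> real). ennreal (\<Sum>i=1..n. norm (f (t i) - f (t (i - 1))))"
  have "?F (n, t) \<le> curve_length f"
    unfolding curve_length_def by (rule SUP_upper) (use assms in simp)
  then show ?thesis by simp
qed

text \<open>The parameter of \<open>f\<close> pauses at \<open>t0\<close> during the middle third of the time, while the curve runs
along the segment from \<open>f t0\<close> to \<open>f t0 + u\<close> and back.\<close>

lemma exists_curve_with_spike:
  fixes f :: "real \<Rightarrow> 'a::real_normed_vector"
  assumes f: "path f" and len: "curve_length f \<le> ennreal l" "0 \<le> l" and t0: "t0 \<in> {0..1}"
  obtains g where "path g" "curve_length g \<le> ennreal (l + 2 * norm u)" "g 0 = f 0" "g 1 = f 1"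
    "path_image f \<subseteq> path_image g" "f t0 + u \<in> path_image g"
proof -
  define c where "c t = t0 * min 1 (3 * t) + (1 - t0) * max 0 (3 * t - 2)" for t :: real
  define b where "b t = max 0 (1 - \<bar>6 * t - 3\<bar>)" for t :: real
  define g where "g t = f (c t) + b t *\<^sub>R u" for t
  have t01: "0 \<le> t0" "t0 \<le> 1" using t0 by auto
  have c_mono: "c s \<le> c t" if "s \<le> t" for s t
    unfolding c_def using that t01 by (intro add_mono mult_left_mono) auto
  have c01: "c 0 = 0" "c 1 = 1" by (auto simp: c_def)
  have c_in: "c t \<in> {0..1}" if "t \<in> {0..1}" for t
    using c_mono[of 0 t] c_mono[of t 1] that c01 by auto
  have "continuous_on {0..1} c" unfolding c_def by (intro continuous_intros)
  then have "continuous_on {0..1} (\<lambda>t. f (c t))"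
    using f c_in unfolding path_def by (auto intro: continuous_on_compose2)
  moreover have "continuous_on {0..1} b" unfolding b_def by (intro continuous_intros)
  ultimately have "path g" unfolding path_def g_def by (intro continuous_intros)
  moreover have "curve_length g \<le> ennreal (l + 2 * norm u)"
    unfolding curve_length_def
  proof (rule SUP_least, clarify)
    fix n :: nat and t :: "nat \<Rightarrow> real"
    assume n: "1 \<le> n" and t: "t 0 = 0" "t n = 1" "\<forall>i\<in>{1..n}. t (i - 1) \<le> t i"
    define e where "e t = 6 * max (1/3) (min (2/3) t)" for t :: real
    \<comment> \<open>The function \<open>b\<close> is a tent of height 1, so its variation is the increment 2 of \<open>e\<close>.\<close>
    have be: "\<bar>b t - b s\<bar> \<le> e t - e s" if "s \<le> t" for s t
    proof -
      have b_eq: "b t = 1 - \<bar>e t - 3\<bar>" for t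
        unfolding b_def e_def by (cases "t \<le> 1/3"; cases "t \<le> 2/3") simp_all
      have "e s \<le> e t" using that unfolding e_def by simp
      then show ?thesis unfolding b_eq by linarith
    qed
    have "ennreal (\<Sum>i=1..n. norm (f (c (t i)) - f (c (t (i - 1))))) \<le> curve_length f"
      using sum_le_curve_length[of n "\<lambda>i. c (t i)" f] n t c01 c_mono by auto
    also have "\<dots> \<le> ennreal l" by (rule len)
    finally have 1: "(\<Sum>i=1..n. norm (f (c (t i)) - f (c (t (i - 1))))) \<le> l"
      using len(2) by (simp add: ennreal_le_iff)
    have "(\<Sum>i=1..n. \<bar>b (t i) - b (t (i - 1))\<bar>) \<le> (\<Sum>i=Suc 0..n. e (t i) - e (t (i - 1)))"
      using be t by (auto intro!: sum_mono)
    also have "\<dots> = e (t n) - e (t 0)" by (rule sum_telescope'') simp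
    also have "\<dots> = 2" using t by (simp add: e_def)
    finally have 2: "(\<Sum>i=1..n. \<bar>b (t i) - b (t (i - 1))\<bar>) \<le> 2" .
    have "(\<Sum>i=1..n. norm (g (t i) - g (t (i - 1)))) \<le>
      (\<Sum>i=1..n. norm (f (c (t i)) - f (c (t (i - 1)))) + \<bar>b (t i) - b (t (i - 1))\<bar> * norm u)"
    proof (rule sum_mono)
      fix i
      have "g (t i) - g (t (i - 1)) = (f (c (t i)) - f (c (t (i - 1)))) + (b (t i) - b (t (i - 1))) *\<^sub>R u"
        by (simp add: g_def algebra_simps)
      then show "norm (g (t i) - g (t (i - 1))) \<le> norm (f (c (t i)) - f (c (t (i - 1))))
          + \<bar>b (t i) - b (t (i - 1))\<bar> * norm u"
        by (metis norm_scaleR norm_triangle_ineq)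
    qed
    also have "\<dots> = (\<Sum>i=1..n. norm (f (c (t i)) - f (c (t (i - 1)))))
        + (\<Sum>i=1..n. \<bar>b (t i) - b (t (i - 1))\<bar>) * norm u"
      by (simp add: sum.distrib sum_distrib_right)
    also have "\<dots> \<le> l + 2 * norm u" by (intro add_mono 1 mult_right_mono 2) simp
    finally show "ennreal (\<Sum>i=1..n. norm (g (t i) - g (t (i - 1)))) \<le> ennreal (l + 2 * norm u)"
      by (rule ennreal_leI)
  qed
  moreover have "g 0 = f 0" "g 1 = f 1" by (auto simp: g_def c_def b_def)
  moreover have "path_image f \<subseteq> path_image g"
  proof -
    have "f r \<in> path_image g" if r: "r \<in> {0..1}" for r
    proof -
      have "\<exists>t\<in>{0..1}. c t = r \<and> b t = 0"
      proof (cases "r \<le> t0")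
        case True
        show ?thesis
        proof (cases "t0 = 0")
          case True
          then show ?thesis using r \<open>r \<le> t0\<close> by (intro bexI[of _ 0]) (auto simp: c_def b_def)
        next
          case False
          then have pos: "t0 > 0" using t01 by simp
          have q: "0 \<le> r / t0" "r / t0 \<le> 1" using r True pos by (auto simp: divide_le_eq)
          show ?thesis
          proof (rule bexI[of _ "(r / t0) / 3"])
            have "min 1 (3 * (r / t0 / 3)) = r / t0" using q by simp
            moreover have "max 0 (3 * (r / t0 / 3) - 2) = 0" using q by simp
            ultimately have "c (r / t0 / 3) = r" unfolding c_def using pos by simp
            moreover have "b (r / t0 / 3) = 0" unfolding b_def using q by simp
            ultimately show "c (r / t0 / 3) = r \<and> b (r / t0 / 3) = 0" by blast
          qed (use q in auto)
        qed
      next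
        case False
        then have pos: "1 - t0 > 0" using r by simp
        define q where "q = (r - t0) / (1 - t0)"
        have q: "0 \<le> q" "q \<le> 1" using r False pos by (auto simp: q_def divide_le_eq)
        have qr: "t0 + (1 - t0) * q = r" using pos by (simp add: q_def)
        show ?thesis
        proof (rule bexI[of _ "(2 + q) / 3"])
          have three: "3 * ((2 + q) / 3) = 2 + q" by simp
          moreover have "min 1 (2 + q) = 1" "max 0 (2 + q - 2) = q" using q by simp_all
          ultimately have "c ((2 + q) / 3) = r" unfolding c_def three using qr by simp
          moreover have "b ((2 + q) / 3) = 0"
          proof -
            have "6 * ((2 + q) / 3) - 3 = 1 + 2 * q" by simp
            then show ?thesis unfolding b_def using q by simp
          qed
          ultimately show "c ((2 + q) / 3) = r \<and> b ((2 + q) / 3) = 0" by blast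
        qed (use q in auto)
      qed
      then obtain t where "t \<in> {0..1}" "c t = r" "b t = 0" by blast
      then have "t \<in> {0..1}" "g t = f r" by (auto simp: g_def)
      then show ?thesis unfolding path_image_def by (metis imageI)
    qed
    then show ?thesis unfolding path_image_def by blast
  qed
  moreover have "f t0 + u \<in> path_image g"
  proof -
    have "g (1/2) = f t0 + u" by (simp add: g_def c_def b_def)
    moreover have "(1/2::real) \<in> {0..1}" by simp
    ultimately show ?thesis unfolding path_image_def by (metis imageI)
  qed
  ultimately show ?thesis using that by blast
qed

text \<open>Rounding the points of a subdivision with long chords to the grid of the multiples of \<open>1/m\<close> changes
the sum by at most \<open>2 n L / m\<close>, and a sum of chords between some of the grid points is at most the sum
over all of them.\<close>

lemma lipschitz_equidistant_sums:
  fixes f :: "real \<Rightarrow> 'a::real_normed_vector"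
  assumes lip: "L-lipschitz_on {0..1} f" and len: "curve_length f = ennreal L" and L: "0 < L" and e: "e > 0"
  shows "\<forall>\<^sub>F m in sequentially. L - e < (\<Sum>j<m. norm (f (real (Suc j) / m) - f (real j / m)))"
proof -
  have "ennreal (L - e) < curve_length f" unfolding len using L e by (simp add: ennreal_lessI)
  then obtain p :: "nat \<times> (nat \<Rightarrow> real)"
    where p: "p \<in> {(n, t). n \<ge> 1 \<and> t 0 = 0 \<and> t n = 1 \<and> (\<forall>i\<in>{1..n}. t (i - 1) \<le> t i)}"
      "ennreal (L - e) < (case p of (n, t) \<Rightarrow> ennreal (\<Sum>i=1..n. norm (f (t i) - f (t (i - 1)))))"
    unfolding curve_length_def less_SUP_iff by blast
  obtain n t where pnt: "p = (n, t)" by (cases p)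
  have nt: "1 \<le> n" "t 0 = 0" "t n = 1" "\<forall>i\<in>{1..n}. t (i - 1) \<le> t i"
    and "ennreal (L - e) < ennreal (\<Sum>i=1..n. norm (f (t i) - f (t (i - 1))))"
    using p unfolding pnt by auto
  then have gap: "L - e < (\<Sum>i=1..n. norm (f (t i) - f (t (i - 1))))" (is "_ < ?S")
    by (metis ennreal_leI linorder_not_less)
  have mono: "t i \<le> t j" if "i \<le> j" "j \<le> n" for i j
    using subdivision_mono[OF nt(4) that] .
  have t01: "0 \<le> t i" "t i \<le> 1" if "i \<le> n" for i using mono[of 0 i] mono[of i n] that nt by auto
  have lip': "norm (f x - f y) \<le> L * \<bar>x - y\<bar>" if "x \<in> {0..1}" "y \<in> {0..1}" for x y
    using lipschitz_onD[OF lip that] by (simp add: dist_norm)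
  have key: "?S \<le> (\<Sum>j<m. norm (f (real (Suc j) / m) - f (real j / m))) + 2 * n * L / m" if m: "m > 0" for m :: nat
  proof -
    define k where "k i = nat \<lfloor>m * t i\<rfloor>" for i
    define F where "F a = (\<Sum>j<a. norm (f (real (Suc j) / m) - f (real j / m)))" for a :: nat
    have k_real: "real (k i) = of_int \<lfloor>m * t i\<rfloor>" if "i \<le> n" for i
      using t01[OF that] m by (simp add: k_def)
    have close: "\<bar>t i - real (k i) / m\<bar> \<le> 1 / m" if "i \<le> n" for i
    proof -
      have "\<bar>m * t i - real (k i)\<bar> \<le> 1" unfolding k_real[OF that] by linarith
      moreover have "t i - real (k i) / m = (m * t i - real (k i)) / m" using m by (simp add: field_simps)
      ultimately show ?thesis using m by (simp add: divide_right_mono)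
    qed
    have k_in: "real (k i) / m \<in> {0..1}" if "i \<le> n" for i
    proof -
      have "real (k i) \<le> m * t i" unfolding k_real[OF that] by linarith
      also have "\<dots> \<le> real m * 1" using t01[OF that] by (intro mult_left_mono) auto
      finally show ?thesis using m by (simp add: divide_le_eq)
    qed
    have k_mono: "k (i - 1) \<le> k i" if "i \<in> {1..n}" for i
      using nt(4) that m unfolding k_def by (intro nat_mono floor_mono mult_left_mono) auto
    have tel: "norm (f (real b / m) - f (real a / m)) \<le> F b - F a" if "a \<le> b" for a b
      using that
    proof (induction b rule: dec_induct)
      case (step b)
      have "norm (f (real (Suc b) / m) - f (real a / m)) \<le>
        norm (f (real (Suc b) / m) - f (real b / m)) + norm (f (real b / m) - f (real a / m))"
        using norm_triangle_ineq[of "f (real (Suc b) / m) - f (real b / m)" "f (real b / m) - f (real a / m)"] by simp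
      also have "\<dots> \<le> F (Suc b) - F a" using step by (simp add: F_def)
      finally show ?case .
    qed simp
    have "?S \<le> (\<Sum>i=1..n. (F (k i) - F (k (i - 1))) + 2 * L / m)"
    proof (rule sum_mono)
      fix i assume i: "i \<in> {1..n}"
      have 1: "norm (f (t i) - f (real (k i) / m)) \<le> L / m" if "i \<le> n" for i
      proof -
        have "norm (f (t i) - f (real (k i) / m)) \<le> L * \<bar>t i - real (k i) / m\<bar>"
          using lip'[of "t i" "real (k i) / m"] t01[OF that] k_in[OF that] by simp
        also have "\<dots> \<le> L * (1 / m)" using close[OF that] L by (intro mult_left_mono) auto
        finally show ?thesis by simp
      qed
      have "norm (f (t i) - f (t (i - 1))) \<le> norm (f (t i) - f (real (k i) / m))
        + norm (f (real (k i) / m) - f (real (k (i - 1)) / m)) + norm (f (t (i - 1)) - f (real (k (i - 1)) / m))"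
        by norm
      moreover have "2 * L / m = L / m + L / m" by simp
      moreover have "i \<le> n" "i - 1 \<le> n" using i by auto
      ultimately show "norm (f (t i) - f (t (i - 1))) \<le> (F (k i) - F (k (i - 1))) + 2 * L / m"
        using 1[of i] 1[of "i - 1"] tel[OF k_mono[OF i]] by linarith
    qed
    also have "\<dots> = (\<Sum>i=Suc 0..n. F (k i) - F (k (i - 1))) + 2 * n * L / m"
      by (simp add: sum.distrib)
    also have "(\<Sum>i=Suc 0..n. F (k i) - F (k (i - 1))) = F (k n) - F (k 0)"
      by (rule sum_telescope'') simp
    also have "k n = m" using nt by (simp add: k_def)
    also have "k 0 = 0" using nt by (simp add: k_def)
    finally show ?thesis by (simp add: F_def)
  qed
  have "(\<lambda>m. 2 * n * L / real m) \<longlonglongrightarrow> 0"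
    by (rule lim_const_over_n)
  then have "\<forall>\<^sub>F m in sequentially. 2 * n * L / real m < ?S - (L - e)"
    by (rule order_tendstoD) (use gap in simp)
  then show ?thesis
    using eventually_gt_at_top[of 0]
  proof eventually_elim
    case (elim m)
    then show ?case using key[of m] by linarith
  qed
qed

section \<open>Competitors of an optimal curve\<close>

lemma curve_length_scaleR:
  fixes g :: "real \<Rightarrow> 'a::real_normed_vector"
  assumes "curve_length g \<le> ennreal l" "0 \<le> l" "0 \<le> c"
  shows "curve_length (\<lambda>t. c *\<^sub>R g t) \<le> ennreal (c * l)"
  unfolding curve_length_def
proof (rule SUP_least, clarify)
  fix n :: nat and t :: "nat \<Rightarrow> real"
  assume t: "1 \<le> n" "t 0 = 0" "t n = 1" "\<forall>i\<in>{1..n}. t (i - 1) \<le> t i"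
  have "ennreal (\<Sum>i=1..n. norm (g (t i) - g (t (i - 1)))) \<le> ennreal l"
    using sum_le_curve_length[OF t] assms(1) by (rule order_trans)
  then have "(\<Sum>i=1..n. norm (g (t i) - g (t (i - 1)))) \<le> l"
    using assms(2) by (simp add: ennreal_le_iff)
  then have "c * (\<Sum>i=1..n. norm (g (t i) - g (t (i - 1)))) \<le> c * l"
    using assms(3) by (rule mult_left_mono)
  also have "c * (\<Sum>i=1..n. norm (g (t i) - g (t (i - 1))))
      = (\<Sum>i=1..n. norm (c *\<^sub>R g (t i) - c *\<^sub>R g (t (i - 1))))"
    using assms(3) by (simp add: sum_distrib_left flip: scaleR_diff_right)
  finally show "ennreal (\<Sum>i=1..n. norm (c *\<^sub>R g (t i) - c *\<^sub>R g (t (i - 1)))) \<le> ennreal (c * l)"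
    by (rule ennreal_leI)
qed

text \<open>The smallest nearest parameter \<open>\<sigma> x\<close> is measurable: \<open>\<sigma> x \<le> s\<close> means that \<open>f ` {0..s}\<close> is as close
to \<open>x\<close> as the whole curve, and the distances to two sets are continuous in \<open>x\<close>.\<close>

lemma exists_measurable_nearest_parameter:
  fixes f :: "real \<Rightarrow> 'a::euclidean_space"
  assumes f: "path f"
  obtains \<sigma> where "\<sigma> \<in> borel_measurable borel" "\<And>x. \<sigma> x \<in> {0..1}"
    "\<And>x. norm (x - f (\<sigma> x)) = infdist x (path_image f)"
proof
  define T where "T x = {t \<in> {0..1}. norm (x - f t) = infdist x (path_image f)}" for x
  define \<sigma> where "\<sigma> x = Inf (T x)" for x
  have cont: "continuous_on {0..1} f" using f by (simp add: path_def)
  have attained: "\<exists>t\<in>{0..s}. norm (x - f t) = infdist x (f ` {0..s})" if "0 \<le> s" "s \<le> 1" for x s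
  proof -
    have "compact (f ` {0..s})"
      by (rule compact_continuous_image) (use cont that in \<open>auto intro: continuous_on_subset\<close>)
    then have "closed (f ` {0..s})" by (rule compact_imp_closed)
    moreover have "f ` {0..s} \<noteq> {}" using that by simp
    ultimately obtain y where "y \<in> f ` {0..s}" "infdist x (f ` {0..s}) = dist x y"
      by (rule infdist_attains_inf)
    then show ?thesis by (auto simp: dist_norm)
  qed
  have T: "\<sigma> x \<in> T x" for x
  proof -
    have "T x \<noteq> {}" using attained[of 1 x] by (auto simp: T_def path_image_def)
    moreover have "closed (T x)"
    proof -
      have "closed ({0..1} \<inter> (\<lambda>t. norm (x - f t)) -` {infdist x (path_image f)})"
        by (rule continuous_closed_preimage) (auto intro!: continuous_intros cont)
      moreover have "T x = {0..1} \<inter> (\<lambda>t. norm (x - f t)) -` {infdist x (path_image f)}"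
        by (auto simp: T_def)
      ultimately show ?thesis by simp
    qed
    moreover have "bdd_below (T x)" by (rule bdd_belowI[of _ 0]) (auto simp: T_def)
    ultimately show ?thesis unfolding \<sigma>_def by (intro closed_contains_Inf)
  qed
  show "\<sigma> x \<in> {0..1}" "norm (x - f (\<sigma> x)) = infdist x (path_image f)" for x
    using T[of x] by (auto simp: T_def)
  have low: "\<sigma> x \<le> t" if "t \<in> T x" for t x
    unfolding \<sigma>_def by (rule cInf_lower[OF that]) (auto simp: T_def intro!: bdd_belowI[of _ 0])
  have le_iff: "\<sigma> x \<le> s \<longleftrightarrow> infdist x (f ` {0..s}) \<le> infdist x (path_image f)"
    if s: "0 \<le> s" "s \<le> 1" for s x
  proof
    assume "\<sigma> x \<le> s"
    then have "f (\<sigma> x) \<in> f ` {0..s}" using T[of x] by (auto simp: T_def)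
    then have "infdist x (f ` {0..s}) \<le> dist x (f (\<sigma> x))" by (rule infdist_le)
    then show "infdist x (f ` {0..s}) \<le> infdist x (path_image f)"
      using T[of x] by (auto simp: T_def dist_norm)
  next
    assume le: "infdist x (f ` {0..s}) \<le> infdist x (path_image f)"
    obtain t where t: "t \<in> {0..s}" "norm (x - f t) = infdist x (f ` {0..s})"
      using attained[OF s] by blast
    have "infdist x (path_image f) \<le> dist x (f t)"
      using t s by (intro infdist_le) (auto simp: path_image_def)
    then have "t \<in> T x" using t le s by (auto simp: T_def dist_norm)
    from low[OF this] t show "\<sigma> x \<le> s" by simp
  qed
  show "\<sigma> \<in> borel_measurable borel"
  proof (rule borel_measurableI_le)
    fix s :: real
    consider "s < 0" | "s > 1" | "0 \<le> s" "s \<le> 1" by linarith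
    then show "{x \<in> space borel. \<sigma> x \<le> s} \<in> sets borel"
    proof cases
      case 1
      then have "\<not> \<sigma> x \<le> s" for x using T[of x] by (auto simp: T_def)
      then show ?thesis by simp
    next
      case 2
      then have "\<sigma> x \<le> s" for x using T[of x] by (auto simp: T_def)
      then show ?thesis by simp
    next
      case 3
      then have "{x \<in> space borel. \<sigma> x \<le> s}
          = {x. infdist x (f ` {0..s}) \<le> infdist x (path_image f)}" using le_iff by auto
      also have "closed \<dots>" by (intro closed_Collect_le continuous_intros)
      finally show ?thesis by (simp add: borel_closed)
    qed
  qed
qed

lemma path_bounded:
  fixes f :: "real \<Rightarrow> 'a::real_normed_vector"
  assumes "path f"
  obtains B where "B > 0" "\<forall>t\<in>{0..1}. norm (f t) \<le> B"
proof -
  have "bounded (path_image f)" using assms by (rule bounded_path_image)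
  then obtain B where "B > 0" "\<forall>x\<in>path_image f. norm x \<le> B" by (auto simp: bounded_pos)
  then show ?thesis by (intro that[of B]) (auto simp: path_image_def)
qed

lemma infdist_measurable [measurable]:
  fixes S :: "'a::euclidean_space set"
  shows "(\<lambda>x. infdist x S) \<in> borel_measurable borel"
  by (intro borel_measurable_continuous_onI continuous_intros)

locale optimal_curve = prob_space M for M :: "'w measure" +
  fixes X :: "'w \<Rightarrow> 'a::euclidean_space" and k :: curve_kind and L :: real
    and f :: "real \<Rightarrow> 'a"
  assumes X_measurable [measurable]: "X \<in> borel_measurable M"
    and X_square_integrable: "integrable M (\<lambda>w. (norm (X w))\<^sup>2)"
    and L_pos: "L > 0"
    and optimal_value_pos: "optimal_value M X k L > 0"
    and f_in_class: "f \<in> curves_upto k L"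
    and f_optimal: "mean_sq_dist M X f = optimal_value M X k L"
begin

lemma f_path: "path f" and f_length: "curve_length f \<le> ennreal L"
  using f_in_class by (cases k; simp)+

lemma f_closed: "k = Closed_Curves \<Longrightarrow> f 0 = f 1"
  using f_in_class by simp

lemma f_continuous: "continuous_on {0..1} f"
  using f_path by (simp add: path_def)

end

text \<open>The parameter \<open>\<tau>\<close> is not required to be a function of \<open>Y\<close>, since the uniqueness of the multiplier
is asserted among all extensions of the probability space.\<close>

definition nearest_coupling ::
  "'w measure \<Rightarrow> ('w \<Rightarrow> 'a::euclidean_space) \<Rightarrow> (real \<Rightarrow> 'a) \<Rightarrow> 'v measure
    \<Rightarrow> ('v \<Rightarrow> 'a) \<Rightarrow> ('v \<Rightarrow> real) \<Rightarrow> bool" where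
  "nearest_coupling M X f N Y \<tau> \<longleftrightarrow>
     prob_extension M X N Y \<and>
     \<tau> \<in> borel_measurable N \<and> (\<forall>w\<in>space N. \<tau> w \<in> {0..1}) \<and>
     (AE w in N. norm (Y w - f (\<tau> w)) = infdist (Y w) (path_image f))"

locale optimal_coupling = optimal_curve M X k L f + N: prob_space N
  for M :: "'w measure" and X :: "'w \<Rightarrow> 'a::euclidean_space" and k L f and N :: "'v measure" +
  fixes Y :: "'v \<Rightarrow> 'a" and \<tau> :: "'v \<Rightarrow> real"
  assumes coupling: "nearest_coupling M X f N Y \<tau>"
begin

definition Z :: "'v \<Rightarrow> 'a" where "Z w = Y w - f (\<tau> w)"

lemma Y_measurable [measurable]: "Y \<in> borel_measurable N"
  and Y_distr: "distr N borel Y = distr M borel X"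
  and tau_measurable [measurable]: "\<tau> \<in> borel_measurable N"
  and tau_range: "w \<in> space N \<Longrightarrow> \<tau> w \<in> {0..1}"
  and Z_nearest: "AE w in N. norm (Z w) = infdist (Y w) (path_image f)"
  using coupling by (auto simp: nearest_coupling_def prob_extension_def Z_def)

lemma tau_measurable_restrict: "\<tau> \<in> measurable N (restrict_space borel {0..1})"
  using tau_range by (intro measurable_restrict_space2) auto

lemma continuous_comp_tau_measurable:
  "continuous_on {0..1} h \<Longrightarrow> (\<lambda>w. h (\<tau> w)) \<in> borel_measurable N"
  using measurable_compose[OF tau_measurable_restrict borel_measurable_continuous_on_restrict] .

lemma f_tau_measurable [measurable]: "(\<lambda>w. f (\<tau> w)) \<in> borel_measurable N"
  by (rule continuous_comp_tau_measurable[OF f_continuous])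

lemma Z_measurable [measurable]: "Z \<in> borel_measurable N"
  unfolding Z_def by measurable

lemma transfer_integral:
  fixes \<phi> :: "'a \<Rightarrow> real"
  assumes [measurable]: "\<phi> \<in> borel_measurable borel"
  shows "N.expectation (\<lambda>w. \<phi> (Y w)) = expectation (\<lambda>w. \<phi> (X w))"
    and "integrable N (\<lambda>w. \<phi> (Y w)) \<longleftrightarrow> integrable M (\<lambda>w. \<phi> (X w))"
proof -
  have "N.expectation (\<lambda>w. \<phi> (Y w)) = integral\<^sup>L (distr N borel Y) \<phi>"
    by (rule integral_distr[symmetric]) simp_all
  also have "\<dots> = expectation (\<lambda>w. \<phi> (X w))"
    unfolding Y_distr by (rule integral_distr) simp_all
  finally show "N.expectation (\<lambda>w. \<phi> (Y w)) = expectation (\<lambda>w. \<phi> (X w))" .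
  have "integrable N (\<lambda>w. \<phi> (Y w)) \<longleftrightarrow> integrable (distr N borel Y) \<phi>"
    by (rule integrable_distr_eq[symmetric]) simp_all
  also have "\<dots> \<longleftrightarrow> integrable M (\<lambda>w. \<phi> (X w))"
    unfolding Y_distr by (rule integrable_distr_eq) simp_all
  finally show "integrable N (\<lambda>w. \<phi> (Y w)) \<longleftrightarrow> integrable M (\<lambda>w. \<phi> (X w))" .
qed

lemma integrable_norm_sq_diff:
  assumes [measurable]: "q \<in> borel_measurable N" and q: "AE w in N. norm (q w) \<le> B"
  shows "integrable N (\<lambda>w. (norm (Y w - q w))\<^sup>2)"
proof (rule Bochner_Integration.integrable_bound)
  show "integrable N (\<lambda>w. 2 * (norm (Y w))\<^sup>2 + 2 * B\<^sup>2)"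
    using transfer_integral(2)[of "\<lambda>x. (norm x)\<^sup>2"] X_square_integrable by simp
  show "AE w in N. norm ((norm (Y w - q w))\<^sup>2) \<le> norm (2 * (norm (Y w))\<^sup>2 + 2 * B\<^sup>2)"
    using q
  proof eventually_elim
    case (elim w)
    have "(norm (Y w - q w))\<^sup>2 \<le> (norm (Y w) + norm (q w))\<^sup>2"
      by (intro power_mono norm_triangle_ineq4) simp
    also have "\<dots> \<le> 2 * (norm (Y w))\<^sup>2 + 2 * (norm (q w))\<^sup>2"
      using zero_le_power2[of "norm (Y w) - norm (q w)"] by (simp add: power2_eq_square algebra_simps)
    also have "(norm (q w))\<^sup>2 \<le> B\<^sup>2" using elim by (intro power_mono) auto
    finally show ?case by simp
  qed
qed measurable

lemma f_bounded: obtains B where "B > 0" "\<forall>t\<in>{0..1}. norm (f t) \<le> B"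
  by (rule path_bounded[OF f_path])

lemma Z_square_integrable: "integrable N (\<lambda>w. (norm (Z w))\<^sup>2)"
proof -
  obtain B where "B > 0" "\<forall>t\<in>{0..1}. norm (f t) \<le> B" by (rule f_bounded)
  then show ?thesis unfolding Z_def
    by (intro integrable_norm_sq_diff[of _ B]) (auto intro!: AE_I2 tau_range)
qed

lemma Z_integrable: "integrable N Z"
proof (rule Bochner_Integration.integrable_bound)
  show "integrable N (\<lambda>w. 1 + (norm (Z w))\<^sup>2)" using Z_square_integrable by simp
  have "norm z \<le> 1 + (norm z)\<^sup>2" for z :: 'a
    using zero_le_power2[of "norm z - 1/2"] by (simp add: power2_eq_square algebra_simps)
  then show "AE w in N. norm (Z w) \<le> norm (1 + (norm (Z w))\<^sup>2)" by auto
qed simp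

lemma Z_inner_integrable:
  assumes [measurable]: "h \<in> borel_measurable N" and "\<And>w. w \<in> space N \<Longrightarrow> norm (h w) \<le> B"
  shows "integrable N (\<lambda>w. Z w \<bullet> h w)"
proof (rule Bochner_Integration.integrable_bound)
  show "integrable N (\<lambda>w. B * norm (Z w))" using Z_integrable by simp
  show "AE w in N. norm (Z w \<bullet> h w) \<le> norm (B * norm (Z w))"
  proof (rule AE_I2)
    fix w assume w: "w \<in> space N"
    have "norm (Z w \<bullet> h w) \<le> norm (Z w) * norm (h w)" by (simp add: Cauchy_Schwarz_ineq2)
    also have "\<dots> \<le> norm (Z w) * B" using assms(2)[OF w] by (intro mult_left_mono) auto
    also have "\<dots> \<le> norm (B * norm (Z w))" by (simp add: mult.commute)
    finally show "norm (Z w \<bullet> h w) \<le> norm (B * norm (Z w))" .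
  qed
qed measurable

lemma loss_eq: "N.expectation (\<lambda>w. (norm (Z w))\<^sup>2) = optimal_value M X k L"
proof -
  have "N.expectation (\<lambda>w. (norm (Z w))\<^sup>2) = N.expectation (\<lambda>w. (infdist (Y w) (path_image f))\<^sup>2)"
    using Z_nearest by (intro integral_cong_AE) (auto elim: eventually_mono)
  also have "\<dots> = mean_sq_dist M X f"
    unfolding mean_sq_dist_def by (rule transfer_integral) measurable
  finally show ?thesis using f_optimal by simp
qed

text \<open>The point \<open>q\<close> need not be nearest to \<open>Y\<close>. It can therefore be chosen by moving \<open>f \<tau>\<close> along with a
perturbation of the curve, with no control on how the nearest point itself moves.\<close>

lemma optimal_le_competitor:
  assumes g: "g \<in> curves_upto k L" and [measurable]: "q \<in> borel_measurable N"
    and q: "\<And>w. w \<in> space N \<Longrightarrow> q w \<in> path_image g"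
  shows "N.expectation (\<lambda>w. (norm (Z w))\<^sup>2) \<le> N.expectation (\<lambda>w. (norm (Y w - q w))\<^sup>2)"
    and "integrable N (\<lambda>w. (norm (Y w - q w))\<^sup>2)"
proof -
  have "path g" using g by (cases k) auto
  then have "bounded (path_image g)" by (rule bounded_path_image)
  then obtain B where B: "\<And>x. x \<in> path_image g \<Longrightarrow> norm x \<le> B" by (auto simp: bounded_iff)
  show int: "integrable N (\<lambda>w. (norm (Y w - q w))\<^sup>2)"
    by (rule integrable_norm_sq_diff[of _ B]) (auto intro!: AE_I2 B q)
  have le: "infdist (Y w) (path_image g) \<le> norm (Y w - q w)" if "w \<in> space N" for w
    using infdist_le[OF q[OF that], of "Y w"] by (simp add: dist_norm)
  have "optimal_value M X k L \<le> mean_sq_dist M X g"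
    unfolding optimal_value_def
    by (rule cINF_lower[OF _ g]) (auto intro!: bdd_belowI2[of _ 0] simp: mean_sq_dist_def)
  also have "\<dots> = N.expectation (\<lambda>w. (infdist (Y w) (path_image g))\<^sup>2)"
    unfolding mean_sq_dist_def by (rule transfer_integral[symmetric]) measurable
  also have "\<dots> \<le> N.expectation (\<lambda>w. (norm (Y w - q w))\<^sup>2)"
  proof (rule integral_mono[OF _ int])
    show "integrable N (\<lambda>w. (infdist (Y w) (path_image g))\<^sup>2)"
      by (rule Bochner_Integration.integrable_bound[OF int])
        (auto intro!: AE_I2 power_mono le infdist_nonneg)
    show "(infdist (Y w) (path_image g))\<^sup>2 \<le> (norm (Y w - q w))\<^sup>2" if "w \<in> space N" for w
      using le[OF that] by (intro power_mono infdist_nonneg)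
  qed
  finally show "N.expectation (\<lambda>w. (norm (Z w))\<^sup>2) \<le> N.expectation (\<lambda>w. (norm (Y w - q w))\<^sup>2)"
    by (simp add: loss_eq)
qed

text \<open>The competitor is \<open>f\<close> with a spike of height \<open>s\<close> in direction \<open>v\<close>, shrunk by the factor \<open>1 - \<epsilon>\<close> to
stay within the length \<open>L\<close>. On \<open>U\<close> the tip of the spike is taken for the point \<open>q\<close>, elsewhere the
old nearest point. By \<open>side\<close> and \<open>near\<close> the tip reduces the squared distance by \<open>s \<delta>\<close>; by \<open>small\<close> at
most half of this is lost again in the first-order effect of the shrinking.\<close>

lemma spike_bound:
  assumes U [measurable]: "U \<in> sets N" and t0: "t0 \<in> {0..1}" and v: "norm v = 1"
    and s: "0 < s" "s \<le> 1" and eps: "0 \<le> \<epsilon>" "\<epsilon> \<le> 1"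
    and len: "curve_length f \<le> ennreal l" "0 \<le> l" "(1 - \<epsilon>) * (l + 2 * s) \<le> L"
    and B: "0 \<le> B" "\<And>t. t \<in> {0..1} \<Longrightarrow> norm (f t) \<le> B"
    and side: "\<And>w. w \<in> U \<Longrightarrow> \<delta> \<le> Z w \<bullet> v"
    and R: "0 \<le> R" "\<And>w. w \<in> U \<Longrightarrow> norm (Z w) \<le> R"
    and near: "\<And>w. w \<in> U \<Longrightarrow> 2 * (Z w \<bullet> (f (\<tau> w) - f t0)) + (norm (f t0 + s *\<^sub>R v - f (\<tau> w)))\<^sup>2 \<le> s * \<delta>"
    and small: "\<And>w. w \<in> U \<Longrightarrow> 4 * \<epsilon> * norm (f t0 + s *\<^sub>R v - f (\<tau> w)) * (R + B) \<le> s * \<delta>"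
  shows "N.prob U * (s * \<delta> / 2) \<le> 2 * \<epsilon> * N.expectation (\<lambda>w. Z w \<bullet> f (\<tau> w)) + \<epsilon>\<^sup>2 * (B + 1)\<^sup>2"
proof -
  obtain g where g: "path g" "curve_length g \<le> ennreal (l + 2 * norm (s *\<^sub>R v))" "g 0 = f 0" "g 1 = f 1"
    "path_image f \<subseteq> path_image g" "f t0 + s *\<^sub>R v \<in> path_image g"
    by (rule exists_curve_with_spike[OF f_path len(1,2) t0])
  define g' where "g' t = (1 - \<epsilon>) *\<^sub>R g t" for t
  define tip where "tip = f t0 + s *\<^sub>R v"
  define q where "q w = (if w \<in> U then tip else f (\<tau> w))" for w
  have q_meas [measurable]: "q \<in> borel_measurable N" unfolding q_def by measurable
  have "curve_length g' \<le> ennreal ((1 - \<epsilon>) * (l + 2 * s))"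
    unfolding g'_def using g(2) v s len eps by (intro curve_length_scaleR) auto
  also have "\<dots> \<le> ennreal L" using len(3) by (rule ennreal_leI)
  finally have "curve_length g' \<le> ennreal L" .
  moreover have "path g'" using g(1) unfolding path_def g'_def by (intro continuous_intros)
  moreover have "k = Closed_Curves \<Longrightarrow> g' 0 = g' 1" using f_closed g by (simp add: g'_def)
  ultimately have g'_class: "g' \<in> curves_upto k L" by (cases k) auto
  have q_in: "q w \<in> path_image g" if "w \<in> space N" for w
    using g(5,6) tau_range[OF that] by (auto simp: q_def tip_def path_image_def)
  have q_in': "(1 - \<epsilon>) *\<^sub>R q w \<in> path_image g'" if "w \<in> space N" for w
    using q_in[OF that] by (auto simp: g'_def path_image_def)
  have tip_norm: "norm tip \<le> B + 1"
    using norm_triangle_ineq[of "f t0" "s *\<^sub>R v"] B(2)[OF t0] s v by (simp add: tip_def)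
  have q_norm: "norm (q w) \<le> B + 1" if "w \<in> space N" for w
    using tip_norm B(2)[OF tau_range[OF that]] by (auto simp: q_def)
  have pointwise: "(norm (Y w - (1 - \<epsilon>) *\<^sub>R q w))\<^sup>2 \<le>
      (norm (Z w))\<^sup>2 + 2 * \<epsilon> * (Z w \<bullet> f (\<tau> w)) + \<epsilon>\<^sup>2 * (B + 1)\<^sup>2 - s * \<delta> / 2 * indicator U w"
    if w: "w \<in> space N" for w
  proof -
    define D where "D = q w - f (\<tau> w)"
    have Yq: "Y w - (1 - \<epsilon>) *\<^sub>R q w = (Z w - D) + \<epsilon> *\<^sub>R q w"
      by (simp add: D_def Z_def algebra_simps)
    have "(norm (Y w - (1 - \<epsilon>) *\<^sub>R q w))\<^sup>2
        = (norm (Z w - D))\<^sup>2 + 2 * \<epsilon> * ((Z w - D) \<bullet> q w) + \<epsilon>\<^sup>2 * (norm (q w))\<^sup>2"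
      unfolding Yq power2_norm_eq_inner
      by (simp add: inner_add_left inner_add_right inner_commute power2_eq_square algebra_simps)
    moreover have "\<epsilon>\<^sup>2 * (norm (q w))\<^sup>2 \<le> \<epsilon>\<^sup>2 * (B + 1)\<^sup>2"
      using q_norm[OF w] by (intro mult_left_mono power_mono) auto
    moreover have "(norm (Z w - D))\<^sup>2 + 2 * \<epsilon> * ((Z w - D) \<bullet> q w)
        \<le> (norm (Z w))\<^sup>2 + 2 * \<epsilon> * (Z w \<bullet> f (\<tau> w)) - s * \<delta> / 2 * indicator U w"
    proof (cases "w \<in> U")
      case False
      then show ?thesis by (simp add: D_def q_def)
    next
      case True
      then have D: "D = tip - f (\<tau> w)" by (simp add: D_def q_def)
      have "(norm (Z w - D))\<^sup>2 = (norm (Z w))\<^sup>2 - 2 * (Z w \<bullet> D) + (norm D)\<^sup>2"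
        unfolding power2_norm_eq_inner by (simp add: inner_diff_left inner_diff_right inner_commute)
      moreover have "Z w \<bullet> D = - (Z w \<bullet> (f (\<tau> w) - f t0)) + s * (Z w \<bullet> v)"
        by (simp add: D tip_def inner_diff_right inner_add_right)
      moreover have "s * \<delta> \<le> s * (Z w \<bullet> v)" using side[OF True] s by (intro mult_left_mono) auto
      moreover have "2 * (Z w \<bullet> (f (\<tau> w) - f t0)) + (norm D)\<^sup>2 \<le> s * \<delta>"
        using near[OF True] by (simp add: D tip_def)
      ultimately have 1: "(norm (Z w - D))\<^sup>2 \<le> (norm (Z w))\<^sup>2 - s * \<delta>" by linarith
      have "(Z w - D) \<bullet> q w - Z w \<bullet> f (\<tau> w) = Z w \<bullet> D - D \<bullet> f (\<tau> w) - (norm D)\<^sup>2"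
        unfolding power2_norm_eq_inner by (simp add: D_def inner_diff_left inner_diff_right inner_commute)
      also have "\<dots> \<le> norm (Z w) * norm D + norm D * norm (f (\<tau> w))"
        using Cauchy_Schwarz_ineq2[of "Z w" D] Cauchy_Schwarz_ineq2[of D "f (\<tau> w)"]
          zero_le_power2[of "norm D"] by linarith
      also have "\<dots> \<le> R * norm D + norm D * B"
        using R(2)[OF True] B(2)[OF tau_range[OF w]] R(1) by (intro add_mono mult_mono) auto
      also have "\<dots> = norm D * (R + B)" by (simp add: algebra_simps)
      finally have "2 * \<epsilon> * ((Z w - D) \<bullet> q w - Z w \<bullet> f (\<tau> w)) \<le> 2 * \<epsilon> * (norm D * (R + B))"
        using eps by (intro mult_left_mono) auto
      also have "\<dots> \<le> s * \<delta> / 2" using small[OF True] by (simp add: D tip_def)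
      finally have "2 * \<epsilon> * ((Z w - D) \<bullet> q w) \<le> 2 * \<epsilon> * (Z w \<bullet> f (\<tau> w)) + s * \<delta> / 2"
        by (simp add: right_diff_distrib)
      then show ?thesis using 1 True by simp
    qed
    ultimately show ?thesis by linarith
  qed
  have int1: "integrable N (\<lambda>w. Z w \<bullet> f (\<tau> w))"
    using B(2) tau_range by (intro Z_inner_integrable[of _ B]) auto
  have int2: "integrable N (\<lambda>w. indicator U w :: real)"
    by (simp add: N.emeasure_eq_measure)
  have "N.expectation (\<lambda>w. (norm (Z w))\<^sup>2) \<le> N.expectation (\<lambda>w. (norm (Y w - (1 - \<epsilon>) *\<^sub>R q w))\<^sup>2)"
    by (rule optimal_le_competitor[OF g'_class]) (use q_in' in auto)
  also have "\<dots> \<le> N.expectation (\<lambda>w. (norm (Z w))\<^sup>2 + 2 * \<epsilon> * (Z w \<bullet> f (\<tau> w)) + \<epsilon>\<^sup>2 * (B + 1)\<^sup>2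
      - s * \<delta> / 2 * indicator U w)"
    by (rule integral_mono[OF optimal_le_competitor(2)[OF g'_class] _ pointwise])
      (use q_in' int1 int2 Z_square_integrable in auto)
  also have "\<dots> = N.expectation (\<lambda>w. (norm (Z w))\<^sup>2) + 2 * \<epsilon> * N.expectation (\<lambda>w. Z w \<bullet> f (\<tau> w))
      + \<epsilon>\<^sup>2 * (B + 1)\<^sup>2 - s * \<delta> / 2 * N.prob U"
    using int1 int2 Z_square_integrable by (simp add: N.prob_space)
  finally show ?thesis by (simp add: mult.commute)
qed

text \<open>As the optimal value is positive, \<open>Z\<close> does not vanish almost surely, so one of its coordinates is
positive or negative with positive probability. The bounds by \<open>n\<close> exhaust this event.\<close>

lemma exists_loss_direction:
  obtains v :: 'a and n :: nat where "norm v = 1"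
    "N.prob {w \<in> space N. 1 / Suc n \<le> Z w \<bullet> v \<and> norm (Z w) \<le> Suc n} > 0"
proof -
  define U where "U v n = {w \<in> space N. 1 / Suc n \<le> Z w \<bullet> v \<and> norm (Z w) \<le> Suc n}" for v n
  have [measurable]: "U v n \<in> sets N" for v n unfolding U_def by measurable
  have "\<exists>v n. norm v = 1 \<and> N.prob (U v n) > 0"
  proof (rule ccontr)
    assume "\<not> ?thesis"
    then have null: "N.prob (U v n) = 0" if "norm v = 1" for v n
      using that by (metis linorder_neqE_linordered_idom measure_nonneg not_less)
    have neg: "AE w in N. Z w \<bullet> v \<le> 0" if v: "norm v = 1" for v
    proof -
      have "AE w in N. \<forall>n. w \<notin> U v n"
        using null[OF v] by (subst AE_all_countable) (auto intro!: AE_not_in simp: null_sets_def N.emeasure_eq_measure)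
      then show ?thesis
      proof (rule AE_mp, intro AE_I2 impI)
        fix w assume w: "w \<in> space N" "\<forall>n. w \<notin> U v n"
        show "Z w \<bullet> v \<le> 0"
        proof (rule ccontr)
          assume "\<not> ?thesis"
          then obtain n1 where n1: "inverse (of_nat (Suc n1)) < Z w \<bullet> v"
            using reals_Archimedean[of "Z w \<bullet> v"] by auto
          obtain n2 :: nat where n2: "norm (Z w) \<le> n2" using real_arch_simple by blast
          define n where "n = max n1 n2"
          have "1 / real (Suc n) \<le> 1 / real (Suc n1)" by (simp add: n_def frac_le)
          then have "1 / Suc n \<le> Z w \<bullet> v" using n1 by (simp add: inverse_eq_divide)
          moreover have "norm (Z w) \<le> Suc n" using n2 by (simp add: n_def)
          ultimately have "w \<in> U v n" using w by (simp add: U_def)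
          with w show False by blast
        qed
      qed
    qed
    have "AE w in N. \<forall>b\<in>Basis. Z w \<bullet> b = 0"
    proof (rule AE_finite_allI)
      fix b :: 'a assume "b \<in> Basis"
      then have "norm b = 1" "norm (- b) = 1" by auto
      from neg[OF this(1)] neg[OF this(2)] show "AE w in N. Z w \<bullet> b = 0" by eventually_elim auto
    qed simp
    then have "AE w in N. (norm (Z w))\<^sup>2 = 0"
      by eventually_elim (simp add: euclidean_all_zero_iff)
    then have "N.expectation (\<lambda>w. (norm (Z w))\<^sup>2) = 0"
      by (rule integral_eq_zero_AE)
    then show False using loss_eq optimal_value_pos by simp
  qed
  then show ?thesis using that unfolding U_def by blast
qed

end

section \<open>The length constraint is active\<close>

context optimal_coupling
begin

lemma window_cover:
  assumes [measurable]: "U \<in> sets N" and m: "m > 0"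
  shows "N.prob U \<le> (\<Sum>i<m. N.prob {w \<in> U. real i / m \<le> \<tau> w \<and> \<tau> w \<le> real (Suc i) / m})"
proof -
  have [measurable]: "{w \<in> U. real i / m \<le> \<tau> w \<and> \<tau> w \<le> real (Suc i) / m} \<in> sets N" for i
  proof -
    have "{w \<in> U. real i / m \<le> \<tau> w \<and> \<tau> w \<le> real (Suc i) / m}
      = U \<inter> {w \<in> space N. real i / m \<le> \<tau> w \<and> \<tau> w \<le> real (Suc i) / m}"
      using sets.sets_into_space[OF assms(1)] by auto
    then show ?thesis by simp
  qed
  have "U \<subseteq> (\<Union>i<m. {w \<in> U. real i / m \<le> \<tau> w \<and> \<tau> w \<le> real (Suc i) / m})"
  proof
    fix w assume w: "w \<in> U"
    then have t: "0 \<le> \<tau> w" "\<tau> w \<le> 1"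
      using tau_range sets.sets_into_space[OF assms(1)] by fastforce+
    show "w \<in> (\<Union>i<m. {w \<in> U. real i / m \<le> \<tau> w \<and> \<tau> w \<le> real (Suc i) / m})"
    proof (cases "\<tau> w = 1")
      case True
      then show ?thesis using w m by (intro UN_I[of "m - 1"]) auto
    next
      case False
      define i where "i = nat \<lfloor>m * \<tau> w\<rfloor>"
      have i: "real i = of_int \<lfloor>m * \<tau> w\<rfloor>" using t by (simp add: i_def)
      have le: "real i \<le> m * \<tau> w" "m * \<tau> w \<le> real (Suc i)" using i by linarith+
      have "real i < m"
      proof -
        have "m * \<tau> w < real m * 1" using t False m by (intro mult_strict_left_mono) auto
        then show ?thesis using le by simp
      qed
      then show ?thesis using w le m by (intro UN_I[of i]) (auto simp: field_simps)
    qed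
  qed
  then have "N.prob U \<le> N.prob (\<Union>i<m. {w \<in> U. real i / m \<le> \<tau> w \<and> \<tau> w \<le> real (Suc i) / m})"
    by (intro N.finite_measure_mono) auto
  also have "\<dots> \<le> (\<Sum>i<m. N.prob {w \<in> U. real i / m \<le> \<tau> w \<and> \<tau> w \<le> real (Suc i) / m})"
    by (rule N.finite_measure_subadditive_finite) auto
  finally show ?thesis .
qed

text \<open>With length to spare, a spike can be added without shrinking. On a window so short that \<open>f\<close> moves
by much less than the height \<open>s\<close>, a spike at the left end lowers the distance of all points for
which \<open>Z\<close> has a large component along \<open>v\<close>. By optimality each of the finitely many windows has probability zero.\<close>

lemma curve_length_eq: "curve_length f = ennreal L"
proof (rule ccontr)
  assume "curve_length f \<noteq> ennreal L"
  then have lt: "curve_length f < ennreal L" using f_length by simp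
  then obtain l where l: "0 \<le> l" "curve_length f = ennreal l"
    by (cases "curve_length f") auto
  then have lL: "l < L" using lt by (simp add: ennreal_less_iff)
  obtain B where B: "B > 0" "\<forall>t\<in>{0..1}. norm (f t) \<le> B" by (rule f_bounded)
  obtain v and n :: nat where v: "norm v = 1"
    and p: "N.prob {w \<in> space N. 1 / Suc n \<le> Z w \<bullet> v \<and> norm (Z w) \<le> Suc n} > 0"
    by (rule exists_loss_direction)
  define U where "U = {w \<in> space N. 1 / Suc n \<le> Z w \<bullet> v \<and> norm (Z w) \<le> Suc n}"
  have U_meas [measurable]: "U \<in> sets N" unfolding U_def by measurable
  define R \<delta> where "R = real (Suc n)" and "\<delta> = 1 / real (Suc n)"
  have R: "R > 0" "\<delta> > 0" by (auto simp: R_def \<delta>_def)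
  \<comment> \<open>The bound \<open>\<delta> / 8\<close> makes \<open>(\<rho> + s)\<^sup>2 \<le> s \<delta> / 2\<close>, and the bound on \<open>\<rho>\<close> makes \<open>2 R \<rho> \<le> s \<delta> / 2\<close>.\<close>
  define s where "s = min 1 (min (\<delta> / 8) ((L - l) / 2))"
  have s: "0 < s" "s \<le> 1" "s \<le> \<delta> / 8" "s \<le> (L - l) / 2" using R lL by (auto simp: s_def min_def)
  define \<rho> where "\<rho> = min s (s * \<delta> / (4 * R))"
  have \<rho>: "0 < \<rho>" "\<rho> \<le> s" "\<rho> \<le> s * \<delta> / (4 * R)" using R s by (auto simp: \<rho>_def)
  have "uniformly_continuous_on {0..1} f"
    using f_continuous by (intro compact_uniformly_continuous) auto
  then obtain d where d: "d > 0" "\<And>t t'. t \<in> {0..1} \<Longrightarrow> t' \<in> {0..1} \<Longrightarrow> dist t' t < d \<Longrightarrow> dist (f t') (f t) < \<rho>"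
    unfolding uniformly_continuous_on_def using \<rho>(1) by metis
  obtain m :: nat where m: "m > 0" "1 / m < d"
    using d(1) by (metis ex_inverse_of_nat_less inverse_eq_divide)
  have "N.prob {w \<in> U. real i / m \<le> \<tau> w \<and> \<tau> w \<le> real (Suc i) / m} = 0" if i: "i < m" for i
  proof -
    define V where "V = {w \<in> U. real i / m \<le> \<tau> w \<and> \<tau> w \<le> real (Suc i) / m}"
    have "V = U \<inter> {w \<in> space N. real i / m \<le> \<tau> w \<and> \<tau> w \<le> real (Suc i) / m}"
      using sets.sets_into_space[OF U_meas] by (auto simp: V_def)
    then have V_meas: "V \<in> sets N" by simp
    have t0: "real i / m \<in> {0..1}" using i by auto
    have VU: "\<delta> \<le> Z w \<bullet> v" "norm (Z w) \<le> R" if "w \<in> V" for w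
      using that by (auto simp: V_def U_def R_def \<delta>_def)
    have close: "norm (f (\<tau> w) - f (real i / m)) \<le> \<rho>" if w: "w \<in> V" for w
    proof -
      have "w \<in> space N" using w V_meas sets.sets_into_space by blast
      moreover have "dist (\<tau> w) (real i / m) < d"
      proof -
        have "real i / m \<le> \<tau> w" "\<tau> w \<le> real (Suc i) / m" using w by (auto simp: V_def)
        then have "dist (\<tau> w) (real i / m) \<le> 1 / m" by (simp add: dist_real_def add_divide_distrib)
        then show ?thesis using m by simp
      qed
      ultimately have "dist (f (\<tau> w)) (f (real i / m)) < \<rho>"
        using d(2)[OF t0 tau_range] by blast
      then show ?thesis by (simp add: dist_norm)
    qed
    have "N.prob V * (s * \<delta> / 2) \<le> 2 * 0 * N.expectation (\<lambda>w. Z w \<bullet> f (\<tau> w)) + 0\<^sup>2 * (B + 1)\<^sup>2"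
    proof (rule spike_bound[OF V_meas t0 v s(1,2), where R = R and l = l and B = B])
      show "curve_length f \<le> ennreal l" "(1 - 0) * (l + 2 * s) \<le> L" using l s by auto
      show "2 * (Z w \<bullet> (f (\<tau> w) - f (real i / m)))
          + (norm (f (real i / m) + s *\<^sub>R v - f (\<tau> w)))\<^sup>2 \<le> s * \<delta>" if w: "w \<in> V" for w
      proof -
        have "Z w \<bullet> (f (\<tau> w) - f (real i / m)) \<le> norm (Z w) * norm (f (\<tau> w) - f (real i / m))"
          by (rule norm_cauchy_schwarz)
        also have "\<dots> \<le> R * \<rho>" using VU(2)[OF w] close[OF w] R by (intro mult_mono) auto
        also have "\<dots> \<le> R * (s * \<delta> / (4 * R))" using \<rho>(3) R by (intro mult_left_mono) auto
        also have "\<dots> = s * \<delta> / 4" using R by simp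
        finally have 1: "2 * (Z w \<bullet> (f (\<tau> w) - f (real i / m))) \<le> s * \<delta> / 2" by simp
        have "norm (f (real i / m) + s *\<^sub>R v - f (\<tau> w))
            \<le> norm (f (\<tau> w) - f (real i / m)) + norm (s *\<^sub>R v)"
          using norm_triangle_ineq[of "f (real i / m) - f (\<tau> w)" "s *\<^sub>R v"]
          by (simp add: norm_minus_commute algebra_simps)
        also have "\<dots> \<le> 2 * s" using close[OF w] \<rho>(2) s v by simp
        finally have "(norm (f (real i / m) + s *\<^sub>R v - f (\<tau> w)))\<^sup>2 \<le> (2 * s)\<^sup>2"
          by (rule power_mono) simp
        also have "\<dots> = s * (4 * s)" by (simp add: power2_eq_square)
        also have "\<dots> \<le> s * (\<delta> / 2)" using s by (intro mult_left_mono) auto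
        finally show ?thesis using 1 by simp
      qed
    qed (use l B VU R s in auto)
    then have "N.prob V * (s * \<delta> / 2) \<le> 0" by simp
    then have "N.prob V \<le> 0" using s R by (simp add: mult_le_0_iff)
    then show ?thesis by (simp add: V_def measure_le_0_iff)
  qed
  then have "N.prob U \<le> 0" using window_cover[OF U_meas m(1)] by simp
  then show False using p by (simp add: U_def)
qed

end

section \<open>First variation under the length constraint\<close>

locale lipschitz_coupling = optimal_coupling M X k L f N Y \<tau>
  for M :: "'w measure" and X :: "'w \<Rightarrow> 'a::euclidean_space" and k L f
    and N :: "'v measure" and Y \<tau> +
  assumes f_lipschitz: "L-lipschitz_on {0..1} f"
begin

definition closing :: real where
  "closing = (if k = Closed_Curves then 1 else 0)"

text \<open>Perturbations of a closed curve have to agree at \<open>0\<close> and \<open>1\<close>. The linear correction achieves this,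
and it does not change the first variation of the length, because \<open>f 0 = f 1\<close>.\<close>

definition ramp :: "real \<Rightarrow> real \<Rightarrow> real" where
  "ramp r t = min t r - closing * r * t"

text \<open>The Lagrange multiplier, read off from the perturbation of \<open>f\<close> in the direction \<open>f\<close>, along which
the first variation of half the energy is \<open>L\<^sup>2\<close>.\<close>

definition multiplier :: real where
  "multiplier = N.expectation (\<lambda>w. Z w \<bullet> f (\<tau> w)) / L\<^sup>2"

lemma closing_01: "0 \<le> closing" "closing \<le> 1" by (auto simp: closing_def)

lemma f_lip: "s \<in> {0..1} \<Longrightarrow> t \<in> {0..1} \<Longrightarrow> norm (f t - f s) \<le> L * \<bar>t - s\<bar>"
  using lipschitz_onD[OF f_lipschitz, of t s] by (simp add: dist_norm)

lemma ramp_measurable [measurable]: "ramp r \<in> borel_measurable borel"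
  unfolding ramp_def by measurable

lemma ramp_bound: "r \<in> {0..1} \<Longrightarrow> t \<in> {0..1} \<Longrightarrow> \<bar>ramp r t\<bar> \<le> 1"
proof -
  assume "r \<in> {0..1}" "t \<in> {0..1}"
  then have "0 \<le> r * t" "r * t \<le> 1" "0 \<le> min t r" "min t r \<le> 1" by (auto simp: mult_le_one)
  moreover from this have "0 \<le> closing * r * t" "closing * r * t \<le> 1"
    by (simp_all add: closing_def)
  ultimately show ?thesis unfolding ramp_def by linarith
qed

text \<open>The energy of the perturbed curve is \<open>L\<^sup>2 + 2 \<epsilon> (v \<bullet> (f r - f 0) - c L\<^sup>2) + O(\<epsilon>\<^sup>2)\<close>. The ramp is
affine with slope \<open>a\<close> on each side of \<open>r\<close>, so the mixed term of a squared increment is a multiple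
of \<open>a (t - s) (v \<bullet> (f t - f s))\<close>, which is again \<open>t - s\<close> times an increment of a function of time.\<close>

lemma perturbation_in_class:
  assumes r: "r \<in> {0..1}" and c: "v \<bullet> (f r - f 0) < c * L\<^sup>2"
  shows "\<forall>\<^sub>F \<epsilon> in at_right 0.
    (\<lambda>t. (1 - c * \<epsilon>) *\<^sub>R f t + \<epsilon> *\<^sub>R (u + ramp r t *\<^sub>R v)) \<in> curves_upto k L"
proof -
  define ell where "ell = v \<bullet> (f r - f 0)"
  have "((\<lambda>\<epsilon>. 2 * ell - 2 * c * L\<^sup>2 + \<epsilon> * (c\<^sup>2 * L\<^sup>2 - 2 * c * ell + (norm v)\<^sup>2))
      \<longlongrightarrow> 2 * ell - 2 * c * L\<^sup>2 + 0 * (c\<^sup>2 * L\<^sup>2 - 2 * c * ell + (norm v)\<^sup>2)) (at_right 0)"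
    by (intro tendsto_intros)
  moreover have "2 * ell - 2 * c * L\<^sup>2 + 0 * (c\<^sup>2 * L\<^sup>2 - 2 * c * ell + (norm v)\<^sup>2) < 0"
    using c by (simp add: ell_def)
  ultimately have "\<forall>\<^sub>F \<epsilon> in at_right 0. 2 * ell - 2 * c * L\<^sup>2 + \<epsilon> * (c\<^sup>2 * L\<^sup>2 - 2 * c * ell + (norm v)\<^sup>2) < 0"
    by (rule order_tendstoD)
  then show ?thesis using eventually_at_right_less[of 0]
  proof eventually_elim
    case (elim \<epsilon>)
    define g where "g t = (1 - c * \<epsilon>) *\<^sub>R f t + \<epsilon> *\<^sub>R (u + ramp r t *\<^sub>R v)" for t
    define b where "b = 1 - c * \<epsilon>"
    define E where "E t = b\<^sup>2 * L\<^sup>2 * t + 2 * \<epsilon> * b * (v \<bullet> (f (min t r) - (closing * r) *\<^sub>R f t))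
      + \<epsilon>\<^sup>2 * (norm v)\<^sup>2 * t" for t
    have piece: "(norm (g t - g s))\<^sup>2 \<le> (t - s) * (E t - E s)"
      if st: "0 \<le> s" "s \<le> t" "t \<le> 1" and a: "\<bar>a\<bar> \<le> 1"
        and ra: "ramp r t - ramp r s = a * (t - s)"
        and fa: "f (min t r) - (closing * r) *\<^sub>R f t - (f (min s r) - (closing * r) *\<^sub>R f s) = a *\<^sub>R (f t - f s)"
      for s t a
    proof -
      have "g t - g s = b *\<^sub>R (f t - f s) + \<epsilon> *\<^sub>R ((ramp r t - ramp r s) *\<^sub>R v)"
        by (simp add: g_def b_def algebra_simps)
      also have "\<dots> = b *\<^sub>R (f t - f s) + (\<epsilon> * a * (t - s)) *\<^sub>R v"
        unfolding ra by simp
      finally have "(norm (g t - g s))\<^sup>2 = b\<^sup>2 * (norm (f t - f s))\<^sup>2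
          + 2 * b * \<epsilon> * a * (t - s) * (v \<bullet> (f t - f s)) + \<epsilon>\<^sup>2 * a\<^sup>2 * (t - s)\<^sup>2 * (norm v)\<^sup>2"
        unfolding power2_norm_eq_inner
        by (simp add: inner_add_left inner_add_right inner_commute power2_eq_square)
      also have "\<dots> \<le> b\<^sup>2 * (L * (t - s))\<^sup>2
          + 2 * b * \<epsilon> * a * (t - s) * (v \<bullet> (f t - f s)) + \<epsilon>\<^sup>2 * 1 * (t - s)\<^sup>2 * (norm v)\<^sup>2"
      proof -
        have "norm (f t - f s) \<le> L * (t - s)" using f_lip[of s t] st by simp
        then have "(norm (f t - f s))\<^sup>2 \<le> (L * (t - s))\<^sup>2" by (rule power_mono) simp
        moreover have "a\<^sup>2 \<le> 1" using a by (simp add: abs_square_le_1)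
        ultimately show ?thesis by (intro add_mono order_refl mult_left_mono mult_right_mono) auto
      qed
      also have "\<dots> = (t - s) * (b\<^sup>2 * L\<^sup>2 * (t - s) + 2 * \<epsilon> * b * (v \<bullet> (a *\<^sub>R (f t - f s)))
          + \<epsilon>\<^sup>2 * (norm v)\<^sup>2 * (t - s))"
        by (simp add: power2_eq_square algebra_simps)
      also have "b\<^sup>2 * L\<^sup>2 * (t - s) + 2 * \<epsilon> * b * (v \<bullet> (a *\<^sub>R (f t - f s))) + \<epsilon>\<^sup>2 * (norm v)\<^sup>2 * (t - s)
          = E t - E s"
        unfolding E_def fa[symmetric] by (simp add: inner_diff_right algebra_simps)
      finally show ?thesis .
    qed
    have cr: "0 \<le> closing * r" "closing * r \<le> 1" using closing_01 r by (auto simp: mult_le_one)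
    have low: "(norm (g t - g s))\<^sup>2 \<le> (t - s) * (E t - E s)" if "0 \<le> s" "s \<le> t" "t \<le> r" for s t
      using that r cr by (intro piece[of s t "1 - closing * r"]) (auto simp: ramp_def algebra_simps)
    have high: "(norm (g t - g s))\<^sup>2 \<le> (t - s) * (E t - E s)" if "r \<le> s" "s \<le> t" "t \<le> 1" for s t
      using that r cr by (intro piece[of s t "- (closing * r)"]) (auto simp: ramp_def algebra_simps)
    have "curve_length g \<le> ennreal L"
    proof (rule curve_length_le_of_energy[OF _ _ L_pos])
      fix s t :: real assume st: "0 \<le> s" "s \<le> t" "t \<le> 1"
      consider "t \<le> r" | "r \<le> s" | "s \<le> r" "r \<le> t" by linarith
      then show "(norm (g t - g s))\<^sup>2 \<le> (t - s) * (E t - E s)"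
        by cases (use st low high energy_bound_trans[of g r s E t] in auto)
    next
      have cl: "closing = 0 \<or> f 1 = f 0" using f_closed by (simp add: closing_def)
      have "E 1 - E 0 = b\<^sup>2 * L\<^sup>2 + 2 * \<epsilon> * b * ell + \<epsilon>\<^sup>2 * (norm v)\<^sup>2"
        using r cl by (auto simp: E_def ell_def inner_diff_right algebra_simps)
      also have "\<dots> = L\<^sup>2 + \<epsilon> * (2 * ell - 2 * c * L\<^sup>2 + \<epsilon> * (c\<^sup>2 * L\<^sup>2 - 2 * c * ell + (norm v)\<^sup>2))"
        by (simp add: b_def power2_eq_square algebra_simps)
      also have "\<dots> \<le> L\<^sup>2" using elim by (simp add: mult_le_0_iff)
      finally show "E 1 - E 0 \<le> L\<^sup>2" .
    qed
    moreover have "path g"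
      using f_continuous unfolding path_def g_def ramp_def by (intro continuous_intros)
    moreover have "g 0 = g 1" if "k = Closed_Curves"
      using f_closed[OF that] r that unfolding g_def ramp_def closing_def by simp
    ultimately have "g \<in> curves_upto k L" by (cases k) auto
    then show ?case by (simp add: g_def[abs_def])
  qed
qed

text \<open>The distance from \<open>Y\<close> to the perturbed point has the square
\<open>|Z|\<^sup>2 - 2 \<epsilon> Z \<bullet> (h - c f) + O(\<epsilon>\<^sup>2)\<close>, where \<open>f\<close> and \<open>h\<close> are taken at \<open>\<tau>\<close>. Its mean is at least that
of \<open>|Z|\<^sup>2\<close> for all small \<open>\<epsilon> > 0\<close>.\<close>

lemma first_variation_le:
  assumes r: "r \<in> {0..1}" and c: "v \<bullet> (f r - f 0) < c * L\<^sup>2"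
  shows "N.expectation (\<lambda>w. Z w \<bullet> (u + ramp r (\<tau> w) *\<^sub>R v)) \<le> c * N.expectation (\<lambda>w. Z w \<bullet> f (\<tau> w))"
proof -
  obtain B where B: "B > 0" "\<forall>t\<in>{0..1}. norm (f t) \<le> B" by (rule f_bounded)
  define h where "h w = u + ramp r (\<tau> w) *\<^sub>R v" for w
  define j where "j w = h w - c *\<^sub>R f (\<tau> w)" for w
  define C where "C = norm u + norm v + \<bar>c\<bar> * B"
  have [measurable]: "h \<in> borel_measurable N" unfolding h_def by measurable
  have [measurable]: "j \<in> borel_measurable N" unfolding j_def by measurable
  have h_bd: "norm (h w) \<le> norm u + norm v" if "w \<in> space N" for w
  proof -
    have "norm (h w) \<le> norm u + \<bar>ramp r (\<tau> w)\<bar> * norm v"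
      unfolding h_def by (metis norm_scaleR norm_triangle_ineq)
    also have "\<dots> \<le> norm u + 1 * norm v"
      using ramp_bound[OF r tau_range[OF that]] by (intro add_left_mono mult_right_mono) auto
    finally show ?thesis by simp
  qed
  have f_bd: "norm (f (\<tau> w)) \<le> B" if "w \<in> space N" for w using B(2) tau_range[OF that] by blast
  have j_bd: "norm (j w) \<le> C" if "w \<in> space N" for w
  proof -
    have "norm (j w) \<le> norm (h w) + norm (c *\<^sub>R f (\<tau> w))" unfolding j_def by (rule norm_triangle_ineq4)
    also have "norm (c *\<^sub>R f (\<tau> w)) \<le> \<bar>c\<bar> * B" using f_bd[OF that] by (simp add: mult_left_mono)
    finally show ?thesis using h_bd[OF that] by (simp add: C_def)
  qed
  have int_j: "integrable N (\<lambda>w. Z w \<bullet> j w)" and int_h: "integrable N (\<lambda>w. Z w \<bullet> h w)"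
    and int_f: "integrable N (\<lambda>w. Z w \<bullet> f (\<tau> w))"
    using Z_inner_integrable[OF _ j_bd] Z_inner_integrable[OF _ h_bd] Z_inner_integrable[OF _ f_bd] by auto
  have ev: "\<forall>\<^sub>F \<epsilon> in at_right 0. N.expectation (\<lambda>w. Z w \<bullet> j w) \<le> \<epsilon> * (C\<^sup>2 / 2)"
    using perturbation_in_class[OF r c, of u] eventually_at_right_less[of 0]
  proof eventually_elim
    case (elim \<epsilon>)
    define q where "q w = (1 - c * \<epsilon>) *\<^sub>R f (\<tau> w) + \<epsilon> *\<^sub>R h w" for w
    have q_eq: "Y w - q w = Z w - \<epsilon> *\<^sub>R j w" for w
      by (simp add: q_def Z_def j_def algebra_simps)
    have [measurable]: "q \<in> borel_measurable N" unfolding q_def by measurable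
    have "q w \<in> path_image (\<lambda>t. (1 - c * \<epsilon>) *\<^sub>R f t + \<epsilon> *\<^sub>R (u + ramp r t *\<^sub>R v))"
      if "w \<in> space N" for w
      unfolding q_def h_def path_image_def using tau_range[OF that] by (rule image_eqI[OF refl])
    note comp = optimal_le_competitor[OF elim(1) \<open>q \<in> _\<close> this]
    have "N.expectation (\<lambda>w. (norm (Z w))\<^sup>2) \<le> N.expectation (\<lambda>w. (norm (Y w - q w))\<^sup>2)"
      by (rule comp(1))
    also have "\<dots> \<le> N.expectation (\<lambda>w. (norm (Z w))\<^sup>2 - 2 * \<epsilon> * (Z w \<bullet> j w) + \<epsilon>\<^sup>2 * C\<^sup>2)"
    proof (rule integral_mono[OF comp(2)])
      show "integrable N (\<lambda>w. (norm (Z w))\<^sup>2 - 2 * \<epsilon> * (Z w \<bullet> j w) + \<epsilon>\<^sup>2 * C\<^sup>2)"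
        using Z_square_integrable int_j by simp
      fix w assume w: "w \<in> space N"
      have "(norm (Y w - q w))\<^sup>2 = (norm (Z w))\<^sup>2 - 2 * \<epsilon> * (Z w \<bullet> j w) + \<epsilon>\<^sup>2 * (norm (j w))\<^sup>2"
        unfolding q_eq power2_norm_eq_inner
        by (simp add: inner_diff_left inner_diff_right inner_commute power2_eq_square algebra_simps)
      moreover have "\<epsilon>\<^sup>2 * (norm (j w))\<^sup>2 \<le> \<epsilon>\<^sup>2 * C\<^sup>2"
        using j_bd[OF w] by (intro mult_left_mono power_mono) auto
      ultimately show "(norm (Y w - q w))\<^sup>2 \<le> (norm (Z w))\<^sup>2 - 2 * \<epsilon> * (Z w \<bullet> j w) + \<epsilon>\<^sup>2 * C\<^sup>2"
        by linarith
    qed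
    also have "\<dots> = N.expectation (\<lambda>w. (norm (Z w))\<^sup>2) - 2 * \<epsilon> * N.expectation (\<lambda>w. Z w \<bullet> j w) + \<epsilon>\<^sup>2 * C\<^sup>2"
      using Z_square_integrable int_j by (simp add: N.prob_space)
    finally have "\<epsilon> * (2 * N.expectation (\<lambda>w. Z w \<bullet> j w)) \<le> \<epsilon> * (\<epsilon> * C\<^sup>2)"
      by (simp add: power2_eq_square algebra_simps)
    then show ?case using elim(2) by simp
  qed
  have "((\<lambda>\<epsilon>. \<epsilon> * (C\<^sup>2 / 2)) \<longlongrightarrow> 0 * (C\<^sup>2 / 2)) (at_right 0)" by (intro tendsto_intros)
  from tendsto_lowerbound[OF this ev] have "N.expectation (\<lambda>w. Z w \<bullet> j w) \<le> 0" by simp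
  also have "N.expectation (\<lambda>w. Z w \<bullet> j w)
      = N.expectation (\<lambda>w. Z w \<bullet> h w) - c * N.expectation (\<lambda>w. Z w \<bullet> f (\<tau> w))"
    using int_h int_f by (simp add: j_def inner_diff_right)
  finally show ?thesis by (simp add: h_def)
qed

text \<open>The inequality of the preceding lemma persists for the limiting value of \<open>c\<close>, and it turns into an
equality because it also holds for \<open>- u\<close> and \<open>- v\<close>.\<close>

lemma first_variation:
  assumes r: "r \<in> {0..1}"
  shows "N.expectation (\<lambda>w. Z w \<bullet> (u + ramp r (\<tau> w) *\<^sub>R v)) = multiplier * (v \<bullet> (f r - f 0))"
proof -
  have le: "N.expectation (\<lambda>w. Z w \<bullet> (u + ramp r (\<tau> w) *\<^sub>R v)) \<le> multiplier * (v \<bullet> (f r - f 0))" for u v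
  proof -
    define c0 where "c0 = v \<bullet> (f r - f 0) / L\<^sup>2"
    define A where "A = N.expectation (\<lambda>w. Z w \<bullet> f (\<tau> w))"
    have "\<forall>\<^sub>F c in at_right c0. N.expectation (\<lambda>w. Z w \<bullet> (u + ramp r (\<tau> w) *\<^sub>R v)) \<le> c * A"
      using eventually_at_right_less[of c0]
    proof eventually_elim
      case (elim c)
      then have "v \<bullet> (f r - f 0) < c * L\<^sup>2" using L_pos by (simp add: c0_def divide_less_eq)
      from first_variation_le[OF r this] show ?case by (simp add: A_def)
    qed
    moreover have "((\<lambda>c. c * A) \<longlongrightarrow> c0 * A) (at_right c0)" by (intro tendsto_intros)
    ultimately have "N.expectation (\<lambda>w. Z w \<bullet> (u + ramp r (\<tau> w) *\<^sub>R v)) \<le> c0 * A"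
      by (intro tendsto_lowerbound) auto
    then show ?thesis by (simp add: c0_def A_def multiplier_def mult.commute)
  qed
  have "- N.expectation (\<lambda>w. Z w \<bullet> (u + ramp r (\<tau> w) *\<^sub>R v))
      = N.expectation (\<lambda>w. Z w \<bullet> (- u + ramp r (\<tau> w) *\<^sub>R (- v)))"
    by (simp add: inner_add_right inner_diff_right flip: Bochner_Integration.integral_minus)
  also have "\<dots> \<le> - (multiplier * (v \<bullet> (f r - f 0)))"
    using le[of "- u" "- v"] by simp
  finally show ?thesis using le[of u v] by simp
qed

lemma multiplier_nonneg: "multiplier \<ge> 0"
  using first_variation_le[of 0 0 1 0] L_pos by (simp add: multiplier_def)

lemma Z_mean_zero: "N.expectation Z = 0"
proof -
  have "u \<bullet> N.expectation Z = 0" for u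
  proof -
    have "u \<bullet> N.expectation Z = N.expectation (\<lambda>w. u \<bullet> Z w)"
      using Z_integrable by simp
    also have "\<dots> = N.expectation (\<lambda>w. Z w \<bullet> (u + ramp 0 (\<tau> w) *\<^sub>R 0))"
      by (simp add: inner_commute)
    also have "\<dots> = 0" by (subst first_variation) auto
    finally show ?thesis .
  qed
  then show ?thesis by (metis inner_eq_zero_iff)
qed

lemma ramp_Z_integrable:
  assumes "r \<in> {0..1}"
  shows "integrable N (\<lambda>w. ramp r (\<tau> w) *\<^sub>R Z w)"
proof (rule Bochner_Integration.integrable_bound[OF Z_integrable])
  show "AE w in N. norm (ramp r (\<tau> w) *\<^sub>R Z w) \<le> norm (Z w)"
    using ramp_bound[OF assms tau_range] by (auto intro!: AE_I2 mult_left_le_one_le)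
qed measurable

lemma ramp_moment:
  assumes r: "r \<in> {0..1}"
  shows "N.expectation (\<lambda>w. ramp r (\<tau> w) *\<^sub>R Z w) = multiplier *\<^sub>R (f r - f 0)"
proof -
  have "v \<bullet> N.expectation (\<lambda>w. ramp r (\<tau> w) *\<^sub>R Z w) = v \<bullet> (multiplier *\<^sub>R (f r - f 0))" for v
  proof -
    have "v \<bullet> N.expectation (\<lambda>w. ramp r (\<tau> w) *\<^sub>R Z w) = N.expectation (\<lambda>w. v \<bullet> (ramp r (\<tau> w) *\<^sub>R Z w))"
      by (rule integral_inner_right[symmetric]) (rule ramp_Z_integrable[OF r])
    also have "\<dots> = N.expectation (\<lambda>w. Z w \<bullet> (0 + ramp r (\<tau> w) *\<^sub>R v))"
      by (simp add: inner_commute)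
    also have "\<dots> = v \<bullet> (multiplier *\<^sub>R (f r - f 0))" by (subst first_variation[OF r]) simp
    finally show ?thesis .
  qed
  then show ?thesis by (metis vector_eq_ldot)
qed

end

section \<open>Positivity of the multiplier\<close>

text \<open>The chord from \<open>t0\<close> to \<open>t'\<close> falls short of the Lipschitz bound by no more than the one from \<open>t0\<close> to
\<open>e\<close>. By the parallelogram law its two halves, which are bounded by the Lipschitz
constant, are then almost equal.\<close>

lemma lipschitz_second_difference:
  fixes f :: "real \<Rightarrow> 'a::real_inner"
  assumes lip: "L-lipschitz_on {0..1} f" and L: "0 \<le> L"
    and range: "t0 \<in> {0..1}" "e \<in> {0..1}" and \<theta>: "0 \<le> \<theta>" "\<theta> \<le> 1/2" and \<eta>: "0 \<le> \<eta>"
    and chord: "(1 - \<eta>) * L * \<bar>e - t0\<bar> \<le> norm (f e - f t0)"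
  defines "t \<equiv> t0 + \<theta> * (e - t0)" and "t' \<equiv> t0 + 2 * \<theta> * (e - t0)"
  shows "(norm (f t' - 2 *\<^sub>R f t + f t0))\<^sup>2 \<le> 2 * \<eta> * (L * \<bar>e - t0\<bar>)\<^sup>2"
proof -
  define a where "a = L * \<bar>e - t0\<bar>"
  have a: "a \<ge> 0" using L by (simp add: a_def)
  have conv: "t0 + c * (e - t0) \<in> {0..1}" if "0 \<le> c" "c \<le> 1" for c
  proof -
    have "(1 - c) *\<^sub>R t0 + c *\<^sub>R e \<in> {0..1}"
      using range that by (intro convexD) auto
    then show ?thesis by (simp add: algebra_simps)
  qed
  have t: "t \<in> {0..1}" and t': "t' \<in> {0..1}"
    using conv[of \<theta>] conv[of "2 * \<theta>"] \<theta> by (auto simp: t_def t'_def)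
  have lip': "norm (f x - f y) \<le> L * \<bar>x - y\<bar>" if "x \<in> {0..1}" "y \<in> {0..1}" for x y
    using lipschitz_onD[OF lip that] by (simp add: dist_norm)
  define u v where "u = f t - f t0" and "v = f t' - f t"
  have nu: "norm u \<le> \<theta> * a"
    using lip'[OF t range(1)] \<theta> by (simp add: u_def a_def t_def abs_mult mult_ac)
  have "\<bar>t' - t\<bar> = \<theta> * \<bar>e - t0\<bar>"
  proof -
    have "t' - t = \<theta> * (e - t0)" by (simp add: t_def t'_def)
    then show ?thesis using \<theta> by (simp add: abs_mult)
  qed
  then have nv: "norm v \<le> \<theta> * a"
    using lip'[OF t' t] by (simp add: v_def a_def mult_ac)
  have "\<bar>e - t'\<bar> = (1 - 2 * \<theta>) * \<bar>e - t0\<bar>"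
  proof -
    have "e - t' = (1 - 2 * \<theta>) * (e - t0)" by (simp add: t'_def algebra_simps)
    then show ?thesis using \<theta> by (simp add: abs_mult)
  qed
  then have "norm (f e - f t') \<le> (1 - 2 * \<theta>) * a"
    using lip'[OF range(2) t'] by (simp add: a_def mult_ac)
  moreover have "norm (f e - f t0) \<le> norm (f e - f t') + norm (u + v)"
    using norm_triangle_ineq[of "f e - f t'" "f t' - f t0"] by (simp add: u_def v_def)
  moreover have "(1 - \<eta>) * a \<le> norm (f e - f t0)" using chord by (simp add: a_def mult_ac)
  ultimately have "(1 - \<eta>) * a \<le> (1 - 2 * \<theta>) * a + norm (u + v)" by linarith
  then have uv: "(2 * \<theta> - \<eta>) * a \<le> norm (u + v)" by (simp add: algebra_simps)
  have par: "(norm (v - u))\<^sup>2 = 2 * (norm u)\<^sup>2 + 2 * (norm v)\<^sup>2 - (norm (u + v))\<^sup>2"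
    unfolding power2_norm_eq_inner by (simp add: inner_diff_left inner_diff_right inner_add_left inner_add_right inner_commute)
  have "(norm u)\<^sup>2 \<le> (\<theta> * a)\<^sup>2" "(norm v)\<^sup>2 \<le> (\<theta> * a)\<^sup>2" using nu nv by (auto intro: power_mono)
  then have "(norm (v - u))\<^sup>2 \<le> 4 * (\<theta> * a)\<^sup>2 - (norm (u + v))\<^sup>2" using par by linarith
  also have "\<dots> \<le> 4 * \<theta> * \<eta> * a\<^sup>2"
  proof (cases "\<eta> \<le> 2 * \<theta>")
    case True
    then have "((2 * \<theta> - \<eta>) * a)\<^sup>2 \<le> (norm (u + v))\<^sup>2" using uv a by (intro power_mono) auto
    moreover have "4 * (\<theta> * a)\<^sup>2 - ((2 * \<theta> - \<eta>) * a)\<^sup>2 = 4 * \<theta> * \<eta> * a\<^sup>2 - (\<eta> * a)\<^sup>2"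
      by (simp add: power2_eq_square algebra_simps)
    moreover have "(\<eta> * a)\<^sup>2 \<ge> 0" by simp
    ultimately show ?thesis by linarith
  next
    case False
    have "4 * (\<theta> * a)\<^sup>2 = 2 * \<theta> * a\<^sup>2 * (2 * \<theta>)" by (simp add: power2_eq_square)
    also have "\<dots> \<le> 2 * \<theta> * a\<^sup>2 * \<eta>" using False \<theta> by (intro mult_left_mono) auto
    also have "\<dots> \<le> 4 * \<theta> * \<eta> * a\<^sup>2"
    proof -
      have "0 \<le> \<theta> * \<eta> * a\<^sup>2" using \<theta> \<eta> by simp
      then show ?thesis by (simp add: mult_ac)
    qed
    finally show ?thesis using zero_le_power2[of "norm (u + v)"] by linarith
  qed
  also have "\<dots> = 4 * \<theta> * (\<eta> * a\<^sup>2)" by simp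
  also have "\<dots> \<le> 2 * (\<eta> * a\<^sup>2)" using \<theta> \<eta> by (intro mult_right_mono) auto
  also have "v - u = f t' - 2 *\<^sub>R f t + f t0" by (simp add: u_def v_def scaleR_2)
  finally show ?thesis by (simp add: a_def mult_ac)
qed

text \<open>Every short chord lowers the sum of the chords by \<open>\<eta> L / m\<close> below the bound \<open>L\<close>, to which the sums
converge.\<close>

lemma few_short_chords:
  fixes f :: "real \<Rightarrow> 'a::real_normed_vector" and \<eta> \<theta> :: real
  assumes lip: "L-lipschitz_on {0..1} f" and len: "curve_length f = ennreal L" and L: "0 < L"
    and \<eta>: "0 < \<eta>" and \<theta>: "0 < \<theta>"
  shows "\<forall>\<^sub>F m in sequentially.
    card {i. i < m \<and> norm (f (real (Suc i) / m) - f (real i / m)) < (1 - \<eta>) * L / m} \<le> \<theta> * m"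
proof -
  have "0 < \<theta> * \<eta> * L" using L \<eta> \<theta> by simp
  from lipschitz_equidistant_sums[OF lip len L this] eventually_gt_at_top[of 0]
  show ?thesis
  proof eventually_elim
    case (elim m)
    define S where "S = {i. i < m \<and> norm (f (real (Suc i) / m) - f (real i / m)) < (1 - \<eta>) * L / m}"
    have fin: "finite S" "S \<subseteq> {..<m}" by (auto simp: S_def)
    have "(\<Sum>j<m. norm (f (real (Suc j) / m) - f (real j / m))) \<le> (\<Sum>j<m. L / m - (if j \<in> S then \<eta> * L / m else 0))"
    proof (rule sum_mono)
      fix j assume j: "j \<in> {..<m}"
      show "norm (f (real (Suc j) / m) - f (real j / m)) \<le> L / m - (if j \<in> S then \<eta> * L / m else 0)"
      proof (cases "j \<in> S")
        case True
        then show ?thesis by (simp add: S_def left_diff_distrib diff_divide_distrib)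
      next
        case False
        have "real (Suc j) / m \<in> {0..1}" "real j / m \<in> {0..1}" using j by auto
        from lipschitz_onD[OF lip this] show ?thesis using False elim
          by (simp add: dist_norm add_divide_distrib)
      qed
    qed
    also have "\<dots> = L - card S * (\<eta> * L / m)"
      using elim fin by (simp add: sum_subtractf sum.If_cases Int_absorb1)
    finally have "card S * (\<eta> * L / m) < \<theta> * \<eta> * L" using elim by linarith
    then have "card S * (\<eta> * L) < \<theta> * m * (\<eta> * L)" using elim by (simp add: field_simps)
    then have "card S < \<theta> * m" using \<eta> L by (simp add: mult_less_cancel_right)
    then show ?case by (simp add: S_def)
  qed
qed

lemma eventually_div_le:
  fixes x y :: real
  assumes "0 < y"
  shows "\<forall>\<^sub>F m in sequentially. x * (1 / real m) \<le> y"
proof -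
  have "(\<lambda>m. x / real m) \<longlonglongrightarrow> 0" by (rule lim_const_over_n)
  then have "\<forall>\<^sub>F m in sequentially. x / real m < y" by (rule order_tendstoD) (rule assms)
  then show ?thesis by eventually_elim simp
qed

context lipschitz_coupling
begin

text \<open>If \<open>E (Z \<bullet> f \<tau>)\<close> vanishes, shrinking by \<open>1 - \<epsilon>\<close> with \<open>\<epsilon> \<le> 2 s / L\<close> costs only \<open>O(s\<^sup>2)\<close>, whereas
the spike of height \<open>s\<close> gains \<open>s \<delta> / 2\<close> on the event \<open>U\<close>.\<close>

lemma spike_mass_bound:
  assumes A: "N.expectation (\<lambda>w. Z w \<bullet> f (\<tau> w)) = 0"
    and U: "U \<in> sets N" and t0: "t0 \<in> {0..1}" and v: "norm v = 1" and s: "0 < s" "s \<le> 1"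
    and B: "0 \<le> B" "\<forall>t\<in>{0..1}. norm (f t) \<le> B" and R: "0 \<le> R" and \<delta>: "0 < \<delta>"
    and side: "\<And>w. w \<in> U \<Longrightarrow> \<delta> \<le> Z w \<bullet> v" "\<And>w. w \<in> U \<Longrightarrow> norm (Z w) \<le> R"
    and near: "\<And>w. w \<in> U \<Longrightarrow> 2 * (Z w \<bullet> (f (\<tau> w) - f t0)) + (L * \<bar>\<tau> w - t0\<bar> + s)\<^sup>2 \<le> s * \<delta>"
    and small: "\<And>w. w \<in> U \<Longrightarrow> 8 * (L * \<bar>\<tau> w - t0\<bar> + s) * (R + B) \<le> L * \<delta>"
  shows "N.prob U \<le> 8 * (B + 1)\<^sup>2 / (L\<^sup>2 * \<delta>) * s"
proof -
  \<comment> \<open>This is the shrinking that restores the length \<open>L\<close>.\<close>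
  define \<epsilon> where "\<epsilon> = 2 * s / (L + 2 * s)"
  have den: "L + 2 * s > 0" using L_pos s by simp
  have eps: "0 \<le> \<epsilon>" "\<epsilon> \<le> 1" "(1 - \<epsilon>) * (L + 2 * s) = L"
    using den s L_pos by (auto simp: \<epsilon>_def divide_le_eq left_diff_distrib)
  have eps_le: "\<epsilon> \<le> 2 * s / L"
    unfolding \<epsilon>_def using s L_pos by (intro divide_left_mono) auto
  have tip: "norm (f t0 + s *\<^sub>R v - f (\<tau> w)) \<le> L * \<bar>\<tau> w - t0\<bar> + s" if "w \<in> U" for w
  proof -
    have "w \<in> space N" using that U sets.sets_into_space by blast
    then have "norm (f t0 - f (\<tau> w)) \<le> L * \<bar>\<tau> w - t0\<bar>"
      using f_lip[OF t0 tau_range] by (simp add: norm_minus_commute)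
    moreover have "norm (f t0 - f (\<tau> w) + s *\<^sub>R v) \<le> norm (f t0 - f (\<tau> w)) + s"
      using norm_triangle_ineq[of "f t0 - f (\<tau> w)" "s *\<^sub>R v"] v s by simp
    moreover have eq: "f t0 + s *\<^sub>R v - f (\<tau> w) = f t0 - f (\<tau> w) + s *\<^sub>R v" by simp
    ultimately show ?thesis unfolding eq by linarith
  qed
  have "N.prob U * (s * \<delta> / 2) \<le> 2 * \<epsilon> * N.expectation (\<lambda>w. Z w \<bullet> f (\<tau> w)) + \<epsilon>\<^sup>2 * (B + 1)\<^sup>2"
  proof (rule spike_bound[OF U t0 v s eps(1,2) f_length, where R = R])
    fix w assume w: "w \<in> U"
    have "(norm (f t0 + s *\<^sub>R v - f (\<tau> w)))\<^sup>2 \<le> (L * \<bar>\<tau> w - t0\<bar> + s)\<^sup>2"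
      using tip[OF w] by (rule power_mono) simp
    then show "2 * (Z w \<bullet> (f (\<tau> w) - f t0)) + (norm (f t0 + s *\<^sub>R v - f (\<tau> w)))\<^sup>2 \<le> s * \<delta>"
      using near[OF w] by linarith
    have "4 * \<epsilon> * norm (f t0 + s *\<^sub>R v - f (\<tau> w)) * (R + B)
        \<le> 4 * (2 * s / L) * (L * \<bar>\<tau> w - t0\<bar> + s) * (R + B)"
      using tip[OF w] eps(1) eps_le B(1) R s L_pos by (intro mult_mono) auto
    also have "\<dots> = s / L * (8 * (L * \<bar>\<tau> w - t0\<bar> + s) * (R + B))" by simp
    also have "\<dots> \<le> s / L * (L * \<delta>)" using small[OF w] s L_pos by (intro mult_left_mono) auto
    finally show "4 * \<epsilon> * norm (f t0 + s *\<^sub>R v - f (\<tau> w)) * (R + B) \<le> s * \<delta>" using L_pos by simp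
  qed (use L_pos eps B R side in auto)
  also have "\<dots> \<le> (2 * s / L)\<^sup>2 * (B + 1)\<^sup>2"
    unfolding A using eps eps_le by (simp add: mult_right_mono power_mono)
  also have "\<dots> = (8 * (B + 1)\<^sup>2 / (L\<^sup>2 * \<delta>) * s) * (s * \<delta> / 2)"
    using L_pos \<delta> by (simp add: power_divide power2_eq_square)
  finally show ?thesis using s \<delta> by (simp only: mult_le_cancel_right) simp
qed

lemma nearest_variation:
  assumes w: "w \<in> space N" "norm (Z w) = infdist (Y w) (path_image f)" and t: "t \<in> {0..1}"
  shows "2 * (Z w \<bullet> (f t - f (\<tau> w))) \<le> (norm (f t - f (\<tau> w)))\<^sup>2"
proof -
  have "f t \<in> path_image f" using t by (simp add: path_image_def)
  then have "norm (Z w) \<le> norm (Y w - f t)"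
    using infdist_le[of "f t" "path_image f" "Y w"] w(2) by (simp add: dist_norm)
  also have "Y w - f t = Z w - (f t - f (\<tau> w))" by (simp add: Z_def)
  finally have "(norm (Z w))\<^sup>2 \<le> (norm (Z w - (f t - f (\<tau> w))))\<^sup>2" by (rule power_mono) simp
  then show ?thesis
    unfolding power2_norm_eq_inner by (simp add: inner_diff_left inner_diff_right inner_commute)
qed

text \<open>Where \<open>f\<close> is differentiable, \<open>Z\<close> is orthogonal to the curve. The substitute is a comparison of
\<open>f (\<tau> w)\<close> with the point at the reflection \<open>t'\<close> of \<open>t0\<close> in \<open>\<tau> w\<close>: as the former is nearest,
\<open>Z \<bullet> (f t' - f (\<tau> w))\<close> is at most of second order, and on a nearly straight stretch this
increment is almost equal to \<open>f (\<tau> w) - f t0\<close>.\<close>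

lemma nearest_one_sided_variation:
  assumes w: "w \<in> space N" "norm (Z w) = infdist (Y w) (path_image f)" and R: "norm (Z w) \<le> R"
    and range: "t0 \<in> {0..1}" "e \<in> {0..1}" and \<theta>: "0 \<le> \<theta>" "\<theta> \<le> 1/2" "\<tau> w = t0 + \<theta> * (e - t0)"
    and \<sigma>: "0 \<le> \<sigma>" and chord: "(1 - \<sigma>\<^sup>2 / 2) * L * \<bar>e - t0\<bar> \<le> norm (f e - f t0)"
  shows "2 * (Z w \<bullet> (f (\<tau> w) - f t0)) \<le> (L * \<bar>e - t0\<bar>)\<^sup>2 / 4 + 2 * R * (\<sigma> * (L * \<bar>e - t0\<bar>))"
proof -
  define t' where "t' = t0 + 2 * \<theta> * (e - t0)"
  define a where "a = L * \<bar>e - t0\<bar>"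
  have a: "a \<ge> 0" using L_pos by (simp add: a_def)
  have "(1 - 2 * \<theta>) *\<^sub>R t0 + (2 * \<theta>) *\<^sub>R e \<in> {0..1}"
    using range \<theta>(1,2) by (intro convexD) auto
  then have t': "t' \<in> {0..1}" by (simp add: t'_def algebra_simps)
  have "(norm (f t' - 2 *\<^sub>R f (\<tau> w) + f t0))\<^sup>2 \<le> 2 * (\<sigma>\<^sup>2 / 2) * a\<^sup>2"
    unfolding t'_def a_def \<theta>(3)
    by (rule lipschitz_second_difference[OF f_lipschitz _ range \<theta>(1,2) _ chord]) (use L_pos in auto)
  also have "2 * (\<sigma>\<^sup>2 / 2) * a\<^sup>2 = (\<sigma> * a)\<^sup>2" by (simp add: power_mult_distrib)
  finally have second: "norm (f t' - 2 *\<^sub>R f (\<tau> w) + f t0) \<le> \<sigma> * a"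
    by (rule power2_le_imp_le) (rule mult_nonneg_nonneg[OF \<sigma> a])
  have "\<bar>t' - \<tau> w\<bar> = \<theta> * \<bar>e - t0\<bar>"
  proof -
    have "t' - \<tau> w = \<theta> * (e - t0)" unfolding \<theta>(3) t'_def by (simp add: algebra_simps)
    then show ?thesis using \<theta>(1) by (simp add: abs_mult)
  qed
  then have "norm (f t' - f (\<tau> w)) \<le> \<theta> * a"
    using f_lip[OF tau_range[OF w(1)] t'] by (simp add: a_def mult_ac)
  also have "\<dots> \<le> 1/2 * a" using \<theta>(2) a by (intro mult_right_mono) auto
  finally have "(norm (f t' - f (\<tau> w)))\<^sup>2 \<le> (a / 2)\<^sup>2" by (intro power_mono) auto
  then have 1: "2 * (Z w \<bullet> (f t' - f (\<tau> w))) \<le> a\<^sup>2 / 4"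
    using nearest_variation[OF w t'] by (simp add: power_divide)
  have "- (Z w \<bullet> (f t' - 2 *\<^sub>R f (\<tau> w) + f t0)) \<le> norm (Z w) * norm (f t' - 2 *\<^sub>R f (\<tau> w) + f t0)"
    using Cauchy_Schwarz_ineq2[of "Z w" "f t' - 2 *\<^sub>R f (\<tau> w) + f t0"] by linarith
  also have "\<dots> \<le> R * (\<sigma> * a)" using second R order_trans[OF norm_ge_zero R] by (intro mult_mono) auto
  finally have "- (Z w \<bullet> (f t' - 2 *\<^sub>R f (\<tau> w) + f t0)) \<le> R * (\<sigma> * a)" .
  moreover have "Z w \<bullet> (f (\<tau> w) - f t0)
      = Z w \<bullet> (f t' - f (\<tau> w)) - Z w \<bullet> (f t' - 2 *\<^sub>R f (\<tau> w) + f t0)"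
    by (simp add: inner_diff_right inner_add_right)
  ultimately show ?thesis using 1 unfolding a_def by linarith
qed

text \<open>Suppose that the multiplier vanishes, and cut \<open>[0, 1]\<close> into windows of length \<open>a = 1/m\<close>. On any
window, a spike of height \<open>\<kappa> a\<close> dominates all first-order errors and catches the whole window, so its
probability is at most \<open>C \<kappa> a\<close>. On a nearly straight window, a spike at either end of height only
\<open>a / K\<close> catches the adjacent half, so the probability is at most \<open>2 C a / K\<close>. The constants are
chosen such that the straight windows together have probability at most \<open>p0 / 3\<close>, and so have the
few others, although the windows cover the event \<open>U\<close> of probability \<open>p0\<close>.\<close>

lemma multiplier_pos: "multiplier > 0"
proof (rule ccontr)
  assume "\<not> ?thesis"
  then have "multiplier = 0" using multiplier_nonneg by simp
  then have A: "N.expectation (\<lambda>w. Z w \<bullet> f (\<tau> w)) = 0" using L_pos by (simp add: multiplier_def)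
  obtain B where B: "B > 0" "\<forall>t\<in>{0..1}. norm (f t) \<le> B" by (rule f_bounded)
  obtain v and n :: nat where v: "norm v = 1"
    and p: "N.prob {w \<in> space N. 1 / Suc n \<le> Z w \<bullet> v \<and> norm (Z w) \<le> Suc n} > 0"
    by (rule exists_loss_direction)
  define R \<delta> where "R = real (Suc n)" and "\<delta> = 1 / real (Suc n)"
  have R: "R > 0" "\<delta> > 0" by (auto simp: R_def \<delta>_def)
  define U where "U = {w \<in> space N. \<delta> \<le> Z w \<bullet> v \<and> norm (Z w) \<le> R
    \<and> norm (Z w) = infdist (Y w) (path_image f)}"
  have U_meas [measurable]: "U \<in> sets N" unfolding U_def by measurable
  have U: "w \<in> space N" "\<delta> \<le> Z w \<bullet> v" "norm (Z w) \<le> R" "norm (Z w) = infdist (Y w) (path_image f)"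
    if "w \<in> U" for w using that by (auto simp: U_def)
  define p0 where "p0 = N.prob U"
  have "N.prob {w \<in> space N. 1 / Suc n \<le> Z w \<bullet> v \<and> norm (Z w) \<le> Suc n} = p0"
    unfolding p0_def U_def R_def \<delta>_def
    by (rule N.finite_measure_eq_AE) (use Z_nearest in \<open>auto elim: eventually_mono\<close>)
  then have p0: "p0 > 0" using p by simp
  define C where "C = 8 * (B + 1)\<^sup>2 / (L\<^sup>2 * \<delta>)"
  have C: "C > 0" using B R L_pos by (simp add: C_def)
  define K where "K = 6 * C / p0"
  have K: "K > 0" using C p0 by (simp add: K_def)
  define \<kappa> where "\<kappa> = 4 * R * L / \<delta>"
  have \<kappa>: "\<kappa> > 0" using R L_pos by (simp add: \<kappa>_def)
  \<comment> \<open>With this straightness, the error \<open>2 R \<sigma> L a\<close> is one eighth of the gain \<open>\<delta> a / K\<close>.\<close>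
  define \<sigma> where "\<sigma> = \<delta> / (16 * R * L * K)"
  have \<sigma>: "\<sigma> > 0" using R L_pos K by (simp add: \<sigma>_def)
  define \<theta> where "\<theta> = p0 / (3 * C * \<kappa>)"
  have \<theta>: "\<theta> > 0" using p0 C \<kappa> by (simp add: \<theta>_def)
  define W where "W m i = {w \<in> U. real i / real m \<le> \<tau> w \<and> \<tau> w \<le> real (Suc i) / real m}" for m i :: nat
  define bad where "bad m = {i. i < m \<and> norm (f (real (Suc i) / m) - f (real i / m)) < (1 - \<sigma>\<^sup>2 / 2) * L / m}" for m :: nat
  have between: "{w \<in> U. x \<le> \<tau> w \<and> \<tau> w \<le> y} \<in> sets N" for x y
  proof -
    have "{w \<in> U. x \<le> \<tau> w \<and> \<tau> w \<le> y} = U \<inter> {w \<in> space N. x \<le> \<tau> w \<and> \<tau> w \<le> y}"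
      using U(1) by auto
    then show ?thesis by simp
  qed
  have "\<forall>\<^sub>F m in sequentially. p0 \<le> 2 * p0 / 3"
  proof -
    have "0 < \<sigma>\<^sup>2 / 2" "0 < \<kappa> * \<delta> / 2" "0 < L * \<delta>" "0 < \<delta> / (8 * K)" "0 < \<delta> / (2 * K)"
      using \<sigma> \<kappa> R K L_pos by simp_all
    note pos = this
    show ?thesis
      using eventually_gt_at_top[of 0] few_short_chords[OF f_lipschitz curve_length_eq L_pos pos(1) \<theta>]
        eventually_div_le[OF zero_less_one, of \<kappa>]
        eventually_div_le[OF pos(2), of "(L + \<kappa>)\<^sup>2"]
        eventually_div_le[OF pos(3), of "8 * (L + \<kappa>) * (R + B)"]
        eventually_div_le[OF zero_less_one, of "1 / K"]
        eventually_div_le[OF pos(4), of "L\<^sup>2 / 4"]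
        eventually_div_le[OF pos(5), of "(L + 1 / K)\<^sup>2"]
        eventually_div_le[OF pos(3), of "8 * (L + 1 / K) * (R + B)"]
    proof eventually_elim
      case (elim m)
      define a where "a = 1 / real m"
      have a: "a > 0" using elim(1) by (simp add: a_def)
      have step: "real (Suc i) / m = real i / m + a" for i by (simp add: a_def add_divide_distrib)
      note bounds = elim(3-9)[folded a_def]
      have coarse: "N.prob (W m i) \<le> C * (\<kappa> * a)" if i: "i < m" for i
        unfolding C_def
      proof (rule spike_mass_bound[OF A _ _ v])
        show "W m i \<in> sets N" unfolding W_def by (rule between)
        show "real i / m \<in> {0..1}" using i by auto
        fix w assume w: "w \<in> W m i"
        then have wU: "w \<in> U" and wt: "\<bar>\<tau> w - real i / m\<bar> \<le> a"
          using step[of i] by (auto simp: W_def)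
        have le: "L * \<bar>\<tau> w - real i / m\<bar> + \<kappa> * a \<le> (L + \<kappa>) * a"
          using wt L_pos by (simp add: distrib_right)
        have ge: "0 \<le> L * \<bar>\<tau> w - real i / m\<bar> + \<kappa> * a" using L_pos \<kappa> a by simp
        have "Z w \<bullet> (f (\<tau> w) - f (real i / m)) \<le> norm (Z w) * norm (f (\<tau> w) - f (real i / m))"
          by (rule norm_cauchy_schwarz)
        also have "\<dots> \<le> R * (L * a)"
        proof (intro mult_mono)
          have "norm (f (\<tau> w) - f (real i / m)) \<le> L * \<bar>\<tau> w - real i / m\<bar>"
            using i by (intro f_lip tau_range U(1) wU) auto
          also have "\<dots> \<le> L * a" using wt L_pos by (intro mult_left_mono) auto
          finally show "norm (f (\<tau> w) - f (real i / m)) \<le> L * a" .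
        qed (use U(3)[OF wU] R in auto)
        also have "\<dots> = \<kappa> * a * \<delta> / 4" using R by (simp add: \<kappa>_def)
        finally have 1: "2 * (Z w \<bullet> (f (\<tau> w) - f (real i / m))) \<le> \<kappa> * a * \<delta> / 2" by simp
        have "(L * \<bar>\<tau> w - real i / m\<bar> + \<kappa> * a)\<^sup>2 \<le> ((L + \<kappa>) * a)\<^sup>2"
          using le ge by (rule power_mono)
        also have "\<dots> = ((L + \<kappa>)\<^sup>2 * a) * a" by (simp add: power2_eq_square)
        also have "\<dots> \<le> (\<kappa> * \<delta> / 2) * a" using bounds(2) a by (intro mult_right_mono) auto
        also have "\<dots> = \<kappa> * a * \<delta> / 2" by simp
        finally show "2 * (Z w \<bullet> (f (\<tau> w) - f (real i / m))) + (L * \<bar>\<tau> w - real i / m\<bar> + \<kappa> * a)\<^sup>2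
            \<le> \<kappa> * a * \<delta>" using 1 by linarith
        have "8 * (L * \<bar>\<tau> w - real i / m\<bar> + \<kappa> * a) * (R + B) \<le> 8 * ((L + \<kappa>) * a) * (R + B)"
          using le R B by (intro mult_right_mono mult_left_mono) auto
        also have "\<dots> \<le> L * \<delta>" using bounds(3) by (simp add: mult_ac)
        finally show "8 * (L * \<bar>\<tau> w - real i / m\<bar> + \<kappa> * a) * (R + B) \<le> L * \<delta>" .
      qed (use B R U \<kappa> a bounds in \<open>auto simp: W_def\<close>)
      have fine: "N.prob V \<le> C * (a / K)"
        if V: "V \<in> sets N" "V \<subseteq> U" and t0: "t0 \<in> {0..1}" "e \<in> {0..1}" "\<bar>e - t0\<bar> = a"
          and chord: "(1 - \<sigma>\<^sup>2 / 2) * L * a \<le> norm (f e - f t0)"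
          and th: "\<And>w. w \<in> V \<Longrightarrow> \<exists>\<theta>. 0 \<le> \<theta> \<and> \<theta> \<le> 1/2 \<and> \<tau> w = t0 + \<theta> * (e - t0)" for V t0 e
        unfolding C_def
      proof (rule spike_mass_bound[OF A V(1) t0(1) v])
        fix w assume w: "w \<in> V"
        then have wU: "w \<in> U" using V by blast
        obtain \<theta> where \<theta>: "0 \<le> \<theta>" "\<theta> \<le> 1/2" "\<tau> w = t0 + \<theta> * (e - t0)" using th[OF w] by blast
        have wt: "\<bar>\<tau> w - t0\<bar> \<le> a"
        proof -
          have "\<bar>\<tau> w - t0\<bar> = \<theta> * a" using \<theta>(1) t0(3) unfolding \<theta>(3) by (simp add: abs_mult)
          also have "\<dots> \<le> 1 * a" using \<theta>(2) a by (intro mult_right_mono) auto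
          finally show ?thesis by simp
        qed
        define P where "P = a / K * \<delta>"
        have le: "L * \<bar>\<tau> w - t0\<bar> + a / K \<le> (L + 1 / K) * a"
          using wt L_pos by (simp add: distrib_right)
        have ge: "0 \<le> L * \<bar>\<tau> w - t0\<bar> + a / K" using L_pos K a by simp
        have "2 * (Z w \<bullet> (f (\<tau> w) - f t0)) \<le> (L * a)\<^sup>2 / 4 + 2 * R * (\<sigma> * (L * a))"
          using nearest_one_sided_variation[OF U(1)[OF wU] U(4)[OF wU] U(3)[OF wU] t0(1,2) \<theta>, of \<sigma>]
            chord \<sigma> unfolding t0(3) by simp
        also have "(L * a)\<^sup>2 / 4 = (L\<^sup>2 / 4 * a) * a" by (simp add: power2_eq_square)
        also have "\<dots> \<le> \<delta> / (8 * K) * a" using bounds(5) a by (intro mult_right_mono) auto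
        also have "2 * R * (\<sigma> * (L * a)) = \<delta> / (8 * K) * a"
          using R L_pos K by (simp add: \<sigma>_def)
        finally have 1: "2 * (Z w \<bullet> (f (\<tau> w) - f t0)) \<le> a / K * \<delta> / 4" by (simp add: mult_ac)
        have "(L * \<bar>\<tau> w - t0\<bar> + a / K)\<^sup>2 \<le> ((L + 1 / K) * a)\<^sup>2"
          using le ge by (rule power_mono)
        also have "\<dots> = ((L + 1 / K)\<^sup>2 * a) * a" by (simp add: power2_eq_square)
        also have "\<dots> \<le> (\<delta> / (2 * K)) * a" using bounds(6) a by (intro mult_right_mono) auto
        finally have "(L * \<bar>\<tau> w - t0\<bar> + a / K)\<^sup>2 \<le> a / K * \<delta> / 2" by (simp add: mult_ac)
        moreover have "0 \<le> a / K * \<delta>" using a K R by simp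
        ultimately show "2 * (Z w \<bullet> (f (\<tau> w) - f t0)) + (L * \<bar>\<tau> w - t0\<bar> + a / K)\<^sup>2 \<le> a / K * \<delta>"
          using 1 unfolding P_def[symmetric] by linarith
        have "8 * (L * \<bar>\<tau> w - t0\<bar> + a / K) * (R + B) \<le> 8 * ((L + 1 / K) * a) * (R + B)"
          using le R B by (intro mult_right_mono mult_left_mono) auto
        also have "\<dots> \<le> L * \<delta>" using bounds(7) by (simp add: mult_ac)
        finally show "8 * (L * \<bar>\<tau> w - t0\<bar> + a / K) * (R + B) \<le> L * \<delta>" .
      qed (use B R U V(2) K a bounds(4) in auto)
      have good: "N.prob (W m i) \<le> 2 * (C * (a / K))" if i: "i < m" "i \<notin> bad m" for i
      proof -
        define x where "x = real i / m"
        have x: "x \<in> {0..1}" "x + a \<in> {0..1}"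
          using i step[of i] by (auto simp: x_def simp flip: step)
        have chord: "(1 - \<sigma>\<^sup>2 / 2) * L * a \<le> norm (f (x + a) - f x)"
          using i step[of i] by (simp add: bad_def x_def a_def not_less)
        define V1 where "V1 = {w \<in> U. x \<le> \<tau> w \<and> \<tau> w \<le> x + a / 2}"
        define V2 where "V2 = {w \<in> U. x + a / 2 \<le> \<tau> w \<and> \<tau> w \<le> x + a}"
        have V: "V1 \<in> sets N" "V2 \<in> sets N" unfolding V1_def V2_def by (rule between)+
        have "N.prob V1 \<le> C * (a / K)"
        proof (rule fine[OF V(1) _ x])
          show "\<exists>\<theta>\<ge>0. \<theta> \<le> 1 / 2 \<and> \<tau> w = x + \<theta> * (x + a - x)" if "w \<in> V1" for w
            using that a by (intro exI[of _ "(\<tau> w - x) / a"]) (auto simp: V1_def divide_le_eq)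
        qed (use a chord in \<open>auto simp: V1_def\<close>)
        moreover have "N.prob V2 \<le> C * (a / K)"
        proof (rule fine[OF V(2) _ x(2,1)])
          show "\<exists>\<theta>\<ge>0. \<theta> \<le> 1 / 2 \<and> \<tau> w = x + a + \<theta> * (x - (x + a))" if "w \<in> V2" for w
            using that a by (intro exI[of _ "(x + a - \<tau> w) / a"]) (auto simp: V2_def divide_le_eq)
        qed (use a chord in \<open>auto simp: V2_def norm_minus_commute\<close>)
        moreover have "N.prob (W m i) \<le> N.prob V1 + N.prob V2"
        proof -
          have "N.prob (W m i) \<le> N.prob (V1 \<union> V2)"
            using V step[of i] by (intro N.finite_measure_mono) (auto simp: W_def V1_def V2_def x_def)
          also have "\<dots> \<le> N.prob V1 + N.prob V2" by (rule measure_Un_le[OF V])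
          finally show ?thesis .
        qed
        ultimately show ?thesis by simp
      qed
      have bad: "bad m \<subseteq> {..<m}" "finite (bad m)" by (auto simp: bad_def)
      have "p0 \<le> (\<Sum>i<m. N.prob (W m i))"
        unfolding p0_def W_def by (rule window_cover[OF U_meas elim(1)])
      also have "\<dots> \<le> (\<Sum>i<m. 2 * (C * (a / K)) + (if i \<in> bad m then C * (\<kappa> * a) else 0))"
      proof (rule sum_mono)
        fix i assume "i \<in> {..<m}"
        moreover have "0 \<le> C * (a / K)" using C a K by simp
        ultimately show "N.prob (W m i) \<le> 2 * (C * (a / K)) + (if i \<in> bad m then C * (\<kappa> * a) else 0)"
          using good[of i] coarse[of i] by auto
      qed
      also have "\<dots> = m * (2 * (C * (a / K))) + card (bad m) * (C * (\<kappa> * a))"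
        using bad by (simp add: sum.distrib sum.If_cases Int_absorb1)
      also have "\<dots> \<le> m * (2 * (C * (a / K))) + (\<theta> * m) * (C * (\<kappa> * a))"
        using elim(2) C \<kappa> a by (intro add_left_mono mult_right_mono) (auto simp: bad_def)
      also have "\<dots> = 2 * p0 / 3"
        using elim(1) C p0 \<kappa> by (simp add: a_def K_def \<theta>_def field_simps)
      finally show "p0 \<le> 2 * p0 / 3" .
    qed
  qed
  then show False using p0 by (simp add: eventually_sequentially)
qed

end

section \<open>One-sided derivatives and speed\<close>

lemma chord_bound_imp_right_derivative:
  fixes f :: "real \<Rightarrow> 'a::real_normed_vector"
  assumes "\<And>e. e > 0 \<Longrightarrow> \<exists>b>a. \<forall>t\<in>{a..b}. norm (f t - f a - (t - a) *\<^sub>R p) \<le> e * (t - a)"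
  shows "(f has_vector_derivative p) (at_right a)"
  unfolding has_vector_derivative_def has_derivative_within_alt
proof (intro conjI allI impI)
  show "bounded_linear (\<lambda>x. x *\<^sub>R p)" by (rule bounded_linear_scaleR_left)
  fix e :: real assume "e > 0"
  from assms[OF this] obtain b where b: "b > a"
    "\<And>t. t \<in> {a..b} \<Longrightarrow> norm (f t - f a - (t - a) *\<^sub>R p) \<le> e * (t - a)" by blast
  show "\<exists>d>0. \<forall>y\<in>{a<..}. norm (y - a) < d \<longrightarrow> norm (f y - f a - (y - a) *\<^sub>R p) \<le> e * norm (y - a)"
  proof (intro exI conjI ballI impI)
    show "b - a > 0" using b by simp
    fix y assume "y \<in> {a<..}" "norm (y - a) < b - a"
    then show "norm (f y - f a - (y - a) *\<^sub>R p) \<le> e * norm (y - a)" using b(2)[of y] by simp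
  qed
qed

lemma chord_bound_imp_left_derivative:
  fixes f :: "real \<Rightarrow> 'a::real_normed_vector"
  assumes "\<And>e. e > 0 \<Longrightarrow> \<exists>a<b. \<forall>t\<in>{a..b}. norm (f b - f t - (b - t) *\<^sub>R p) \<le> e * (b - t)"
  shows "(f has_vector_derivative p) (at_left b)"
  unfolding has_vector_derivative_def has_derivative_within_alt
proof (intro conjI allI impI)
  show "bounded_linear (\<lambda>x. x *\<^sub>R p)" by (rule bounded_linear_scaleR_left)
  fix e :: real assume "e > 0"
  from assms[OF this] obtain a where a: "a < b"
    "\<And>t. t \<in> {a..b} \<Longrightarrow> norm (f b - f t - (b - t) *\<^sub>R p) \<le> e * (b - t)" by blast
  show "\<exists>d>0. \<forall>y\<in>{..<b}. norm (y - b) < d \<longrightarrow> norm (f y - f b - (y - b) *\<^sub>R p) \<le> e * norm (y - b)"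
  proof (intro exI conjI ballI impI)
    show "b - a > 0" using a by simp
    fix y assume y: "y \<in> {..<b}" "norm (y - b) < b - a"
    have "f y - f b - (y - b) *\<^sub>R p = - (f b - f y - (b - y) *\<^sub>R p)" by (simp add: algebra_simps)
    then have "norm (f y - f b - (y - b) *\<^sub>R p) = norm (f b - f y - (b - y) *\<^sub>R p)"
      by (metis norm_minus_cancel)
    then show "norm (f y - f b - (y - b) *\<^sub>R p) \<le> e * norm (y - b)" using a(2)[of y] y by simp
  qed
qed

text \<open>The hypothesis holds for one-sided derivatives that are strict, that is, uniform over all pairs of
points near the base point on one side. On such a one-sided neighbourhood \<open>f\<close> has a Lipschitz
constant close to \<open>norm p\<close>.\<close>

lemma speed_eq_of_full_length:
  fixes f :: "real \<Rightarrow> 'a::real_normed_vector"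
  assumes lip: "L-lipschitz_on {0..1} f" and len: "curve_length f = ennreal L" and L: "L > 0"
    and window: "\<And>e. e > 0 \<Longrightarrow> \<exists>a b. 0 \<le> a \<and> a < b \<and> b \<le> 1 \<and>
      (\<forall>s t. a \<le> s \<longrightarrow> s \<le> t \<longrightarrow> t \<le> b \<longrightarrow> norm (f t - f s - (t - s) *\<^sub>R p) \<le> e * (t - s))"
  shows "norm p = L"
proof (rule antisym)
  show "norm p \<le> L"
  proof (rule field_le_epsilon)
    fix e :: real assume "e > 0"
    then obtain a b where ab: "0 \<le> a" "a < b" "b \<le> 1"
      "\<And>s t. a \<le> s \<Longrightarrow> s \<le> t \<Longrightarrow> t \<le> b \<Longrightarrow> norm (f t - f s - (t - s) *\<^sub>R p) \<le> e * (t - s)"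
      using window by blast
    have "norm ((b - a) *\<^sub>R p) \<le> norm (f b - f a) + norm (f b - f a - (b - a) *\<^sub>R p)"
      using norm_triangle_ineq4[of "f b - f a" "f b - f a - (b - a) *\<^sub>R p"] by simp
    also have "\<dots> \<le> L * (b - a) + e * (b - a)"
      using ab lipschitz_onD[OF lip, of b a] by (intro add_mono ab(4)) (auto simp: dist_norm)
    also have "norm ((b - a) *\<^sub>R p) = (b - a) * norm p" using ab by simp
    also have "L * (b - a) + e * (b - a) = (b - a) * (L + e)" by (simp add: algebra_simps)
    finally show "norm p \<le> L + e" using ab by simp
  qed
next
  show "L \<le> norm p"
  proof (rule ccontr)
    assume lt: "\<not> L \<le> norm p"
    define e where "e = (L - norm p) / 2"
    have e: "e > 0" "norm p + e < L" using lt by (auto simp: e_def field_simps)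
    obtain a b where ab: "0 \<le> a" "a < b" "b \<le> 1"
      "\<And>s t. a \<le> s \<Longrightarrow> s \<le> t \<Longrightarrow> t \<le> b \<Longrightarrow> norm (f t - f s - (t - s) *\<^sub>R p) \<le> e * (t - s)"
      using window[OF e(1)] by blast
    have ord: "norm (f t - f s) \<le> (norm p + e) * \<bar>t - s\<bar>" if "a \<le> s" "s \<le> t" "t \<le> b" for s t
    proof -
      have "norm (f t - f s) \<le> norm (f t - f s - (t - s) *\<^sub>R p) + norm ((t - s) *\<^sub>R p)"
        using norm_triangle_ineq[of "f t - f s - (t - s) *\<^sub>R p" "(t - s) *\<^sub>R p"] by simp
      also have "norm ((t - s) *\<^sub>R p) = (t - s) * norm p" using that by simp
      finally have "norm (f t - f s) \<le> e * (t - s) + (t - s) * norm p" using ab(4)[OF that] by linarith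
      then show ?thesis using that by (simp add: algebra_simps)
    qed
    have "(norm p + e)-lipschitz_on {a..b} f"
    proof (rule lipschitz_onI)
      fix x y assume "x \<in> {a..b}" "y \<in> {a..b}"
      then show "dist (f x) (f y) \<le> (norm p + e) * dist x y"
        using ord[of x y] ord[of y x]
        by (cases "x \<le> y") (auto simp: dist_norm norm_minus_commute abs_minus_commute)
    qed (use e in auto)
    from lipschitz_subinterval_curve_length[OF lip ab(1) _ ab(3) this]
    have le: "ennreal L \<le> ennreal (L - (L - (norm p + e)) * (b - a))" using ab e len by simp
    have gain: "0 < (L - (norm p + e)) * (b - a)" using ab e by simp
    show False
    proof (cases "0 \<le> L - (L - (norm p + e)) * (b - a)")
      case True
      then show ?thesis using le gain L by (simp add: ennreal_le_iff)
    next
      case False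
      then show ?thesis using le L by (simp add: ennreal_neg)
    qed
  qed
qed

context lipschitz_coupling
begin

definition moment :: "real set \<Rightarrow> 'a" where
  "moment S = N.expectation (\<lambda>w. indicator S (\<tau> w) *\<^sub>R Z w)"

text \<open>For \<open>S = {t<..}\<close> and \<open>S = {t..}\<close> these are the right and the left derivative of \<open>f\<close> at \<open>t\<close>.\<close>

definition slope :: "real set \<Rightarrow> 'a" where
  "slope S = (moment S - closing *\<^sub>R N.expectation (\<lambda>w. \<tau> w *\<^sub>R Z w)) /\<^sub>R multiplier"

definition oscillation :: "real \<Rightarrow> real \<Rightarrow> real" where
  "oscillation a b = N.expectation (\<lambda>w. indicator {a<..<b} (\<tau> w) * norm (Z w)) / multiplier"

lemma weighted_Z_integrable:
  assumes [measurable]: "c \<in> borel_measurable borel" and c: "\<And>t. t \<in> {0..1} \<Longrightarrow> \<bar>c t\<bar> \<le> B"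
  shows "integrable N (\<lambda>w. c (\<tau> w) *\<^sub>R Z w)"
proof (rule Bochner_Integration.integrable_bound)
  show "integrable N (\<lambda>w. B *\<^sub>R Z w)" using Z_integrable by simp
  show "AE w in N. norm (c (\<tau> w) *\<^sub>R Z w) \<le> norm (B *\<^sub>R Z w)"
  proof (rule AE_I2)
    fix w assume "w \<in> space N"
    then have "\<bar>c (\<tau> w)\<bar> \<le> \<bar>B\<bar>" using c[OF tau_range] by fastforce
    then show "norm (c (\<tau> w) *\<^sub>R Z w) \<le> norm (B *\<^sub>R Z w)" by (simp add: mult_right_mono)
  qed
qed measurable

text \<open>By \<open>ramp_moment\<close>, an increment of \<open>f\<close> is a mean of \<open>Z\<close> with the weight \<open>min \<tau> t - min \<tau> s\<close>, up to the
correction for closed curves. This weight differs from \<open>t - s\<close> times the indicator of \<open>S\<close> only for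
\<open>\<tau>\<close> strictly between \<open>a\<close> and \<open>b\<close>, and there by at most \<open>t - s\<close>.\<close>

lemma increment_estimate:
  assumes ab: "0 \<le> a" "a \<le> s" "s \<le> t" "t \<le> b" "b \<le> 1"
    and S [measurable]: "S \<in> sets borel" and S_low: "\<And>x. x \<le> a \<Longrightarrow> x \<notin> S" and S_high: "\<And>x. b \<le> x \<Longrightarrow> x \<in> S"
  shows "norm (f t - f s - (t - s) *\<^sub>R slope S) \<le> oscillation a b * (t - s)"
proof -
  define c where "c x = min x t - min x s - (t - s) * indicator S x" for x :: real
  have c_meas [measurable]: "c \<in> borel_measurable borel" unfolding c_def by measurable
  have c_bd: "\<bar>c x\<bar> \<le> (t - s) * indicator {a<..<b} x" for x
  proof -
    consider "x \<le> a" | "b \<le> x" | "a < x" "x < b" by linarith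
    then show ?thesis
    proof cases
      case 3
      then show ?thesis using ab by (cases "x \<in> S") (auto simp: c_def min_def)
    qed (use ab S_low S_high in \<open>auto simp: c_def\<close>)
  qed
  have int_S: "integrable N (\<lambda>w. indicator S (\<tau> w) *\<^sub>R Z w)"
    by (rule weighted_Z_integrable[of _ 1]) (auto simp: indicator_def)
  have int_tau: "integrable N (\<lambda>w. \<tau> w *\<^sub>R Z w)"
    by (rule weighted_Z_integrable[of "\<lambda>x. x" 1]) auto
  have int_min: "integrable N (\<lambda>w. min (\<tau> w) r *\<^sub>R Z w)" if "r \<in> {0..1}" for r
    using that by (intro weighted_Z_integrable[of "\<lambda>x. min x r" 1]) auto
  have st: "s \<in> {0..1}" "t \<in> {0..1}" using ab by auto
  have ramp_split: "multiplier *\<^sub>R (f r - f 0) = N.expectation (\<lambda>w. min (\<tau> w) r *\<^sub>R Z w)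
      - (closing * r) *\<^sub>R N.expectation (\<lambda>w. \<tau> w *\<^sub>R Z w)" if r: "r \<in> {0..1}" for r
  proof -
    have "multiplier *\<^sub>R (f r - f 0) = N.expectation (\<lambda>w. min (\<tau> w) r *\<^sub>R Z w - (closing * r) *\<^sub>R (\<tau> w *\<^sub>R Z w))"
      unfolding ramp_moment[OF r, symmetric] by (simp add: ramp_def scaleR_diff_left)
    also have "\<dots> = N.expectation (\<lambda>w. min (\<tau> w) r *\<^sub>R Z w)
      - (closing * r) *\<^sub>R N.expectation (\<lambda>w. \<tau> w *\<^sub>R Z w)"
      using int_min[OF r] int_tau by (simp del: scaleR_scaleR)
    finally show ?thesis .
  qed
  have "multiplier *\<^sub>R (f t - f s - (t - s) *\<^sub>R slope S)
      = multiplier *\<^sub>R (f t - f 0) - multiplier *\<^sub>R (f s - f 0) - (t - s) *\<^sub>R (multiplier *\<^sub>R slope S)"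
    by (simp add: algebra_simps)
  also have "multiplier *\<^sub>R slope S = N.expectation (\<lambda>w. indicator S (\<tau> w) *\<^sub>R Z w)
      - closing *\<^sub>R N.expectation (\<lambda>w. \<tau> w *\<^sub>R Z w)"
    using multiplier_pos by (simp add: slope_def moment_def)
  also have "multiplier *\<^sub>R (f t - f 0) - multiplier *\<^sub>R (f s - f 0) - (t - s) *\<^sub>R
      (N.expectation (\<lambda>w. indicator S (\<tau> w) *\<^sub>R Z w) - closing *\<^sub>R N.expectation (\<lambda>w. \<tau> w *\<^sub>R Z w))
      = N.expectation (\<lambda>w. min (\<tau> w) t *\<^sub>R Z w) - N.expectation (\<lambda>w. min (\<tau> w) s *\<^sub>R Z w)
        - (t - s) *\<^sub>R N.expectation (\<lambda>w. indicator S (\<tau> w) *\<^sub>R Z w)"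
    unfolding ramp_split[OF st(1)] ramp_split[OF st(2)] by (simp add: algebra_simps)
  also have "\<dots> = N.expectation (\<lambda>w. c (\<tau> w) *\<^sub>R Z w)"
    using int_S int_min[OF st(1)] int_min[OF st(2)] by (simp add: c_def scaleR_diff_left flip: scaleR_scaleR)
  finally have eq: "multiplier *\<^sub>R (f t - f s - (t - s) *\<^sub>R slope S) = N.expectation (\<lambda>w. c (\<tau> w) *\<^sub>R Z w)" .
  have "multiplier * norm (f t - f s - (t - s) *\<^sub>R slope S) = norm (N.expectation (\<lambda>w. c (\<tau> w) *\<^sub>R Z w))"
    unfolding eq[symmetric] using multiplier_pos by simp
  also have "\<dots> \<le> N.expectation (\<lambda>w. norm (c (\<tau> w) *\<^sub>R Z w))" by (rule integral_norm_bound)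
  also have "\<dots> \<le> N.expectation (\<lambda>w. (t - s) * (indicator {a<..<b} (\<tau> w) * norm (Z w)))"
  proof (rule integral_mono)
    show "integrable N (\<lambda>w. norm (c (\<tau> w) *\<^sub>R Z w))"
    proof (rule integrable_norm, rule weighted_Z_integrable[OF c_meas])
      fix x :: real
      have "(t - s) * indicator {a<..<b} x \<le> (t - s) * 1" using ab by (intro mult_left_mono) (auto simp: indicator_def)
      then show "\<bar>c x\<bar> \<le> t - s" using c_bd[of x] by simp
    qed
    show "integrable N (\<lambda>w. (t - s) * (indicator {a<..<b} (\<tau> w) * norm (Z w)))"
      using weighted_Z_integrable[of "indicator {a<..<b}" 1, THEN integrable_norm]
      by (simp add: indicator_def abs_mult)
    show "norm (c (\<tau> w) *\<^sub>R Z w) \<le> (t - s) * (indicator {a<..<b} (\<tau> w) * norm (Z w))" for w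
      using mult_right_mono[OF c_bd[of "\<tau> w"] norm_ge_zero[of "Z w"]] by (simp add: mult_ac)
  qed
  also have "\<dots> = multiplier * (oscillation a b * (t - s))"
    using multiplier_pos by (simp add: oscillation_def)
  finally show ?thesis using multiplier_pos by simp
qed

text \<open>Since the intervals are open, an atom of the law of \<open>\<tau>\<close> at the point to which they shrink does no
harm.\<close>

lemma oscillation_tendsto_0:
  assumes "\<And>x. \<forall>\<^sub>F n in sequentially. x \<notin> {a n<..<b n}"
  shows "(\<lambda>n. oscillation (a n) (b n)) \<longlonglongrightarrow> 0"
proof -
  have "(\<lambda>n. N.expectation (\<lambda>w. indicator {a n<..<b n} (\<tau> w) * norm (Z w))) \<longlonglongrightarrow> N.expectation (\<lambda>w. 0)"
  proof (rule integral_dominated_convergence)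
    show "integrable N (\<lambda>w. norm (Z w))" using Z_integrable by simp
    show "AE w in N. (\<lambda>n. indicator {a n<..<b n} (\<tau> w) * norm (Z w)) \<longlonglongrightarrow> 0"
    proof (rule AE_I2)
      fix w
      have "\<forall>\<^sub>F n in sequentially. indicator {a n<..<b n} (\<tau> w) * norm (Z w) = 0"
        using assms[of "\<tau> w"] by eventually_elim simp
      then show "(\<lambda>n. indicator {a n<..<b n} (\<tau> w) * norm (Z w)) \<longlonglongrightarrow> 0" by (rule tendsto_eventually)
    qed
    show "AE w in N. norm (indicator {a n<..<b n} (\<tau> w) * norm (Z w)) \<le> norm (Z w)" for n
      by (auto simp: indicator_def)
  qed auto
  from tendsto_divide[OF this tendsto_const[of multiplier]] show ?thesis
    using multiplier_pos by (simp add: oscillation_def)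
qed

lemma right_window:
  assumes a: "a \<in> {0..<1}" and e: "e > 0"
  obtains b where "a < b" "b \<le> 1"
    "\<And>s t. a \<le> s \<Longrightarrow> s \<le> t \<Longrightarrow> t \<le> b \<Longrightarrow> norm (f t - f s - (t - s) *\<^sub>R slope {a<..}) \<le> e * (t - s)"
proof -
  define b where "b n = a + (1 - a) / real (Suc n)" for n
  have b: "a < b n" "b n \<le> 1" for n
  proof -
    show "a < b n" using a by (simp add: b_def)
    have "(1 - a) / real (Suc n) \<le> (1 - a) / 1" using a by (intro divide_left_mono) auto
    then show "b n \<le> 1" by (simp add: b_def)
  qed
  have "b \<longlonglongrightarrow> a + 0"
    unfolding b_def by (intro tendsto_add tendsto_const LIMSEQ_Suc[OF lim_const_over_n])
  then have lim: "b \<longlonglongrightarrow> a" by simp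
  have "(\<lambda>n. oscillation a (b n)) \<longlonglongrightarrow> 0"
  proof (rule oscillation_tendsto_0)
    fix x
    show "\<forall>\<^sub>F n in sequentially. x \<notin> {a<..<b n}"
    proof (cases "a < x")
      case True
      from order_tendstoD(2)[OF lim True] show ?thesis by eventually_elim auto
    qed auto
  qed
  from order_tendstoD(2)[OF this e] obtain n where n: "oscillation a (b n) < e"
    by (auto simp: eventually_sequentially)
  show ?thesis
  proof (rule that[OF b])
    fix s t assume st: "a \<le> s" "s \<le> t" "t \<le> b n"
    have "norm (f t - f s - (t - s) *\<^sub>R slope {a<..}) \<le> oscillation a (b n) * (t - s)"
      by (rule increment_estimate) (use st b[of n] a in auto)
    also have "\<dots> \<le> e * (t - s)" using n st by (intro mult_right_mono) auto
    finally show "norm (f t - f s - (t - s) *\<^sub>R slope {a<..}) \<le> e * (t - s)" .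
  qed
qed

lemma left_window:
  assumes b: "b \<in> {0<..1}" and e: "e > 0"
  obtains a where "0 \<le> a" "a < b"
    "\<And>s t. a \<le> s \<Longrightarrow> s \<le> t \<Longrightarrow> t \<le> b \<Longrightarrow> norm (f t - f s - (t - s) *\<^sub>R slope {b..}) \<le> e * (t - s)"
proof -
  define a where "a n = b - b / real (Suc n)" for n
  have a: "0 \<le> a n" "a n < b" for n
  proof -
    show "a n < b" using b by (simp add: a_def)
    have "b / real (Suc n) \<le> b / 1" using b by (intro divide_left_mono) auto
    then show "0 \<le> a n" by (simp add: a_def)
  qed
  have "a \<longlonglongrightarrow> b - 0"
    unfolding a_def by (intro tendsto_diff tendsto_const LIMSEQ_Suc[OF lim_const_over_n])
  then have lim: "a \<longlonglongrightarrow> b" by simp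
  have "(\<lambda>n. oscillation (a n) b) \<longlonglongrightarrow> 0"
  proof (rule oscillation_tendsto_0)
    fix x
    show "\<forall>\<^sub>F n in sequentially. x \<notin> {a n<..<b}"
    proof (cases "x < b")
      case True
      from order_tendstoD(1)[OF lim True] show ?thesis by eventually_elim auto
    qed auto
  qed
  from order_tendstoD(2)[OF this e] obtain n where n: "oscillation (a n) b < e"
    by (auto simp: eventually_sequentially)
  show ?thesis
  proof (rule that[OF a])
    fix s t assume st: "a n \<le> s" "s \<le> t" "t \<le> b"
    have "norm (f t - f s - (t - s) *\<^sub>R slope {b..}) \<le> oscillation (a n) b * (t - s)"
      by (rule increment_estimate) (use st a[of n] b in auto)
    also have "\<dots> \<le> e * (t - s)" using n st by (intro mult_right_mono) auto
    finally show "norm (f t - f s - (t - s) *\<^sub>R slope {b..}) \<le> e * (t - s)" .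
  qed
qed

lemma right_derivative:
  assumes a: "a \<in> {0..<1}"
  shows "(f has_vector_derivative slope {a<..}) (at_right a)" and "norm (slope {a<..}) = L"
proof -
  show "(f has_vector_derivative slope {a<..}) (at_right a)"
  proof (rule chord_bound_imp_right_derivative)
    fix e :: real assume "e > 0"
    from right_window[OF a this] show "\<exists>b>a. \<forall>t\<in>{a..b}. norm (f t - f a - (t - a) *\<^sub>R slope {a<..}) \<le> e * (t - a)"
      by (metis atLeastAtMost_iff order_refl)
  qed
  show "norm (slope {a<..}) = L"
  proof (rule speed_eq_of_full_length[OF f_lipschitz curve_length_eq L_pos])
    fix e :: real assume "e > 0"
    from right_window[OF a this] obtain b where "a < b" "b \<le> 1"
      "\<And>s t. a \<le> s \<Longrightarrow> s \<le> t \<Longrightarrow> t \<le> b \<Longrightarrow> norm (f t - f s - (t - s) *\<^sub>R slope {a<..}) \<le> e * (t - s)"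
      by blast
    then show "\<exists>a' b. 0 \<le> a' \<and> a' < b \<and> b \<le> 1 \<and> (\<forall>s t. a' \<le> s \<longrightarrow> s \<le> t \<longrightarrow> t \<le> b \<longrightarrow>
        norm (f t - f s - (t - s) *\<^sub>R slope {a<..}) \<le> e * (t - s))"
      using a by (intro exI[of _ a] exI[of _ b]) auto
  qed
qed

lemma left_derivative:
  assumes b: "b \<in> {0<..1}"
  shows "(f has_vector_derivative slope {b..}) (at_left b)" and "norm (slope {b..}) = L"
proof -
  show "(f has_vector_derivative slope {b..}) (at_left b)"
  proof (rule chord_bound_imp_left_derivative)
    fix e :: real assume "e > 0"
    from left_window[OF b this] show "\<exists>a<b. \<forall>t\<in>{a..b}. norm (f b - f t - (b - t) *\<^sub>R slope {b..}) \<le> e * (b - t)"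
      by (metis atLeastAtMost_iff order_refl)
  qed
  show "norm (slope {b..}) = L"
  proof (rule speed_eq_of_full_length[OF f_lipschitz curve_length_eq L_pos])
    fix e :: real assume "e > 0"
    from left_window[OF b this] obtain a where "0 \<le> a" "a < b"
      "\<And>s t. a \<le> s \<Longrightarrow> s \<le> t \<Longrightarrow> t \<le> b \<Longrightarrow> norm (f t - f s - (t - s) *\<^sub>R slope {b..}) \<le> e * (t - s)"
      by blast
    then show "\<exists>a b'. 0 \<le> a \<and> a < b' \<and> b' \<le> 1 \<and> (\<forall>s t. a \<le> s \<longrightarrow> s \<le> t \<longrightarrow> t \<le> b' \<longrightarrow>
        norm (f t - f s - (t - s) *\<^sub>R slope {b..}) \<le> e * (t - s))"
      using b by (intro exI[of _ a] exI[of _ b]) auto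
  qed
qed

lemma right_deriv_eq: "a \<in> {0..<1} \<Longrightarrow> right_deriv f a = slope {a<..}"
  using right_derivative(1) by (intro vector_derivative_within) auto

lemma left_deriv_eq: "b \<in> {0<..1} \<Longrightarrow> left_deriv f b = slope {b..}"
  using left_derivative(1) by (intro vector_derivative_within) auto

end

section \<open>Signed measures: densities and uniqueness\<close>

lemma integrable_mult_bounded:
  fixes h g :: "'b \<Rightarrow> real"
  assumes h: "integrable R h" and g: "g \<in> borel_measurable R" "\<And>x. x \<in> space R \<Longrightarrow> \<bar>g x\<bar> \<le> B"
  shows "integrable R (\<lambda>x. h x * g x)"
proof (rule Bochner_Integration.integrable_bound)
  show "integrable R (\<lambda>x. B * h x)" using h by simp
  show "(\<lambda>x. h x * g x) \<in> borel_measurable R" using h g by measurable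
  show "AE x in R. norm (h x * g x) \<le> norm (B * h x)"
  proof (rule AE_I2)
    fix x assume "x \<in> space R"
    then have "\<bar>g x\<bar> \<le> \<bar>B\<bar>" using g(2) by fastforce
    then show "norm (h x * g x) \<le> norm (B * h x)" by (simp add: abs_mult mult.commute mult_right_mono)
  qed
qed

lemma signed_measure_density:
  fixes \<rho> :: "'b \<Rightarrow> real"
  assumes \<rho>: "integrable P \<rho>" and P: "sets P = sets M"
    and m: "\<And>A. A \<in> sets M \<Longrightarrow> m A = (\<integral>x. \<rho> x * indicator A x \<partial>P)" "\<And>A. A \<notin> sets M \<Longrightarrow> m A = 0"
  shows "signed_measure M m"
  unfolding signed_measure_def
proof (intro conjI allI impI)
  show "m {} = 0" using m(1)[of "{}"] by simp
  fix A :: "nat \<Rightarrow> 'b set" assume A: "range A \<subseteq> sets M" "disjoint_family A"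
  then have A_sets [measurable]: "A i \<in> sets P" for i using P by auto
  have UA: "(\<Union>i. A i) \<in> sets P" by measurable
  have int: "integrable P (\<lambda>x. \<rho> x * indicator (A i) x)" for i
    using integrable_real_mult_indicator[OF A_sets \<rho>] by simp
  have "(\<lambda>n. \<integral>x. (\<Sum>i<n. \<rho> x * indicator (A i) x) \<partial>P) \<longlonglongrightarrow> (\<integral>x. \<rho> x * indicator (\<Union>i. A i) x \<partial>P)"
  proof (rule integral_dominated_convergence)
    show "(\<lambda>x. \<rho> x * indicator (\<Union>i. A i) x) \<in> borel_measurable P" using \<rho> UA by measurable
    show "(\<lambda>x. \<Sum>i<n. \<rho> x * indicator (A i) x) \<in> borel_measurable P" for n using \<rho> by measurable
    show "integrable P (\<lambda>x. \<bar>\<rho> x\<bar>)" using \<rho> by simp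
    have ind: "(\<lambda>i. indicator (A i) x :: real) sums indicator (\<Union>i. A i) x" for x
      using A(2) by (intro indicator_sums) (auto simp: disjoint_family_on_def)
    show "AE x in P. (\<lambda>n. \<Sum>i<n. \<rho> x * indicator (A i) x) \<longlonglongrightarrow> \<rho> x * indicator (\<Union>i. A i) x"
      using sums_mult[OF ind] by (auto simp: sums_def)
    show "AE x in P. norm (\<Sum>i<n. \<rho> x * indicator (A i) x) \<le> \<bar>\<rho> x\<bar>" for n
    proof (rule AE_I2)
      fix x
      have nonneg: "(0::real) \<le> (\<Sum>i<n. indicator (A i) x)" by (intro sum_nonneg) simp
      have "(\<Sum>i<n. indicator (A i) x) \<le> (indicator (\<Union>i. A i) x :: real)"
        using sum_le_suminf[OF sums_summable[OF ind[of x]], of "{..<n}"] sums_unique[OF ind[of x]] by simp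
      also have "\<dots> \<le> 1" by (simp add: indicator_def)
      finally have "\<bar>\<rho> x\<bar> * (\<Sum>i<n. indicator (A i) x) \<le> \<bar>\<rho> x\<bar> * 1" by (intro mult_left_mono) auto
      then show "norm (\<Sum>i<n. \<rho> x * indicator (A i) x) \<le> \<bar>\<rho> x\<bar>"
        using nonneg by (simp add: abs_mult flip: sum_distrib_left)
    qed
  qed
  moreover have "(\<integral>x. (\<Sum>i<n. \<rho> x * indicator (A i) x) \<partial>P) = (\<Sum>i<n. m (A i))" for n
  proof -
    have "A i \<in> sets M" for i using A by auto
    then show ?thesis using int m(1) by (subst Bochner_Integration.integral_sum) auto
  qed
  moreover have "m (\<Union>i. A i) = (\<integral>x. \<rho> x * indicator (\<Union>i. A i) x \<partial>P)"
    using UA P by (intro m(1)) simp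
  ultimately show "(\<lambda>i. m (A i)) sums m (\<Union>i. A i)" by (simp add: sums_def)
qed (use m(2) in auto)

text \<open>The supremum over the subsets \<open>B\<close> of \<open>A\<close> is attained at the part of \<open>A\<close> where the density is
nonnegative.\<close>

lemma upper_variation_density:
  fixes \<rho> :: "'b \<Rightarrow> real"
  assumes \<rho>: "integrable P \<rho>" and P: "sets P = sets M"
    and m: "\<And>A. A \<in> sets M \<Longrightarrow> m A = (\<integral>x. \<rho> x * indicator A x \<partial>P)"
  shows "upper_variation M m = density P (\<lambda>x. ennreal (max 0 (\<rho> x)))"
proof -
  define D where "D = density P (\<lambda>x. ennreal (max 0 (\<rho> x)))"
  have \<rho>_meas [measurable]: "\<rho> \<in> borel_measurable P" using \<rho> by simp
  have D_sets: "sets D = sets M" using P by (simp add: D_def)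
  have D_space: "space D = space M" using D_sets by (rule sets_eq_imp_space_eq)
  have max_int: "integrable P (\<lambda>x. max 0 (\<rho> x))" using \<rho> by simp
  have D_eq: "emeasure D A = ennreal (\<integral>x. max 0 (\<rho> x) * indicator A x \<partial>P)" if A: "A \<in> sets M" for A
  proof -
    have [measurable]: "A \<in> sets P" using A P by simp
    have "emeasure D A = (\<integral>\<^sup>+x. ennreal (max 0 (\<rho> x)) * indicator A x \<partial>P)"
      by (simp add: D_def emeasure_density)
    also have "\<dots> = (\<integral>\<^sup>+x. ennreal (max 0 (\<rho> x) * indicator A x) \<partial>P)"
      by (intro nn_integral_cong) (simp add: indicator_def)
    also have "\<dots> = ennreal (\<integral>x. max 0 (\<rho> x) * indicator A x \<partial>P)"
      using integrable_real_mult_indicator[OF \<open>A \<in> sets P\<close> max_int]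
      by (intro nn_integral_eq_integral) auto
    finally show ?thesis .
  qed
  have sup: "(SUP B \<in> {B \<in> sets M. B \<subseteq> A}. ennreal (m B)) = emeasure D A" if A: "A \<in> sets M" for A
  proof (rule antisym)
    show "(SUP B \<in> {B \<in> sets M. B \<subseteq> A}. ennreal (m B)) \<le> emeasure D A"
    proof (rule SUP_least)
      fix B assume "B \<in> {B \<in> sets M. B \<subseteq> A}"
      then have B: "B \<in> sets M" "B \<subseteq> A" by auto
      have "m B \<le> (\<integral>x. max 0 (\<rho> x) * indicator A x \<partial>P)"
        unfolding m[OF B(1)]
      proof (rule integral_mono)
        show "\<rho> x * indicator B x \<le> max 0 (\<rho> x) * indicator A x" for x
          using B(2) by (auto simp: indicator_def)
      qed (use integrable_real_mult_indicator[of _ P] A B P \<rho> max_int in auto)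
      then show "ennreal (m B) \<le> emeasure D A" unfolding D_eq[OF A] by (rule ennreal_leI)
    qed
    define B where "B = A \<inter> {x \<in> space P. 0 \<le> \<rho> x}"
    have "{x \<in> space P. 0 \<le> \<rho> x} \<in> sets M" unfolding P[symmetric] by measurable
    then have B: "B \<in> sets M" "B \<subseteq> A" using A by (auto simp: B_def)
    have "m B = (\<integral>x. max 0 (\<rho> x) * indicator A x \<partial>P)"
      unfolding m[OF B(1)]
      by (rule Bochner_Integration.integral_cong) (auto simp: B_def indicator_def)
    then have "emeasure D A = ennreal (m B)" by (simp add: D_eq[OF A])
    also have "\<dots> \<le> (SUP B \<in> {B \<in> sets M. B \<subseteq> A}. ennreal (m B))"
      using B by (intro SUP_upper) auto
    finally show "emeasure D A \<le> (SUP B \<in> {B \<in> sets M. B \<subseteq> A}. ennreal (m B))" .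
  qed
  have "upper_variation M m = measure_of (space M) (sets M) (emeasure D)"
    unfolding upper_variation_def
    by (rule measure_of_eq) (auto simp: sets.space_closed sets.sigma_sets_eq sup)
  also have "\<dots> = D" using measure_of_of_measure[of D] by (simp add: D_sets D_space)
  finally show ?thesis by (simp add: D_def)
qed

lemma signed_integral_density:
  fixes \<rho> g :: "'b \<Rightarrow> real"
  assumes \<rho>: "integrable P \<rho>" and P: "sets P = sets M"
    and m: "\<And>A. A \<in> sets M \<Longrightarrow> m A = (\<integral>x. \<rho> x * indicator A x \<partial>P)"
    and g: "g \<in> borel_measurable M" "\<And>x. x \<in> space M \<Longrightarrow> \<bar>g x\<bar> \<le> B"
  shows "signed_integral M m g = (\<integral>x. \<rho> x * g x \<partial>P)"
proof -
  have [measurable]: "\<rho> \<in> borel_measurable P" using \<rho> by simp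
  have g_meas [measurable]: "g \<in> borel_measurable P" using g(1) P by (simp cong: measurable_cong_sets)
  have space: "space P = space M" using P by (rule sets_eq_imp_space_eq)
  have prod: "integrable P (\<lambda>x. h x * g x)" if h: "integrable P h" for h :: "'b \<Rightarrow> real"
    using g(2) space by (intro integrable_mult_bounded[OF h g_meas]) auto
  have up: "upper_variation M m = density P (\<lambda>x. ennreal (max 0 (\<rho> x)))"
    by (rule upper_variation_density[OF \<rho> P m])
  have lo: "upper_variation M (\<lambda>A. - m A) = density P (\<lambda>x. ennreal (max 0 (- \<rho> x)))"
    by (rule upper_variation_density) (use \<rho> P m in auto)
  have part: "integral\<^sup>L (density P (\<lambda>x. ennreal (max 0 (h x)))) g = (\<integral>x. max 0 (h x) * g x \<partial>P)"
    if [measurable]: "h \<in> borel_measurable P" for h :: "'b \<Rightarrow> real"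
    by (subst integral_density) auto
  have "signed_integral M m g = (\<integral>x. max 0 (\<rho> x) * g x \<partial>P) - (\<integral>x. max 0 (- \<rho> x) * g x \<partial>P)"
    unfolding signed_integral_def up lo by (subst (1 2) part) auto
  also have "\<dots> = (\<integral>x. max 0 (\<rho> x) * g x - max 0 (- \<rho> x) * g x \<partial>P)"
    by (rule Bochner_Integration.integral_diff[symmetric]) (use \<rho> in \<open>auto intro!: prod\<close>)
  also have "\<dots> = (\<integral>x. \<rho> x * g x \<partial>P)"
    by (rule Bochner_Integration.integral_cong) (auto simp: max_def)
  finally show ?thesis .
qed

text \<open>The image under \<open>\<tau>\<close> of the measure with density \<open>y\<close> is absolutely continuous with respect to the law
of \<open>\<tau>\<close>, and its Radon-Nikodym density is a version of the conditional expectation of \<open>y\<close>.\<close>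

lemma exists_weighted_law_density_nonneg:
  fixes y :: "'v \<Rightarrow> real"
  assumes N: "prob_space N" and \<tau> [measurable]: "\<tau> \<in> measurable N S"
    and y: "integrable N y" "\<And>w. 0 \<le> y w"
  obtains \<rho> where "integrable (distr N S \<tau>) \<rho>"
    "\<And>g :: _ \<Rightarrow> real. g \<in> borel_measurable S \<Longrightarrow> (\<integral>x. \<rho> x * g x \<partial>distr N S \<tau>) = (\<integral>w. y w * g (\<tau> w) \<partial>N)"
proof -
  interpret N: prob_space N by (rule N)
  define P where "P = distr N S \<tau>"
  interpret P: prob_space P unfolding P_def by (rule N.prob_space_distr) (rule \<tau>)
  have [measurable]: "y \<in> borel_measurable N" using y by simp
  define Q where "Q = distr (density N (\<lambda>w. ennreal (y w))) S \<tau>"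
  have \<tau>': "\<tau> \<in> measurable (density N (\<lambda>w. ennreal (y w))) S" using \<tau> by simp
  have Q_P: "sets Q = sets P" by (simp add: Q_def P_def)
  have Q_em: "emeasure Q A = (\<integral>\<^sup>+w. ennreal (y w) * indicator (\<tau> -` A \<inter> space N) w \<partial>N)" if "A \<in> sets S" for A
    unfolding Q_def using that \<tau>' by (simp add: emeasure_distr emeasure_density measurable_sets[OF \<tau>])
  have Q_fin: "finite_measure Q"
  proof (rule finite_measureI)
    have "emeasure Q (space Q) = (\<integral>\<^sup>+w. ennreal (y w) * indicator (\<tau> -` space S \<inter> space N) w \<partial>N)"
      using Q_em[of "space S"] by (simp add: Q_def)
    also have "\<dots> \<le> (\<integral>\<^sup>+w. ennreal (y w) \<partial>N)"
      by (intro nn_integral_mono) (simp add: indicator_def)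
    also have "\<dots> < \<infinity>" using y by (simp add: nn_integral_eq_integral)
    finally show "emeasure Q (space Q) \<noteq> \<infinity>" by simp
  qed
  have ac: "absolutely_continuous P Q"
    unfolding absolutely_continuous_def
  proof
    fix A assume "A \<in> null_sets P"
    then have A: "A \<in> sets S" "emeasure N (\<tau> -` A \<inter> space N) = 0"
      by (auto simp: P_def null_sets_def emeasure_distr)
    have "\<tau> -` A \<inter> space N \<in> null_sets N" using A measurable_sets[OF \<tau>] by auto
    then have "(\<integral>\<^sup>+w. ennreal (y w) * indicator (\<tau> -` A \<inter> space N) w \<partial>N) = 0"
      by (rule nn_integral_null_set)
    then show "A \<in> null_sets Q" using A Q_em[OF A(1)] by (auto simp: null_sets_def Q_def)
  qed
  obtain \<rho> where \<rho>: "\<rho> \<in> borel_measurable P" "AE x in P. RN_deriv P Q x = ennreal (\<rho> x)" "\<And>x. 0 \<le> \<rho> x"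
    using P.real_RN_deriv[OF Q_fin ac Q_P] by metis
  have "Q = density P (RN_deriv P Q)" using P.density_RN_deriv[OF ac Q_P] by simp
  also have "\<dots> = density P (\<lambda>x. ennreal (\<rho> x))"
    using \<rho> by (intro density_cong) auto
  finally have Q_density: "Q = density P (\<lambda>x. ennreal (\<rho> x))" .
  have main: "(\<integral>x. \<rho> x * g x \<partial>P) = (\<integral>w. y w * g (\<tau> w) \<partial>N)" if g: "g \<in> borel_measurable S" for g :: "_ \<Rightarrow> real"
  proof -
    have g': "g \<in> borel_measurable P" using g by (simp add: P_def)
    have "(\<integral>x. \<rho> x * g x \<partial>P) = integral\<^sup>L Q g"
      unfolding Q_density using \<rho> g' by (simp add: integral_density)
    also have "\<dots> = (\<integral>w. g (\<tau> w) \<partial>density N (\<lambda>w. ennreal (y w)))"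
      unfolding Q_def by (rule integral_distr[OF \<tau>' g])
    also have "\<dots> = (\<integral>w. y w * g (\<tau> w) \<partial>N)"
      using y g by (simp add: integral_density)
    finally show ?thesis .
  qed
  moreover have "integrable P \<rho>"
  proof -
    have "integrable Q (\<lambda>x. 1 :: real)" using Q_fin by (simp add: finite_measure.integrable_const)
    then show ?thesis unfolding Q_density using \<rho> by (simp add: integrable_density)
  qed
  ultimately show ?thesis using that unfolding P_def by blast
qed

lemma exists_weighted_law_density:
  fixes z :: "'v \<Rightarrow> real"
  assumes N: "prob_space N" and \<tau> [measurable]: "\<tau> \<in> measurable N S" and z: "integrable N z"
  obtains \<rho> where "integrable (distr N S \<tau>) \<rho>"
    "\<And>(g :: _ \<Rightarrow> real) B. g \<in> borel_measurable S \<Longrightarrow> (\<And>x. x \<in> space S \<Longrightarrow> \<bar>g x\<bar> \<le> B) \<Longrightarrow>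
      (\<integral>x. \<rho> x * g x \<partial>distr N S \<tau>) = (\<integral>w. z w * g (\<tau> w) \<partial>N)"
proof -
  obtain \<rho>1 where \<rho>1: "integrable (distr N S \<tau>) \<rho>1"
    "\<And>g :: _ \<Rightarrow> real. g \<in> borel_measurable S \<Longrightarrow>
      (\<integral>x. \<rho>1 x * g x \<partial>distr N S \<tau>) = (\<integral>w. max 0 (z w) * g (\<tau> w) \<partial>N)"
    by (rule exists_weighted_law_density_nonneg[OF N \<tau>, of "\<lambda>w. max 0 (z w)"]) (use z in auto)
  obtain \<rho>2 where \<rho>2: "integrable (distr N S \<tau>) \<rho>2"
    "\<And>g :: _ \<Rightarrow> real. g \<in> borel_measurable S \<Longrightarrow>
      (\<integral>x. \<rho>2 x * g x \<partial>distr N S \<tau>) = (\<integral>w. max 0 (- z w) * g (\<tau> w) \<partial>N)"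
    by (rule exists_weighted_law_density_nonneg[OF N \<tau>, of "\<lambda>w. max 0 (- z w)"]) (use z in auto)
  show ?thesis
  proof (rule that[of "\<lambda>x. \<rho>1 x - \<rho>2 x"])
    show "integrable (distr N S \<tau>) (\<lambda>x. \<rho>1 x - \<rho>2 x)" using \<rho>1 \<rho>2 by simp
    fix g :: "_ \<Rightarrow> real" and B
    assume g: "g \<in> borel_measurable S" "\<And>x. x \<in> space S \<Longrightarrow> \<bar>g x\<bar> \<le> B"
    have gt: "(\<lambda>w. g (\<tau> w)) \<in> borel_measurable N" using g(1) \<tau> by measurable
    have gb: "\<And>w. w \<in> space N \<Longrightarrow> \<bar>g (\<tau> w)\<bar> \<le> B" using g(2) measurable_space[OF \<tau>] by blast
    have "(\<integral>x. (\<rho>1 x - \<rho>2 x) * g x \<partial>distr N S \<tau>)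
        = (\<integral>x. \<rho>1 x * g x \<partial>distr N S \<tau>) - (\<integral>x. \<rho>2 x * g x \<partial>distr N S \<tau>)"
      unfolding left_diff_distrib using \<rho>1(1) \<rho>2(1) g
      by (intro Bochner_Integration.integral_diff integrable_mult_bounded) auto
    also have "\<dots> = (\<integral>w. max 0 (z w) * g (\<tau> w) - max 0 (- z w) * g (\<tau> w) \<partial>N)"
      unfolding \<rho>1(2)[OF g(1)] \<rho>2(2)[OF g(1)]
      by (rule Bochner_Integration.integral_diff[symmetric]; rule integrable_mult_bounded[OF _ gt gb]) (use z in auto)
    also have "\<dots> = (\<integral>w. z w * g (\<tau> w) \<partial>N)"
      by (rule Bochner_Integration.integral_cong) (auto simp: max_def)
    finally show "(\<integral>x. (\<rho>1 x - \<rho>2 x) * g x \<partial>distr N S \<tau>) = (\<integral>w. z w * g (\<tau> w) \<partial>N)" .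
  qed
qed

text \<open>Conditioning on \<open>\<tau>\<close> replaces the weight \<open>z\<close>, which lives on the sample space, by a density with
respect to the law of \<open>\<tau>\<close>; for densities the variations are explicit.\<close>

lemma weighted_law_signed_measure:
  fixes z :: "'v \<Rightarrow> real" and S :: "'b measure"
  assumes N: "prob_space N" and \<tau>: "\<tau> \<in> measurable N S" and z: "integrable N z"
    and m: "\<And>A. A \<in> sets S \<Longrightarrow> m A = (\<integral>w. z w * indicator A (\<tau> w) \<partial>N)" "\<And>A. A \<notin> sets S \<Longrightarrow> m A = 0"
  shows "signed_measure S m"
    and "g \<in> borel_measurable S \<Longrightarrow> (\<And>x. x \<in> space S \<Longrightarrow> \<bar>g x\<bar> \<le> B) \<Longrightarrow>
      signed_integral S m g = (\<integral>w. z w * g (\<tau> w) \<partial>N)"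
proof -
  obtain \<rho> where \<rho>: "integrable (distr N S \<tau>) \<rho>"
    "\<And>(g :: _ \<Rightarrow> real) B. g \<in> borel_measurable S \<Longrightarrow> (\<And>x. x \<in> space S \<Longrightarrow> \<bar>g x\<bar> \<le> B) \<Longrightarrow>
      (\<integral>x. \<rho> x * g x \<partial>distr N S \<tau>) = (\<integral>w. z w * g (\<tau> w) \<partial>N)"
    using exists_weighted_law_density[OF N \<tau> z] by blast
  have m': "m A = (\<integral>x. \<rho> x * indicator A x \<partial>distr N S \<tau>)" if "A \<in> sets S" for A
    using \<rho>(2)[of "indicator A" 1] that m(1)[OF that] by (simp add: indicator_def)
  show "signed_measure S m"
    by (rule signed_measure_density[OF \<rho>(1) _ m' m(2)]) auto
  show "signed_integral S m g = (\<integral>w. z w * g (\<tau> w) \<partial>N)"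
    if g: "g \<in> borel_measurable S" "\<And>x. x \<in> space S \<Longrightarrow> \<bar>g x\<bar> \<le> B"
    using signed_integral_density[OF \<rho>(1) _ m' g] \<rho>(2)[OF g] by simp
qed

lemma signed_measure_Un:
  assumes m: "signed_measure M m" and AB: "A \<in> sets M" "B \<in> sets M" "A \<inter> B = {}"
  shows "m (A \<union> B) = m A + m B"
proof -
  define F where "F i = (if i = 0 then A else if i = 1 then B else {})" for i :: nat
  have "range F \<subseteq> sets M" using AB by (auto simp: F_def)
  moreover have "disjoint_family F" using AB(3) by (auto simp: disjoint_family_on_def F_def)
  ultimately have "(\<lambda>i. m (F i)) sums m (\<Union>i. F i)" using m by (auto simp: signed_measure_def)
  moreover have "(\<Union>i. F i) = A \<union> B" by (auto simp: F_def split: if_splits)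
  moreover have "(\<lambda>i. m (F i)) sums (\<Sum>i\<in>{0, 1}. m (F i))"
    by (rule sums_finite) (use m in \<open>auto simp: F_def signed_measure_def\<close>)
  ultimately show ?thesis by (metis F_def One_nat_def add.right_neutral finite.intros empty_iff
    insert_iff sum.empty sum.insert sums_unique2 zero_neq_one)
qed

text \<open>The intervals \<open>{s<..t}\<close> with \<open>t < 1\<close> exhaust the open unit interval, and half-open intervals
generate the Borel sets, so that Dynkin's argument applies.\<close>

lemma signed_measure_eq_0_open_interval:
  fixes d :: "real set \<Rightarrow> real"
  assumes d: "signed_measure unit_borel d"
    and Ioc: "\<And>s t. 0 \<le> s \<Longrightarrow> s \<le> t \<Longrightarrow> t < 1 \<Longrightarrow> d {s<..t} = 0"
    and A: "A \<in> sets borel"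
  shows "d (A \<inter> {0<..<1}) = 0"
proof -
  have sets: "B \<inter> {0<..<1} \<in> sets unit_borel" if "B \<in> sets borel" for B :: "real set"
    using that by (subst sets_restrict_space_iff) auto
  have d_sums: "(\<lambda>i. d (F i)) sums d (\<Union>i. F i)"
    if "range F \<subseteq> sets unit_borel" "disjoint_family F" for F :: "nat \<Rightarrow> real set"
    using d that by (auto simp: signed_measure_def)
  have empty: "d {} = 0" using d by (auto simp: signed_measure_def)
  have tail: "d {c<..<1} = 0" if c: "0 \<le> c" "c < 1" for c
  proof -
    \<comment> \<open>The points \<open>x n\<close> increase from \<open>c\<close> to \<open>1\<close> and cut the interval into countably many pieces.\<close>
    define x where "x n = 1 - (1 - c) / real (Suc n)" for n
    have x: "x 0 = c" "c \<le> x n" "x n \<le> x (Suc n)" "x n < 1" for n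
    proof -
      show "x 0 = c" by (simp add: x_def)
      have "(1 - c) / real (Suc n) \<le> (1 - c) / 1" using c by (intro divide_left_mono) auto
      then show "c \<le> x n" by (simp add: x_def)
      have "(1 - c) / real (Suc (Suc n)) \<le> (1 - c) / real (Suc n)" using c by (intro divide_left_mono) auto
      then show "x n \<le> x (Suc n)" by (simp add: x_def)
      show "x n < 1" using c by (simp add: x_def)
    qed
    have mono: "x i \<le> x j" if "i \<le> j" for i j using lift_Suc_mono_le[of x, OF x(3) that] .
    define F where "F n = {x n<..x (Suc n)}" for n
    have "disjoint_family F"
      unfolding disjoint_family_on_def
    proof (intro ballI impI)
      fix i j :: nat assume "i \<noteq> j"
      then consider "Suc i \<le> j" | "Suc j \<le> i" by linarith
      then show "F i \<inter> F j = {}" using mono by cases (fastforce simp: F_def)+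
    qed
    moreover have "range F \<subseteq> sets unit_borel"
    proof -
      have "F n = F n \<inter> {0<..<1}" for n using x(2)[of n] x(4)[of "Suc n"] c by (auto simp: F_def)
      moreover have "F n \<inter> {0<..<1} \<in> sets unit_borel" for n by (rule sets) (simp add: F_def)
      ultimately show ?thesis by auto
    qed
    ultimately have "(\<lambda>i. d (F i)) sums d (\<Union>i. F i)" by (intro d_sums)
    moreover have "d (F i) = 0" for i
      unfolding F_def using x(2)[of i] x(3)[of i] x(4)[of "Suc i"] c by (intro Ioc) auto
    moreover have "(\<Union>i. F i) = {c<..<1}"
    proof (intro subset_antisym subsetI)
      fix t assume "t \<in> (\<Union>i. F i)"
      then obtain i where "x i < t" "t \<le> x (Suc i)" by (auto simp: F_def)
      then show "t \<in> {c<..<1}" using x(2)[of i] x(4)[of "Suc i"] by auto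
    next
      fix t assume t: "t \<in> {c<..<1}"
      have "x \<longlonglongrightarrow> 1 - 0"
        unfolding x_def by (intro tendsto_diff tendsto_const LIMSEQ_Suc[OF lim_const_over_n])
      then have "\<forall>\<^sub>F n in sequentially. t < x n" using t by (intro order_tendstoD(1)) auto
      then have ex: "\<exists>n. t \<le> x n" by (auto simp: eventually_sequentially intro: less_imp_le)
      define n where "n = (LEAST n. t \<le> x n)"
      have n: "t \<le> x n" unfolding n_def using ex by (rule LeastI_ex)
      have "n \<noteq> 0" using n x(1) t by (intro notI) auto
      then obtain k where k: "n = Suc k" by (cases n) auto
      have "\<not> t \<le> x k" using not_less_Least[of k "\<lambda>n. t \<le> x n"] k by (simp add: n_def)
      then show "t \<in> (\<Union>i. F i)" using n k by (intro UN_I[of k]) (auto simp: F_def)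
    qed
    ultimately show ?thesis by (simp add: sums_0 sums_unique2)
  qed
  have "sets borel = sigma_sets UNIV (range (\<lambda>(a, b). {a<..b::real}))"
    by (subst borel_sigma_sets_Ioc) simp
  then have A_gen: "A \<in> sigma_sets UNIV (range (\<lambda>(a, b). {a<..b::real}))" using A by simp
  have stable: "Int_stable (range (\<lambda>(a, b). {a<..b::real}))"
  proof (rule Int_stableI)
    fix a b assume "a \<in> range (\<lambda>(a, b). {a<..b::real})" "b \<in> range (\<lambda>(a, b). {a<..b::real})"
    then obtain p q r s where "a = {p<..q}" "b = {r<..s}" by auto
    then have "a \<inter> b = (case (max p r, min q s) of (u, v) \<Rightarrow> {u<..v})" by auto
    then show "a \<inter> b \<in> range (\<lambda>(a, b). {a<..b::real})" by (metis rangeI)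
  qed
  have "range (\<lambda>(a, b). {a<..b::real}) \<subseteq> Pow UNIV" by simp
  from stable this A_gen show ?thesis
  proof (induction rule: sigma_sets_induct_disjoint)
    case (basic B)
    then obtain a b where B: "B = {a<..b}" by auto
    show ?case
    proof (cases "b < 1")
      case True
      have eq: "B \<inter> {0<..<1} = {max a 0<..b}" using True by (auto simp: B)
      show ?thesis
      proof (cases "max a 0 \<le> b")
        case True
        then show ?thesis unfolding eq using \<open>b < 1\<close> by (intro Ioc) auto
      next
        case False
        then have none: "{max a 0<..b} = {}" by auto
        show ?thesis unfolding eq none by (rule empty)
      qed
    next
      case False
      then have eq: "B \<inter> {0<..<1} = {max a 0<..<1}" by (auto simp: B)
      show ?thesis
      proof (cases "max a 0 < 1")
        case True
        then show ?thesis unfolding eq by (intro tail) auto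
      next
        case False
        then have none: "{max a 0<..<1} = {}" by auto
        show ?thesis unfolding eq none by (rule empty)
      qed
    qed
  next
    case empty
    then show ?case using \<open>d {} = 0\<close> by simp
  next
    case (compl B)
    have B: "B \<in> sets borel" using compl(1) by (subst borel_sigma_sets_Ioc) simp
    have "d ((B \<inter> {0<..<1}) \<union> ((UNIV - B) \<inter> {0<..<1})) = d (B \<inter> {0<..<1}) + d ((UNIV - B) \<inter> {0<..<1})"
      using B by (intro signed_measure_Un[OF d] sets) auto
    moreover have "(B \<inter> {0<..<1}) \<union> ((UNIV - B) \<inter> {0<..<1}) = {0<..<1}" by auto
    ultimately show ?case using compl(2) tail[of 0] by simp
  next
    case (union B)
    have B: "B i \<in> sets borel" for i using union(2) by (subst borel_sigma_sets_Ioc) auto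
    have "(\<lambda>i. d (B i \<inter> {0<..<1})) sums d (\<Union>i. B i \<inter> {0<..<1})"
      using union(1) by (intro d_sums) (auto simp: disjoint_family_on_def intro!: sets B)
    moreover have "(\<Union>i. B i \<inter> {0<..<1}) = (\<Union>i. B i) \<inter> {0<..<1}" by auto
    ultimately show ?case using union(3) by (simp add: sums_0 sums_unique2)
  qed
qed

text \<open>A set that contains neither endpoint lies in the open interval; one that contains both is the
complement of such a set, and both measures give \<open>{0..1}\<close> the mass zero.\<close>

lemma second_deriv_measure_agree:
  fixes f :: "real \<Rightarrow> real ^ 'n"
  assumes m: "second_deriv_measure f m" "second_deriv_measure f m'"
  shows "agree_up_to_endpoints m m'"
  unfolding agree_up_to_endpoints_def
proof (intro ballI impI)
  fix A :: "real set" assume A: "A \<in> sets unit_borel" "0 \<in> A \<longleftrightarrow> 1 \<in> A"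
  have A': "A \<in> sets borel" "A \<subseteq> {0..1}" using A(1) by (auto simp: sets_restrict_space_iff)
  have sm: "signed_measure unit_borel (\<lambda>A. m A $ j)" "signed_measure unit_borel (\<lambda>A. m' A $ j)" for j
    using m by (auto simp: second_deriv_measure_def vec_signed_measure_def)
  have dm: "signed_measure unit_borel (\<lambda>A. m A $ j - m' A $ j)" for j
    using sm[of j] unfolding signed_measure_def by (auto intro!: sums_diff)
  have inner: "m (B \<inter> {0<..<1}) $ j = m' (B \<inter> {0<..<1}) $ j" if "B \<in> sets borel" for B j
  proof -
    have "m (B \<inter> {0<..<1}) $ j - m' (B \<inter> {0<..<1}) $ j = 0"
      by (rule signed_measure_eq_0_open_interval[OF dm _ that])
        (use m in \<open>auto simp: second_deriv_measure_def\<close>)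
    then show ?thesis by simp
  qed
  have "m A $ j = m' A $ j" for j
  proof (cases "0 \<in> A")
    case False
    then have "A = A \<inter> {0<..<1}" using A A' by (auto simp: less_le)
    then show ?thesis using inner[OF A'(1)] by metis
  next
    case True
    define B where "B = (- A) \<inter> {0<..<1}"
    have B: "B \<in> sets unit_borel" using A' by (auto simp: B_def sets_restrict_space_iff)
    have "A \<union> B = {0..1}" "A \<inter> B = {}" using True A A' by (auto simp: B_def less_le)
    then have "m {0..1} $ j = m A $ j + m B $ j" "m' {0..1} $ j = m' A $ j + m' B $ j"
      using signed_measure_Un[OF sm(1) A(1) B] signed_measure_Un[OF sm(2) A(1) B] by metis+
    moreover have "m {0..1} = m' {0..1}" using m by (simp add: second_deriv_measure_def)
    moreover have "m B $ j = m' B $ j" unfolding B_def using A' by (intro inner) auto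
    ultimately show ?thesis by simp
  qed
  then show "m A = m' A" by (simp add: vec_eq_iff)
qed

lemma open_second_deriv_measure_unique:
  fixes f :: "real \<Rightarrow> real ^ 'n"
  assumes m: "open_second_deriv_measure f m" "open_second_deriv_measure f m'"
  shows "m = m'"
proof
  fix A :: "real set"
  have sd: "second_deriv_measure f m" "second_deriv_measure f m'"
    and ends: "m {0} = m' {0}" "m {1} = m' {1}"
    using m by (auto simp: open_second_deriv_measure_def)
  have sm: "signed_measure unit_borel (\<lambda>A. m A $ j)" "signed_measure unit_borel (\<lambda>A. m' A $ j)" for j
    using sd by (auto simp: second_deriv_measure_def vec_signed_measure_def)
  have add: "m (A \<union> B) = m A + m B" "m' (A \<union> B) = m' A + m' B"
    if "A \<in> sets unit_borel" "B \<in> sets unit_borel" "A \<inter> B = {}" for A B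
    using signed_measure_Un[OF sm(1) that] signed_measure_Un[OF sm(2) that] by (auto simp: vec_eq_iff)
  show "m A = m' A"
  proof (cases "A \<in> sets unit_borel")
    case False
    then show ?thesis using sm by (auto simp: signed_measure_def vec_eq_iff)
  next
    case True
    have zero: "m {} = m' {}" using sm by (auto simp: signed_measure_def vec_eq_iff)
    have point: "A \<inter> {x} \<in> sets unit_borel" if "x \<in> {0..1}" for x
      using True that by (auto simp: sets_restrict_space_iff)
    have open_part: "A - {0, 1} \<in> sets unit_borel" using True by (auto simp: sets_restrict_space_iff)
    have parts: "m (A \<inter> {0}) = m' (A \<inter> {0})" "m (A \<inter> {1}) = m' (A \<inter> {1})"
      using ends zero by (cases "0 \<in> A"; cases "1 \<in> A"; simp)+
    have open_eq: "m (A - {0, 1}) = m' (A - {0, 1})"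
      using second_deriv_measure_agree[OF sd] open_part by (auto simp: agree_up_to_endpoints_def)
    have ends_set: "(A \<inter> {0}) \<union> (A \<inter> {1}) \<in> sets unit_borel" using point by (intro sets.Un) auto
    have "A = (A - {0, 1}) \<union> ((A \<inter> {0}) \<union> (A \<inter> {1}))" by auto
    moreover have "m ((A - {0, 1}) \<union> ((A \<inter> {0}) \<union> (A \<inter> {1}))) = m' ((A - {0, 1}) \<union> ((A \<inter> {0}) \<union> (A \<inter> {1})))"
    proof -
      have "(A - {0, 1}) \<inter> ((A \<inter> {0}) \<union> (A \<inter> {1})) = {}" "(A \<inter> {0}) \<inter> (A \<inter> {1}) = {}" by auto
      then show ?thesis
        using add[OF open_part ends_set] add[OF point[of 0] point[of 1]] parts open_eq by simp
    qed
    ultimately show ?thesis by metis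
  qed
qed

section \<open>Almost sure uniqueness of the nearest point\<close>

lemma AE_eq_0_of_set_integrals:
  fixes g :: "'b \<Rightarrow> real"
  assumes g: "integrable M g" and zero: "\<And>U. U \<in> sets M \<Longrightarrow> (\<integral>x. indicator U x * g x \<partial>M) = 0"
  shows "AE x in M. g x = 0"
proof -
  have [measurable]: "g \<in> borel_measurable M" using g by simp
  define P where "P = {x \<in> space M. 0 \<le> g x}"
  have P [measurable]: "P \<in> sets M" "space M - P \<in> sets M" unfolding P_def by measurable
  have int: "integrable M (\<lambda>x. indicator U x * g x)" if "U \<in> sets M" for U
    using integrable_real_mult_indicator[OF that g] by (simp add: mult.commute)
  have "(\<integral>x. \<bar>g x\<bar> \<partial>M) = (\<integral>x. indicator P x * g x - indicator (space M - P) x * g x \<partial>M)"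
    by (rule Bochner_Integration.integral_cong) (auto simp: P_def indicator_def)
  also have "\<dots> = 0"
    using int[OF P(1)] int[OF P(2)] zero[OF P(1)] zero[OF P(2)] by simp
  finally have "AE x in M. \<bar>g x\<bar> = 0"
    using g by (subst (asm) integral_nonneg_eq_0_iff_AE) auto
  then show ?thesis by eventually_elim simp
qed

text \<open>Using \<open>\<tau>1\<close> on an event \<open>U\<close> and \<open>\<tau>2\<close> off \<open>U\<close> gives a third nearest parameter. All three residuals have
mean zero by \<open>Z_mean_zero\<close>, so the difference of the first two has mean zero on every event.\<close>

lemma nearest_point_AE_unique:
  assumes "lipschitz_coupling M X k L f N Y \<tau>1" and "lipschitz_coupling M X k L f N Y \<tau>2"
  shows "AE w in N. f (\<tau>1 w) = f (\<tau>2 w)"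
proof -
  interpret A: lipschitz_coupling M X k L f N Y \<tau>1 by fact
  interpret B: lipschitz_coupling M X k L f N Y \<tau>2 by fact
  have mix: "A.N.expectation (\<lambda>w. indicator U w *\<^sub>R (A.Z w - B.Z w)) = 0" if U [measurable]: "U \<in> sets N" for U
  proof -
    define \<tau> where "\<tau> w = (if w \<in> U then \<tau>1 w else \<tau>2 w)" for w
    have "\<tau> \<in> borel_measurable N" unfolding \<tau>_def by measurable
    moreover have "\<forall>w\<in>space N. \<tau> w \<in> {0..1}" using A.tau_range B.tau_range by (auto simp: \<tau>_def)
    moreover have "AE w in N. norm (Y w - f (\<tau> w)) = infdist (Y w) (path_image f)"
      using A.Z_nearest B.Z_nearest by eventually_elim (simp add: \<tau>_def A.Z_def B.Z_def)
    ultimately have "nearest_coupling M X f N Y \<tau>"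
      using A.coupling by (simp add: nearest_coupling_def)
    then interpret C: lipschitz_coupling M X k L f N Y \<tau>
      by unfold_locales (assumption | rule A.f_lipschitz)+
    have int: "integrable N (\<lambda>w. indicator U w *\<^sub>R (A.Z w - B.Z w))"
      using A.Z_integrable B.Z_integrable by (intro integrable_mult_indicator) auto
    have "C.Z w = B.Z w + indicator U w *\<^sub>R (A.Z w - B.Z w)" for w
      by (simp add: A.Z_def B.Z_def C.Z_def \<tau>_def indicator_def)
    then have "A.N.expectation C.Z = A.N.expectation (\<lambda>w. B.Z w + indicator U w *\<^sub>R (A.Z w - B.Z w))"
      by presburger
    then show ?thesis
      using C.Z_mean_zero B.Z_mean_zero int B.Z_integrable by simp
  qed
  have "AE w in N. \<forall>b\<in>Basis. (A.Z w - B.Z w) \<bullet> b = 0"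
  proof (rule AE_finite_allI)
    fix b :: 'b assume "b \<in> Basis"
    show "AE w in N. (A.Z w - B.Z w) \<bullet> b = 0"
    proof (rule AE_eq_0_of_set_integrals)
      show "integrable N (\<lambda>w. (A.Z w - B.Z w) \<bullet> b)" using A.Z_integrable B.Z_integrable by simp
      fix U assume U: "U \<in> sets N"
      have "integrable N (\<lambda>w. indicator U w *\<^sub>R (A.Z w - B.Z w))"
        using A.Z_integrable B.Z_integrable U by (intro integrable_mult_indicator) auto
      then have "A.N.expectation (\<lambda>w. (indicator U w *\<^sub>R (A.Z w - B.Z w)) \<bullet> b) = 0"
        using mix[OF U] by (subst integral_inner_left) auto
      then show "A.N.expectation (\<lambda>w. indicator U w * ((A.Z w - B.Z w) \<bullet> b)) = 0" by simp
    qed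
  qed simp
  then show ?thesis
    by eventually_elim (auto simp: euclidean_all_zero_iff A.Z_def B.Z_def)
qed

text \<open>Replacing \<open>\<tau>\<close> by a measurable selection of nearest parameters changes \<open>f \<tau>\<close> on a null set only, after
which the mean depends on \<open>Y\<close> through its law alone.\<close>

lemma coupling_moment_eq_selection_moment:
  assumes coupling: "lipschitz_coupling M X k L f N Y \<tau>"
    and \<sigma> [measurable]: "\<sigma> \<in> borel_measurable borel" and \<sigma>_range: "\<And>x. \<sigma> x \<in> {0..1}"
    and nearest: "\<And>x. norm (x - f (\<sigma> x)) = infdist x (path_image f)"
  shows "(\<integral>w. (Y w - f (\<tau> w)) \<bullet> f (\<tau> w) \<partial>N) = (\<integral>w. (X w - f (\<sigma> (X w))) \<bullet> f (\<sigma> (X w)) \<partial>M)"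
proof -
  interpret C: lipschitz_coupling M X k L f N Y \<tau> by fact
  have "\<sigma> \<in> measurable borel (restrict_space borel {0..1})"
    using \<sigma>_range by (intro measurable_restrict_space2) auto
  from measurable_compose[OF this borel_measurable_continuous_on_restrict[OF C.f_continuous]]
  have f_\<sigma> [measurable]: "(\<lambda>x. f (\<sigma> x)) \<in> borel_measurable borel" .
  have "nearest_coupling M X f N Y (\<lambda>w. \<sigma> (Y w))"
    using C.coupling \<sigma>_range nearest by (simp add: nearest_coupling_def)
  then have "lipschitz_coupling M X k L f N Y (\<lambda>w. \<sigma> (Y w))"
    by unfold_locales (assumption | rule C.f_lipschitz)+
  from nearest_point_AE_unique[OF coupling this]
  have "(\<integral>w. (Y w - f (\<tau> w)) \<bullet> f (\<tau> w) \<partial>N) = (\<integral>w. (Y w - f (\<sigma> (Y w))) \<bullet> f (\<sigma> (Y w)) \<partial>N)"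
    by (intro integral_cong_AE) (auto elim: eventually_mono)
  also have "\<dots> = (\<integral>w. (X w - f (\<sigma> (X w))) \<bullet> f (\<sigma> (X w)) \<partial>M)"
    by (rule C.transfer_integral(1)[of "\<lambda>x. (x - f (\<sigma> x)) \<bullet> f (\<sigma> x)"]) measurable
  finally show ?thesis .
qed

lemma multiplier_unique:
  assumes "lipschitz_coupling M X k L f N Y \<tau>" and "lipschitz_coupling M X k L f N' Y' \<tau>'"
  shows "lipschitz_coupling.multiplier L f N Y \<tau> = lipschitz_coupling.multiplier L f N' Y' \<tau>'"
proof -
  interpret A: lipschitz_coupling M X k L f N Y \<tau> by fact
  interpret B: lipschitz_coupling M X k L f N' Y' \<tau>' by fact
  obtain \<sigma> where "\<sigma> \<in> borel_measurable borel" "\<And>x. \<sigma> x \<in> {0..1}"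
    "\<And>x. norm (x - f (\<sigma> x)) = infdist x (path_image f)"
    using exists_measurable_nearest_parameter[OF A.f_path] by blast
  from coupling_moment_eq_selection_moment[OF assms(1) this] coupling_moment_eq_selection_moment[OF assms(2) this]
  show ?thesis by (simp add: A.multiplier_def B.multiplier_def A.Z_def B.Z_def)
qed

section \<open>The second derivative\<close>

context lipschitz_coupling
begin

text \<open>An increment of the tail moment \<open>E (Z; \<tau> > t)\<close> is minus the moment of \<open>Z\<close> over \<open>\<tau> \<in> {s<..t}\<close>, which
explains the sign.\<close>

definition second_derivative :: "real set \<Rightarrow> 'a" where
  "second_derivative A = (if A \<in> sets unit_borel then - (moment A /\<^sub>R multiplier) else 0)"

lemma moment_Un:
  assumes "A \<in> sets borel" "B \<in> sets borel" "A \<inter> B = {}"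
  shows "moment (A \<union> B) = moment A + moment B"
proof -
  have int: "integrable N (\<lambda>w. indicator S (\<tau> w) *\<^sub>R Z w)" if "S \<in> sets borel" for S
    using that by (intro weighted_Z_integrable[of _ 1]) (auto simp: indicator_def)
  have "indicator (A \<union> B) t = (indicator A t + indicator B t :: real)" for t
    using assms(3) by (auto simp: indicator_def)
  then show ?thesis using int assms(1,2) by (simp add: moment_def scaleR_add_left)
qed

lemma moment_cong:
  assumes "\<And>t. t \<in> {0..1} \<Longrightarrow> t \<in> A \<longleftrightarrow> t \<in> B"
  shows "moment A = moment B"
  unfolding moment_def
  by (rule Bochner_Integration.integral_cong) (use assms tau_range in \<open>auto simp: indicator_def\<close>)

lemma moment_unit: "moment {0..1} = 0"
proof -
  have "moment {0..1} = N.expectation Z"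
    unfolding moment_def
    by (rule Bochner_Integration.integral_cong) (use tau_range in \<open>auto simp: indicator_def\<close>)
  then show ?thesis by (simp add: Z_mean_zero)
qed

lemma unit_borel_sets: "A \<in> sets borel \<Longrightarrow> A \<subseteq> {0..1} \<Longrightarrow> A \<in> sets unit_borel"
  by (subst sets_restrict_space_iff) auto

lemma second_derivative_Ioc:
  assumes "0 \<le> s" "s \<le> t" "t < 1"
  shows "second_derivative {s<..t} = right_deriv f t - right_deriv f s"
proof -
  have "moment {s<..} = moment {s<..t} + moment {t<..}"
    using assms by (subst moment_Un[symmetric]) (auto intro!: arg_cong[of _ _ moment])
  moreover have "{s<..t} \<in> sets unit_borel" using assms by (intro unit_borel_sets) auto
  ultimately show ?thesis
    using assms by (simp add: right_deriv_eq second_derivative_def slope_def algebra_simps)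
qed

lemma second_derivative_unit: "second_derivative {0..1} = 0"
  by (simp add: second_derivative_def moment_unit)

lemma second_derivative_ends:
  assumes "k = Open_Curves"
  shows "second_derivative {0} = right_deriv f 0" and "second_derivative {1} = - left_deriv f 1"
proof -
  have closing: "closing = 0" unfolding closing_def using assms by simp
  have "moment {0} + moment {0<..} = moment {0..1}"
    by (subst moment_Un[symmetric]) (auto intro!: moment_cong)
  then have "moment {0} = - moment {0<..}" by (simp add: moment_unit eq_neg_iff_add_eq_0)
  moreover have "{0} \<in> sets unit_borel" "{1} \<in> sets unit_borel" by (auto intro!: unit_borel_sets)
  moreover have "moment {1} = moment {1..}" by (auto intro!: moment_cong)
  ultimately show "second_derivative {0} = right_deriv f 0" "second_derivative {1} = - left_deriv f 1"
    by (simp_all add: right_deriv_eq left_deriv_eq second_derivative_def slope_def closing)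
qed

end

lemma second_derivative_vec_signed_measure:
  fixes f :: "real \<Rightarrow> real ^ 'n"
  assumes "lipschitz_coupling M X k L f N Y \<tau>"
  shows "vec_signed_measure unit_borel (lipschitz_coupling.second_derivative L f N Y \<tau>)"
    and "g \<in> borel_measurable unit_borel \<Longrightarrow> bounded (g ` {0..1}) \<Longrightarrow>
      (\<integral>w. (Y w - f (\<tau> w)) \<bullet> g (\<tau> w) \<partial>N) = - lipschitz_coupling.multiplier L f N Y \<tau>
        * vec_signed_integral unit_borel (lipschitz_coupling.second_derivative L f N Y \<tau>) g"
proof -
  interpret C: lipschitz_coupling M X k L f N Y \<tau> by fact
  define z where "z j w = - (C.Z w $ j / C.multiplier)" for j w
  have Z_j: "integrable N (\<lambda>w. C.Z w $ j)" for j
    using integrable_inner_left[OF C.Z_integrable, of "axis j 1"] by (simp add: inner_axis)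
  have z: "integrable N (z j)" for j unfolding z_def using Z_j by simp
  have comp: "C.second_derivative A $ j = (\<integral>w. z j w * indicator A (\<tau> w) \<partial>N)" if A: "A \<in> sets unit_borel" for A j
  proof -
    have A': "A \<in> sets borel" using A by (auto simp: sets_restrict_space_iff)
    have int: "integrable N (\<lambda>w. indicator A (\<tau> w) *\<^sub>R C.Z w)"
      using A' by (intro C.weighted_Z_integrable[of _ 1]) (auto simp: indicator_def)
    have "C.moment A $ j = C.moment A \<bullet> axis j 1" by (simp add: inner_axis)
    also have "\<dots> = (\<integral>w. (indicator A (\<tau> w) *\<^sub>R C.Z w) \<bullet> axis j 1 \<partial>N)"
      unfolding C.moment_def using int by (subst integral_inner_left) auto
    also have "\<dots> = (\<integral>w. indicator A (\<tau> w) * C.Z w $ j \<partial>N)" by (simp add: inner_axis)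
    finally have "C.second_derivative A $ j = (- 1 / C.multiplier) * (\<integral>w. indicator A (\<tau> w) * C.Z w $ j \<partial>N)"
      using A by (simp add: C.second_derivative_def divide_inverse mult.commute)
    also have "\<dots> = (\<integral>w. (- 1 / C.multiplier) * (indicator A (\<tau> w) * C.Z w $ j) \<partial>N)" by simp
    also have "\<dots> = (\<integral>w. z j w * indicator A (\<tau> w) \<partial>N)"
      by (rule Bochner_Integration.integral_cong) (auto simp: z_def)
    finally show ?thesis .
  qed
  have zero: "C.second_derivative A $ j = 0" if "A \<notin> sets unit_borel" for A j
    using that by (simp add: C.second_derivative_def)
  show "vec_signed_measure unit_borel C.second_derivative"
    unfolding vec_signed_measure_def
    using weighted_law_signed_measure(1)[OF C.N.prob_space_axioms C.tau_measurable_restrict z comp zero] by blast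
  assume g: "g \<in> borel_measurable unit_borel" "bounded (g ` {0..1})"
  obtain B where "\<forall>x\<in>g ` {0..1}. norm x \<le> B" using g(2) unfolding bounded_iff by blast
  then have B: "\<And>t. t \<in> {0..1} \<Longrightarrow> norm (g t) \<le> B" by blast
  have g_j: "(\<lambda>t. g t $ j) \<in> borel_measurable unit_borel" for j
    using borel_measurable_inner[OF g(1) borel_measurable_const[of "axis j 1"]] by (simp add: inner_axis)
  have B_j: "\<bar>g t $ j\<bar> \<le> B" if "t \<in> space unit_borel" for t j
    using B[of t] component_le_norm_cart[of "g t" j] that by (simp add: space_restrict_space)
  have int_j: "integrable N (\<lambda>w. C.Z w $ j * g (\<tau> w) $ j)" for j
  proof (rule integrable_mult_bounded[OF Z_j])
    show "(\<lambda>w. g (\<tau> w) $ j) \<in> borel_measurable N"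
      using measurable_compose[OF C.tau_measurable_restrict g_j] .
    show "\<bar>g (\<tau> w) $ j\<bar> \<le> B" if "w \<in> space N" for w
      using B_j[of "\<tau> w" j] C.tau_range[OF that] by (simp add: space_restrict_space)
  qed
  have comp_integral: "signed_integral unit_borel (\<lambda>A. C.second_derivative A $ j) (\<lambda>t. g t $ j)
      = (\<integral>w. z j w * g (\<tau> w) $ j \<partial>N)" for j
    by (rule weighted_law_signed_measure(2)[OF C.N.prob_space_axioms C.tau_measurable_restrict z comp zero g_j B_j])
  have "- C.multiplier * vec_signed_integral unit_borel C.second_derivative g
      = (\<Sum>j\<in>UNIV. - C.multiplier * (\<integral>w. z j w * g (\<tau> w) $ j \<partial>N))"
    unfolding vec_signed_integral_def comp_integral by (simp add: sum_distrib_left)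
  also have "\<dots> = (\<Sum>j\<in>UNIV. \<integral>w. C.Z w $ j * g (\<tau> w) $ j \<partial>N)"
  proof (rule sum.cong[OF refl])
    fix j
    have "(\<integral>w. - C.multiplier * (z j w * g (\<tau> w) $ j) \<partial>N) = (\<integral>w. C.Z w $ j * g (\<tau> w) $ j \<partial>N)"
      using C.multiplier_pos by (intro Bochner_Integration.integral_cong) (auto simp: z_def)
    then show "- C.multiplier * (\<integral>w. z j w * g (\<tau> w) $ j \<partial>N) = (\<integral>w. C.Z w $ j * g (\<tau> w) $ j \<partial>N)"
      by simp
  qed
  also have "\<dots> = (\<integral>w. (\<Sum>j\<in>UNIV. C.Z w $ j * g (\<tau> w) $ j) \<partial>N)"
    using int_j by simp
  also have "\<dots> = (\<integral>w. (Y w - f (\<tau> w)) \<bullet> g (\<tau> w) \<partial>N)"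
    by (simp add: inner_vec_def C.Z_def)
  finally show "(\<integral>w. (Y w - f (\<tau> w)) \<bullet> g (\<tau> w) \<partial>N) = - C.multiplier
        * vec_signed_integral unit_borel C.second_derivative g" by simp
qed

theorem theorem3p1:
  fixes M :: "'w measure" and X :: "'w \<Rightarrow> real ^ 'n" and k :: curve_kind
    and L :: real and f :: "real \<Rightarrow> real ^ 'n"
  assumes "prob_space M"
    and "X \<in> borel_measurable M"
    and "integrable M (\<lambda>w. (norm (X w))\<^sup>2)"
    and "L > 0"
    and "optimal_value M X k L > 0"
    and "f \<in> curves_upto k L"
    and "mean_sq_dist M X f = optimal_value M X k L"
  shows "curve_length f = ennreal L \<and>
    (L-lipschitz_on {0..1} f \<longrightarrow>
      (\<forall>t\<in>{0..<1}. f differentiable (at_right t) \<and> norm (right_deriv f t) = L) \<and>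
      (\<forall>t\<in>{0<..1}. f differentiable (at_left t) \<and> norm (left_deriv f t) = L) \<and>
      (\<exists>f''. second_deriv_measure f f'' \<and>
        (\<forall>m. second_deriv_measure f m \<longrightarrow> agree_up_to_endpoints m f'') \<and>
        (k = Open_Curves \<longrightarrow>
          open_second_deriv_measure f f'' \<and>
          (\<forall>m. open_second_deriv_measure f m \<longrightarrow> m = f'')) \<and>
        (\<exists>!lam. lam > 0 \<and> (\<exists>N Y \<tau>. projection_parameter M X f f'' lam N Y \<tau>))))"
proof -
  interpret prob_space M by fact
  interpret optimal_curve M X k L f by unfold_locales fact+
  obtain \<sigma> where \<sigma> [measurable]: "\<sigma> \<in> borel_measurable borel" and \<sigma>_range: "\<And>x. \<sigma> x \<in> {0..1}"
    and nearest: "\<And>x. norm (x - f (\<sigma> x)) = infdist x (path_image f)"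
    using exists_measurable_nearest_parameter[OF f_path] by blast
  \<comment> \<open>The law of \<open>(X, 0)\<close> is an extension of the required type, with \<open>fst\<close> as the copy of \<open>X\<close>.\<close>
  define N :: "((real ^ 'n) \<times> real) measure" where "N = distr M borel (\<lambda>w. (X w, 0))"
  define \<tau> where "\<tau> w = \<sigma> (fst w)" for w :: "(real ^ 'n) \<times> real"
  have emb [measurable]: "(\<lambda>w. (X w, 0 :: real)) \<in> borel_measurable M" by measurable
  have N_prob: "prob_space N" unfolding N_def by (rule prob_space_distr) (rule emb)
  have fst_meas: "fst \<in> borel_measurable (borel :: ((real ^ 'n) \<times> real) measure)"
    by (intro borel_measurable_continuous_onI continuous_intros)
  have "distr N borel fst = distr M borel X"
    unfolding N_def by (subst distr_distr[OF fst_meas emb]) (simp add: comp_def)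
  moreover have "\<tau> \<in> borel_measurable N"
    unfolding \<tau>_def N_def using measurable_compose[OF fst_meas \<sigma>] by simp
  ultimately have coupling: "nearest_coupling M X f N fst \<tau>"
    using N_prob fst_meas \<sigma>_range nearest
    by (simp add: nearest_coupling_def prob_extension_def \<tau>_def N_def)
  interpret N: prob_space N by (rule N_prob)
  interpret optimal_coupling M X k L f N fst \<tau> by unfold_locales (rule coupling)
  have conclusion: "(\<forall>t\<in>{0..<1}. f differentiable (at_right t) \<and> norm (right_deriv f t) = L) \<and>
      (\<forall>t\<in>{0<..1}. f differentiable (at_left t) \<and> norm (left_deriv f t) = L) \<and>
      (\<exists>f''. second_deriv_measure f f'' \<and>
        (\<forall>m. second_deriv_measure f m \<longrightarrow> agree_up_to_endpoints m f'') \<and>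
        (k = Open_Curves \<longrightarrow>
          open_second_deriv_measure f f'' \<and>
          (\<forall>m. open_second_deriv_measure f m \<longrightarrow> m = f'')) \<and>
        (\<exists>!lam. lam > 0 \<and> (\<exists>N Y \<tau>. projection_parameter M X f f'' lam N Y \<tau>)))"
    if lip: "L-lipschitz_on {0..1} f"
  proof -
    interpret C: lipschitz_coupling M X k L f N fst \<tau> by unfold_locales (rule lip)
    note C_axioms = C.lipschitz_coupling_axioms
    define f'' where "f'' = C.second_derivative"
    have sd: "second_deriv_measure f f''"
      unfolding second_deriv_measure_def f''_def
      using second_derivative_vec_signed_measure(1)[OF C_axioms] C.second_derivative_Ioc C.second_derivative_unit
      by blast
    have osd: "open_second_deriv_measure f f''" if "k = Open_Curves"
      using sd C.second_derivative_ends[OF that] by (simp add: open_second_deriv_measure_def f''_def)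
    have param: "projection_parameter M X f f'' C.multiplier N fst \<tau>"
      using coupling second_derivative_vec_signed_measure(2)[OF C_axioms]
      by (simp add: projection_parameter_def nearest_coupling_def f''_def)
    have f_meas: "f \<in> borel_measurable unit_borel"
      by (rule borel_measurable_continuous_on_restrict[OF f_continuous])
    have f_bdd: "bounded (f ` {0..1})" using bounded_path_image[OF f_path] by (simp add: path_image_def)
    \<comment> \<open>Testing with \<open>g = f\<close> gives \<open>E (Z \<bullet> f \<tau>)\<close>, which is the same nonzero number for every parameter.\<close>
    have unique: "lam = C.multiplier" if p: "projection_parameter M X f f'' lam N' Y' \<tau>'"
      for lam and N' :: "((real ^ 'n) \<times> real) measure" and Y' \<tau>'
    proof -
      have nc: "nearest_coupling M X f N' Y' \<tau>'"
        using p by (simp add: projection_parameter_def nearest_coupling_def)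
      interpret N': prob_space N' using nc by (simp add: nearest_coupling_def prob_extension_def)
      interpret D: lipschitz_coupling M X k L f N' Y' \<tau>'
        by unfold_locales (rule nc, rule lip)
      have "(\<integral>w. (Y' w - f (\<tau>' w)) \<bullet> f (\<tau>' w) \<partial>N') = - lam * vec_signed_integral unit_borel f'' f"
        using p f_meas f_bdd by (simp add: projection_parameter_def)
      moreover have "(\<integral>w. (Y' w - f (\<tau>' w)) \<bullet> f (\<tau>' w) \<partial>N') = D.multiplier * L\<^sup>2"
        using L_pos by (simp add: D.multiplier_def D.Z_def)
      moreover have "D.multiplier = C.multiplier"
        by (rule multiplier_unique[OF D.lipschitz_coupling_axioms C_axioms])
      moreover have "C.multiplier * L\<^sup>2 = (\<integral>w. (fst w - f (\<tau> w)) \<bullet> f (\<tau> w) \<partial>N)"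
        using L_pos by (simp add: C.multiplier_def Z_def)
      moreover have "\<dots> = - C.multiplier * vec_signed_integral unit_borel f'' f"
        unfolding f''_def by (rule second_derivative_vec_signed_measure(2)[OF C_axioms f_meas f_bdd])
      ultimately have "lam * vec_signed_integral unit_borel f'' f
          = C.multiplier * vec_signed_integral unit_borel f'' f"
        and "C.multiplier * vec_signed_integral unit_borel f'' f = - (C.multiplier * L\<^sup>2)" by auto
      moreover have "C.multiplier * L\<^sup>2 \<noteq> 0" using C.multiplier_pos L_pos by simp
      ultimately show ?thesis by (metis mult_right_cancel mult_zero_right neg_equal_0_iff_equal)
    qed
    have right: "f differentiable (at_right t)" "norm (right_deriv f t) = L" if "t \<in> {0..<1}" for t
      using C.right_derivative[OF that] C.right_deriv_eq[OF that]
      by (auto simp: differentiable_def has_vector_derivative_def)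
    have left: "f differentiable (at_left t)" "norm (left_deriv f t) = L" if "t \<in> {0<..1}" for t
      using C.left_derivative[OF that] C.left_deriv_eq[OF that]
      by (auto simp: differentiable_def has_vector_derivative_def)
    have ex1: "\<exists>!lam. lam > 0 \<and> (\<exists>N Y \<tau>. projection_parameter M X f f'' lam N Y \<tau>)"
    proof (rule ex1I[of _ C.multiplier])
      show "C.multiplier > 0 \<and> (\<exists>N Y \<tau>. projection_parameter M X f f'' C.multiplier N Y \<tau>)"
        using C.multiplier_pos param by blast
      show "lam = C.multiplier"
        if "lam > 0 \<and> (\<exists>N Y \<tau>. projection_parameter M X f f'' lam N Y \<tau>)" for lam
        using that by (elim conjE exE) (rule unique)
    qed
    show ?thesis
    proof (intro conjI ballI)
      show "f differentiable (at_right t)" "norm (right_deriv f t) = L" if "t \<in> {0..<1}" for t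
        by (rule right[OF that])+
      show "f differentiable (at_left t)" "norm (left_deriv f t) = L" if "t \<in> {0<..1}" for t
        by (rule left[OF that])+
      show "\<exists>f''. second_deriv_measure f f'' \<and>
        (\<forall>m. second_deriv_measure f m \<longrightarrow> agree_up_to_endpoints m f'') \<and>
        (k = Open_Curves \<longrightarrow>
          open_second_deriv_measure f f'' \<and>
          (\<forall>m. open_second_deriv_measure f m \<longrightarrow> m = f'')) \<and>
        (\<exists>!lam. lam > 0 \<and> (\<exists>N Y \<tau>. projection_parameter M X f f'' lam N Y \<tau>))"
      proof (intro exI[of _ f''] conjI allI impI)
        show "agree_up_to_endpoints m f''" if "second_deriv_measure f m" for m
          by (rule second_deriv_measure_agree[OF that sd])
        show "m = f''" if "k = Open_Curves" "open_second_deriv_measure f m" for m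
          by (rule open_second_deriv_measure_unique[OF that(2) osd[OF that(1)]])
      qed (fact sd osd ex1 | rule osd, assumption)+
    qed
  qed
  show ?thesis by (rule conjI[OF curve_length_eq impI[OF conclusion]])
qed

end
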